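(* The quotient $C^*$-algebra $C^*(z)/\mathcal{K}$ is isomorphic (as a $C^*$-algebra) to $C(S^1)\oplus C(S^1)\oplus C(S^1)$.
   Context: Fix real numbers $a, r_1, r_2$ with $r_1, r_2 > 0$, $0<a<1$, $a+r_2<1$ and $r_1+r_2<a$. The closed pair of pants is $$PP_{(a,r_1,r_2)} = \{\zeta\in\mathbb{C} : |\zeta|\le 1,\ |\zeta|\ge r_1,\ |\zeta-a|\ge r_2\}.$$ Define functions $E_n(\zeta)=\zeta^n$ for $n\ge 0$, and $F_n(\zeta)=(\zeta/r_1)^n$, $G_n(\zeta)=((\zeta-a)/r_2)^n$ for $n\le -1$. Let $H$ be the Hilbert space of holomorphic functions on the interior of $PP_{(a,r_1,r_2)}$ of the form $$\varphi=\sum_{n=0}^\infty e_nE_n+\sum_{n=-\infty}^{-1}(f_nF_n+g_nG_n),\qquad \|\varphi\|^2=\sum_{n=0}^\infty|e_n|^2+\sum_{n=-\infty}^{-1}(|f_n|^2+|g_n|^2)<\infty,$$ so that $\{E_n\}_{n\ge0}\cup\{F_n\}_{n\le-1}\cup\{G_n\}_{n\le-1}$ is an orthonormal basis of $H$. The operator $z:H\to H$ is multiplication by the coordinate: $(z\varphi)(\zeta)=\zeta\varphi(\zeta)$. Equivalently, $zE_n=E_{n+1}$ for $n\ge0$; $zF_n=r_1F_{n+1}$ for $n\le-2$, $zF_{-1}=r_1E_0$; $zG_n=r_2G_{n+1}+aG_n$ for $n\le-2$, $zG_{-1}=r_2E_0+aG_{-1}$. $C^*(z)$ denotes the $C^*$-algebra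 of bounded operators on $H$ generated by $z$; $\mathcal{K}$ is the ideal of compact operators on $H$, which is contained in $C^*(z)$ (it is the commutator ideal of $C^*(z)$). $C(S^1)$ is the $C^*$-algebra of continuous complex-valued functions on the unit circle. *)

theory Defs
  imports "HOL-Complex_Analysis.Complex_Analysis"
begin

section \<open>C*-algebras as concrete structures\<close>

text \<open>C*-algebras are not assumed to be unital, so there is no field for a unit.\<close>

record 'a cstar =
  cs_carrier :: "'a set"
  cs_add :: "'a \<Rightarrow> 'a \<Rightarrow> 'a"
  cs_scale :: "complex \<Rightarrow> 'a \<Rightarrow> 'a"
  cs_mult :: "'a \<Rightarrow> 'a \<Rightarrow> 'a"
  cs_star :: "'a \<Rightarrow> 'a"
  cs_norm :: "'a \<Rightarrow> real"

definition cstar_isomorphic :: "'a cstar \<Rightarrow> 'b cstar \<Rightarrow> bool" where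
  "cstar_isomorphic A B \<longleftrightarrow>
     (\<exists>h. bij_betw h (cs_carrier A) (cs_carrier B) \<and>
        (\<forall>x\<in>cs_carrier A. \<forall>y\<in>cs_carrier A. h (cs_add A x y) = cs_add B (h x) (h y)) \<and>
        (\<forall>c. \<forall>x\<in>cs_carrier A. h (cs_scale A c x) = cs_scale B c (h x)) \<and>
        (\<forall>x\<in>cs_carrier A. \<forall>y\<in>cs_carrier A. h (cs_mult A x y) = cs_mult B (h x) (h y)) \<and>
        (\<forall>x\<in>cs_carrier A. h (cs_star A x) = cs_star B (h x)) \<and>
        (\<forall>x\<in>cs_carrier A. cs_norm B (h x) = cs_norm A x))"

definition cs_coset :: "'a cstar \<Rightarrow> 'a set \<Rightarrow> 'a \<Rightarrow> 'a set" where
  "cs_coset A J x = (\<lambda>k. cs_add A x k) ` J"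

text \<open>The unions run over all representatives; when \<open>J\<close> is a closed two-sided ideal, all
  members of each union are the same coset.\<close>

definition cs_quotient :: "'a cstar \<Rightarrow> 'a set \<Rightarrow> 'a set cstar" where
  "cs_quotient A J =
     \<lparr>cs_carrier = cs_coset A J ` cs_carrier A,
      cs_add = (\<lambda>X Y. \<Union>x\<in>X. \<Union>y\<in>Y. cs_coset A J (cs_add A x y)),
      cs_scale = (\<lambda>c X. \<Union>x\<in>X. cs_coset A J (cs_scale A c x)),
      cs_mult = (\<lambda>X Y. \<Union>x\<in>X. \<Union>y\<in>Y. cs_coset A J (cs_mult A x y)),
      cs_star = (\<lambda>X. \<Union>x\<in>X. cs_coset A J (cs_star A x)),
      cs_norm = (\<lambda>X. INF x\<in>X. cs_norm A x)\<rparr>"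

definition cs_dsum :: "'a cstar \<Rightarrow> 'b cstar \<Rightarrow> ('a \<times> 'b) cstar"  (infixr \<open>\<oplus>\<^sub>C\<close> 65) where
  "A \<oplus>\<^sub>C B =
     \<lparr>cs_carrier = cs_carrier A \<times> cs_carrier B,
      cs_add = (\<lambda>x y. (cs_add A (fst x) (fst y), cs_add B (snd x) (snd y))),
      cs_scale = (\<lambda>c x. (cs_scale A c (fst x), cs_scale B c (snd x))),
      cs_mult = (\<lambda>x y. (cs_mult A (fst x) (fst y), cs_mult B (snd x) (snd y))),
      cs_star = (\<lambda>x. (cs_star A (fst x), cs_star B (snd x))),
      cs_norm = (\<lambda>x. max (cs_norm A (fst x)) (cs_norm B (snd x)))\<rparr>"

text \<open>A function on a subset of the complex plane is represented by its extension by zero, so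
  that distinct elements of the function spaces below are distinct as HOL functions.\<close>

definition C_circle :: "(complex \<Rightarrow> complex) cstar" where
  "C_circle =
     \<lparr>cs_carrier = {f. continuous_on (sphere 0 1) f \<and> (\<forall>\<zeta>. \<zeta> \<notin> sphere 0 1 \<longrightarrow> f \<zeta> = 0)},
      cs_add = (\<lambda>f g \<zeta>. f \<zeta> + g \<zeta>),
      cs_scale = (\<lambda>c f \<zeta>. c * f \<zeta>),
      cs_mult = (\<lambda>f g \<zeta>. f \<zeta> * g \<zeta>),
      cs_star = (\<lambda>f \<zeta>. cnj (f \<zeta>)),
      cs_norm = (\<lambda>f. SUP \<zeta>\<in>sphere 0 1. cmod (f \<zeta>))\<rparr>"

section \<open>The Hilbert space of the pair of pants\<close>

text \<open>\<open>idxE n\<close> indexes $E_n$, while \<open>idxF n\<close> and \<open>idxG n\<close> index $F_{-(n+1)}$ and $G_{-(n+1)}$.\<close>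

datatype pants_idx = idxE nat | idxF nat | idxG nat

type_synonym operator = "(complex \<Rightarrow> complex) \<Rightarrow> (complex \<Rightarrow> complex)"

context
  fixes a r1 r2 :: real
begin

definition pants :: "complex set" where
  "pants = {\<zeta>. cmod \<zeta> \<le> 1 \<and> cmod \<zeta> \<ge> r1 \<and> cmod (\<zeta> - of_real a) \<ge> r2}"

primrec pants_basis :: "pants_idx \<Rightarrow> complex \<Rightarrow> complex" where
  "pants_basis (idxE n) \<zeta> = \<zeta> ^ n"
| "pants_basis (idxF n) \<zeta> = (\<zeta> / of_real r1) powi (- (int n + 1))"
| "pants_basis (idxG n) \<zeta> = ((\<zeta> - of_real a) / of_real r2) powi (- (int n + 1))"

definition pants_expansion :: "(pants_idx \<Rightarrow> complex) \<Rightarrow> (complex \<Rightarrow> complex) \<Rightarrow> bool" where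
  "pants_expansion c \<phi> \<longleftrightarrow>
     (\<lambda>i. (cmod (c i))\<^sup>2) summable_on UNIV \<and>
     (\<forall>\<zeta>\<in>interior pants. ((\<lambda>i. c i * pants_basis i \<zeta>) has_sum \<phi> \<zeta>) UNIV)"

definition pants_H :: "(complex \<Rightarrow> complex) set" where
  "pants_H = {\<phi>. \<phi> holomorphic_on interior pants \<and> (\<forall>\<zeta>. \<zeta> \<notin> interior pants \<longrightarrow> \<phi> \<zeta> = 0) \<and>
                 (\<exists>c. pants_expansion c \<phi>)}"

text \<open>The expansion of an element of \<^const>\<open>pants_H\<close> is unique (Laurent decomposition on a
  domain with two holes), so the coefficients below are well defined and \<^const>\<open>pants_basis\<close>
  becomes an orthonormal basis.\<close>

definition pants_coeff :: "(complex \<Rightarrow> complex) \<Rightarrow> pants_idx \<Rightarrow> complex" where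
  "pants_coeff \<phi> = (THE c. pants_expansion c \<phi>)"

definition pants_inner :: "(complex \<Rightarrow> complex) \<Rightarrow> (complex \<Rightarrow> complex) \<Rightarrow> complex" where
  "pants_inner \<phi> \<psi> = (\<Sum>\<^sub>\<infinity>i. pants_coeff \<phi> i * cnj (pants_coeff \<psi> i))"

definition pants_norm :: "(complex \<Rightarrow> complex) \<Rightarrow> real" where
  "pants_norm \<phi> = sqrt (\<Sum>\<^sub>\<infinity>i. (cmod (pants_coeff \<phi> i))\<^sup>2)"

subsection \<open>Operators\<close>

text \<open>An operator on \<^const>\<open>pants_H\<close> is extended by the zero function to arguments
  outside \<^const>\<open>pants_H\<close>; this is preserved by sums, multiples and composition.\<close>

definition bounded_ops :: "operator set" where
  "bounded_ops = {T.
     (\<forall>\<phi>\<in>pants_H. T \<phi> \<in> pants_H) \<and>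
     (\<forall>\<phi>. \<phi> \<notin> pants_H \<longrightarrow> T \<phi> = (\<lambda>\<zeta>. 0)) \<and>
     (\<forall>\<phi>\<in>pants_H. \<forall>\<psi>\<in>pants_H. T (\<lambda>\<zeta>. \<phi> \<zeta> + \<psi> \<zeta>) = (\<lambda>\<zeta>. T \<phi> \<zeta> + T \<psi> \<zeta>)) \<and>
     (\<forall>c. \<forall>\<phi>\<in>pants_H. T (\<lambda>\<zeta>. c * \<phi> \<zeta>) = (\<lambda>\<zeta>. c * T \<phi> \<zeta>)) \<and>
     (\<exists>C. \<forall>\<phi>\<in>pants_H. pants_norm (T \<phi>) \<le> C * pants_norm \<phi>)}"

definition op_norm :: "operator \<Rightarrow> real" where
  "op_norm T = (SUP \<phi>\<in>{\<phi>\<in>pants_H. pants_norm \<phi> \<le> 1}. pants_norm (T \<phi>))"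

definition op_adjoint :: "operator \<Rightarrow> operator" where
  "op_adjoint T = (THE S. S \<in> bounded_ops \<and>
     (\<forall>\<phi>\<in>pants_H. \<forall>\<psi>\<in>pants_H. pants_inner (T \<phi>) \<psi> = pants_inner \<phi> (S \<psi>)))"

definition compact_ops :: "operator set" where
  "compact_ops = {T\<in>bounded_ops.
     \<forall>\<phi>. (\<forall>n::nat. \<phi> n \<in> pants_H \<and> pants_norm (\<phi> n) \<le> 1) \<longrightarrow>
       (\<exists>s. strict_mono s \<and>
         (\<exists>\<psi>\<in>pants_H. (\<lambda>n. pants_norm (\<lambda>\<zeta>. T (\<phi> (s n)) \<zeta> - \<psi> \<zeta>)) \<longlonglongrightarrow> 0))}"

definition is_cstar_subalgebra :: "operator set \<Rightarrow> bool" where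
  "is_cstar_subalgebra A \<longleftrightarrow>
     A \<subseteq> bounded_ops \<and> (\<lambda>\<phi> \<zeta>. 0) \<in> A \<and>
     (\<forall>S\<in>A. \<forall>T\<in>A. (\<lambda>\<phi> \<zeta>. S \<phi> \<zeta> + T \<phi> \<zeta>) \<in> A) \<and>
     (\<forall>c. \<forall>T\<in>A. (\<lambda>\<phi> \<zeta>. c * T \<phi> \<zeta>) \<in> A) \<and>
     (\<forall>S\<in>A. \<forall>T\<in>A. S \<circ> T \<in> A) \<and>
     (\<forall>T\<in>A. op_adjoint T \<in> A) \<and>
     (\<forall>X T. (\<forall>n::nat. X n \<in> A) \<and> T \<in> bounded_ops \<and>
        (\<lambda>n. op_norm (\<lambda>\<phi> \<zeta>. X n \<phi> \<zeta> - T \<phi> \<zeta>)) \<longlonglongrightarrow> 0 \<longrightarrow> T \<in> A)"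

definition mult_z :: operator where
  "mult_z \<phi> = (if \<phi> \<in> pants_H then (\<lambda>\<zeta>. \<zeta> * \<phi> \<zeta>) else (\<lambda>\<zeta>. 0))"

text \<open>The carrier is the smallest norm-closed *-subalgebra containing \<^const>\<open>mult_z\<close>; the
  identity operator is not put in by hand.\<close>

definition cstar_z :: "operator cstar" where
  "cstar_z =
     \<lparr>cs_carrier = \<Inter>{A. is_cstar_subalgebra A \<and> mult_z \<in> A},
      cs_add = (\<lambda>S T \<phi> \<zeta>. S \<phi> \<zeta> + T \<phi> \<zeta>),
      cs_scale = (\<lambda>c T \<phi> \<zeta>. c * T \<phi> \<zeta>),
      cs_mult = (\<lambda>S T. S \<circ> T),
      cs_star = op_adjoint,
      cs_norm = op_norm\<rparr>"

end

end

theory Submission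
  imports Defs
begin

text \<open>
Expansion coefficients identify the Hilbert space with the square-summable families over
\<^typ>\<open>pants_idx\<close>; uniqueness of the expansion follows by gluing each principal part to minus the rest
of the function and applying Liouville's theorem. Up to a finite-rank operator, the operator becomes
the orthogonal sum of a unilateral shift \<open>S\<close>, of \<open>r1 S*\<close> and of \<open>a + r2 S*\<close>, which correspond to the
three boundary circles. A polynomial \<open>p\<close> in the operator and its adjoint therefore acts, deep inside
the branches, by multiplication of generating functions, so Parseval's identity bounds its essential
norm by the supremum of \<open>p\<close> on the union \<open>X\<close> of the circles; approximate eigenvectors escaping to
infinity show that this bound is attained. The symbol map thus extends to an isometry from the
algebra modulo the compact operators into the continuous functions on \<open>X\<close>. It is onto by the
Stone-Weierstrass theorem: the constants are obtained because \<open>0 \<notin> X\<close>.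
\<close>

section \<open>Square-summable families\<close>

text \<open>The generated algebra comes without an explicit description, so \<open>Alg\<close> is
  built from the symbol side: limits of polynomials plus compact operators along which the
  polynomial symbols converge uniformly on \<open>X\<close>. The lower norm bound makes
  \<open>Alg\<close> closed. It is the smallest algebra because every closed subalgebra containing
  \<open>Z\<close> contains all matrix units, hence all compact operators. On generating functions
  over the unit circle a backward shift is multiplication by \<open>cnj u\<close>, which is no
  polynomial in \<open>u\<close>. Padding a vector with a power of \<open>u\<close> absorbs these
  negative powers, so polynomials suffice, and sums over roots of unity take the place of integrals.
  The same conjugate explains why the symbol is evaluated at \<open>u\<close> on the first branch
  but at \<open>r1 * cnj u\<close> and \<open>a + r2 * cnj u\<close> on the other two. The
  approximate eigenvectors are normalized truncated geometric series. They peak at one point of the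
  circle, and pushing them out along a branch hides them from compact operators.\<close>

typedef 'i ell2 = "{c :: 'i \<Rightarrow> complex. (\<lambda>i. (cmod (c i))\<^sup>2) summable_on UNIV}"
  morphisms coord Ell2
  by (rule exI[of _ "\<lambda>_. 0"]) simp

setup_lifting type_definition_ell2

lemma coord_summable: "(\<lambda>i. (cmod (coord x i))\<^sup>2) summable_on A"
  using coord[of x] by (auto intro: summable_on_subset_banach)

lemma ell2_eqI: "(\<And>i. coord x i = coord y i) \<Longrightarrow> x = y"
  by (metis coord_inject ext)

lemma cmod_add_square_le: "(cmod (x + y))\<^sup>2 \<le> 2 * (cmod x)\<^sup>2 + 2 * (cmod y)\<^sup>2"
proof -
  have "(cmod (x + y))\<^sup>2 \<le> (cmod x + cmod y)\<^sup>2"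
    by (simp add: norm_triangle_ineq power_mono)
  also have "\<dots> \<le> 2 * (cmod x)\<^sup>2 + 2 * (cmod y)\<^sup>2"
    using sum_squares_bound[of "cmod x" "cmod y"] by (simp add: power2_sum)
  finally show ?thesis .
qed

lemma square_summable_add:
  assumes "(\<lambda>i. (cmod (c i))\<^sup>2) summable_on A" "(\<lambda>i. (cmod (d i))\<^sup>2) summable_on A"
  shows "(\<lambda>i. (cmod (c i + d i))\<^sup>2) summable_on A"
proof (rule summable_on_comparison_test)
  show "(\<lambda>i. 2 * (cmod (c i))\<^sup>2 + 2 * (cmod (d i))\<^sup>2) summable_on A"
    by (intro summable_on_add summable_on_cmult_right assms)
qed (auto simp: cmod_add_square_le)

lemma square_summable_cmult:
  assumes "(\<lambda>i. (cmod (c i))\<^sup>2) summable_on A"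
  shows "(\<lambda>i. (cmod (k * c i))\<^sup>2) summable_on A"
  using summable_on_cmult_right[OF assms, of "(cmod k)\<^sup>2"] by (simp add: norm_mult power_mult_distrib)

lemma square_summable_mult:
  assumes "(\<lambda>i. (cmod (c i))\<^sup>2) summable_on A" "(\<lambda>i. (cmod (d i))\<^sup>2) summable_on A"
  shows "(\<lambda>i. norm (c i * d i)) summable_on A"
proof (rule summable_on_comparison_test)
  show "(\<lambda>i. (cmod (c i))\<^sup>2 + (cmod (d i))\<^sup>2) summable_on A"
    by (intro summable_on_add assms)
  show "norm (c i * d i) \<le> (cmod (c i))\<^sup>2 + (cmod (d i))\<^sup>2" for i
  proof -
    have "2 * (cmod (c i) * cmod (d i)) \<le> (cmod (c i))\<^sup>2 + (cmod (d i))\<^sup>2"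
      using sum_squares_bound[of "cmod (c i)" "cmod (d i)"] by (simp add: mult.assoc)
    moreover have "0 \<le> cmod (c i) * cmod (d i)" by simp
    ultimately show ?thesis unfolding norm_mult by linarith
  qed
qed auto

instantiation ell2 :: (type) real_vector
begin
lift_definition zero_ell2 :: "'a ell2" is "\<lambda>_. 0" by simp
lift_definition plus_ell2 :: "'a ell2 \<Rightarrow> 'a ell2 \<Rightarrow> 'a ell2" is "\<lambda>c d i. c i + d i"
  by (simp add: square_summable_add)
lift_definition uminus_ell2 :: "'a ell2 \<Rightarrow> 'a ell2" is "\<lambda>c i. - c i" by simp
lift_definition minus_ell2 :: "'a ell2 \<Rightarrow> 'a ell2 \<Rightarrow> 'a ell2" is "\<lambda>c d i. c i - d i"
  subgoal for c d using square_summable_add[of c UNIV "\<lambda>i. - d i"] by simp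
  done
lift_definition scaleR_ell2 :: "real \<Rightarrow> 'a ell2 \<Rightarrow> 'a ell2" is "\<lambda>r c i. complex_of_real r * c i"
  by (rule square_summable_cmult)
instance
  by standard (transfer; simp add: algebra_simps)+
end

lemmas coord_simps [simp] =
  zero_ell2.rep_eq plus_ell2.rep_eq uminus_ell2.rep_eq minus_ell2.rep_eq scaleR_ell2.rep_eq

lemma coord_sum [simp]: "coord (sum f A) i = (\<Sum>a\<in>A. coord (f a) i)"
  by (induction A rule: infinite_finite_induct) auto

definition cip :: "'i ell2 \<Rightarrow> 'i ell2 \<Rightarrow> complex" where
  "cip x y = (\<Sum>\<^sub>\<infinity>i. coord x i * cnj (coord y i))"

lemma cip_summable: "(\<lambda>i. coord x i * cnj (coord y i)) summable_on A"
  by (rule abs_summable_summable, rule square_summable_mult) (simp_all add: coord_summable)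

lemma cip_self: "cip x x = of_real (\<Sum>\<^sub>\<infinity>i. (cmod (coord x i))\<^sup>2)"
proof -
  have "((\<lambda>i. (cmod (coord x i))\<^sup>2) has_sum (\<Sum>\<^sub>\<infinity>i. (cmod (coord x i))\<^sup>2)) UNIV"
    using coord_summable[of x UNIV] by (rule has_sum_infsum)
  from has_sum_of_real[OF this, where 'a = complex] show ?thesis
    unfolding cip_def by (intro infsumI) (simp add: complex_norm_square del: of_real_power flip: of_real_power)
qed

instantiation ell2 :: (type) real_inner
begin
definition inner_ell2 :: "'a ell2 \<Rightarrow> 'a ell2 \<Rightarrow> real" where
  "inner_ell2 x y = Re (cip x y)"
definition norm_ell2 :: "'a ell2 \<Rightarrow> real" where "norm_ell2 x = sqrt (inner x x)"
definition dist_ell2 :: "'a ell2 \<Rightarrow> 'a ell2 \<Rightarrow> real" where "dist_ell2 x y = norm (x - y)"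
definition sgn_ell2 :: "'a ell2 \<Rightarrow> 'a ell2" where "sgn_ell2 x = x /\<^sub>R norm x"
definition uniformity_ell2 :: "('a ell2 \<times> 'a ell2) filter" where
  "uniformity_ell2 = (INF e\<in>{0<..}. principal {(x, y). dist x y < e})"
definition open_ell2 :: "'a ell2 set \<Rightarrow> bool" where
  "open_ell2 U \<longleftrightarrow> (\<forall>x\<in>U. \<forall>\<^sub>F (x', y) in uniformity. x' = x \<longrightarrow> y \<in> U)"
instance
proof
  fix x y z :: "'a ell2" and r :: real
  show "inner x y = inner y x"
  proof -
    have "cip y x = cnj (cip x y)"
      unfolding cip_def infsum_cnj[symmetric] by (simp add: mult.commute)
    then show ?thesis by (simp add: inner_ell2_def)
  qed
  show "inner (x + y) z = inner x z + inner y z"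
    by (simp add: inner_ell2_def cip_def distrib_right infsum_add cip_summable)
  show "inner (r *\<^sub>R x) y = r * inner x y"
    by (simp add: inner_ell2_def cip_def mult.assoc infsum_cmult_right' )
  show "0 \<le> inner x x"
    by (simp add: inner_ell2_def cip_self infsum_nonneg)
  show "inner x x = 0 \<longleftrightarrow> x = 0"
  proof
    assume "inner x x = 0"
    then have "(\<Sum>\<^sub>\<infinity>i. (cmod (coord x i))\<^sup>2) = 0" by (simp add: inner_ell2_def cip_self)
    then have "(cmod (coord x i))\<^sup>2 = 0" for i
      using nonneg_infsum_le_0D[of "\<lambda>i. (cmod (coord x i))\<^sup>2" UNIV i]
      by (simp add: coord_summable)
    then show "x = 0" by (intro ell2_eqI) simp
  qed (simp add: inner_ell2_def cip_def)
  show "dist x y = norm (x - y)" by (simp add: dist_ell2_def)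
  show "norm x = sqrt (inner x x)" by (simp add: norm_ell2_def)
  show "sgn x = x /\<^sub>R norm x" by (simp add: sgn_ell2_def)
  show "uniformity = (INF e\<in>{0<..}. principal {(x :: 'a ell2, y). dist x y < e})"
    by (rule uniformity_ell2_def)
  show "open U \<longleftrightarrow> (\<forall>x\<in>U. \<forall>\<^sub>F (x', y) in uniformity. x' = x \<longrightarrow> y \<in> U)" for U :: "'a ell2 set"
    by (rule open_ell2_def)
qed
end

lemma norm_ell2_sq: "(norm (x :: 'i ell2))\<^sup>2 = (\<Sum>\<^sub>\<infinity>i. (cmod (coord x i))\<^sup>2)"
  by (simp add: power2_norm_eq_inner inner_ell2_def cip_self)

lemma finite_sum_le_norm_ell2:
  assumes "finite F"
  shows "(\<Sum>i\<in>F. (cmod (coord x i))\<^sup>2) \<le> (norm x)\<^sup>2"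
  unfolding norm_ell2_sq
  by (rule finite_sum_le_infsum) (use assms in \<open>auto simp: coord_summable\<close>)

lemma norm_ell2_le:
  fixes x :: "'i ell2"
  assumes "\<And>F. finite F \<Longrightarrow> (\<Sum>i\<in>F. (cmod (coord x i))\<^sup>2) \<le> B\<^sup>2" "B \<ge> 0"
  shows "norm x \<le> B"
proof -
  have "(norm x)\<^sup>2 \<le> B\<^sup>2"
    unfolding norm_ell2_sq by (rule infsum_le_finite_sums) (use assms in \<open>auto simp: coord_summable\<close>)
  then show ?thesis using assms(2) by (rule power2_le_imp_le)
qed

lemma ell2_ex:
  assumes "\<And>F. finite F \<Longrightarrow> (\<Sum>i\<in>F. (cmod (c i))\<^sup>2) \<le> B"
  shows "\<exists>x. coord x = c"
proof -
  have "(\<lambda>i. (cmod (c i))\<^sup>2) summable_on UNIV"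
    by (rule nonneg_bdd_above_summable_on) (auto intro!: bdd_aboveI[of _ B] assms)
  then show ?thesis by (metis Ell2_inverse mem_Collect_eq)
qed

lemma coord_le_norm: "cmod (coord x i) \<le> norm x"
  using finite_sum_le_norm_ell2[of "{i}" x] by (auto intro: power2_le_imp_le)

lemma bounded_linear_coord: "bounded_linear (\<lambda>x. coord x i)"
  by (rule bounded_linear_intro[of _ 1]) (auto simp: coord_le_norm scaleR_conv_of_real)

text \<open>In the Cauchy estimate for \<open>X n - X m\<close>, first fix a finite index set and
  let m tend to infinity, then let the set be arbitrary. The resulting bound puts
  \<open>X N - l\<close>, and therefore \<open>l\<close>, into the space.\<close>

lemma ell2_limit:
  fixes X :: "nat \<Rightarrow> 'i ell2"
  assumes X: "Cauchy X" and l: "\<And>i. (\<lambda>n. coord (X n) i) \<longlonglongrightarrow> l i"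
  shows "\<exists>x. coord x = l \<and> X \<longlonglongrightarrow> x"
proof -
  have *: "\<exists>N. \<forall>n\<ge>N. \<forall>F. finite F \<longrightarrow> (\<Sum>i\<in>F. (cmod (coord (X n) i - l i))\<^sup>2) \<le> e\<^sup>2"
    if "e > 0" for e :: real
  proof -
    obtain N where N: "\<And>m n. m \<ge> N \<Longrightarrow> n \<ge> N \<Longrightarrow> norm (X n - X m) < e"
      using X \<open>e > 0\<close> unfolding Cauchy_iff by blast
    have "(\<Sum>i\<in>F. (cmod (coord (X n) i - l i))\<^sup>2) \<le> e\<^sup>2" if "n \<ge> N" "finite F" for n F
    proof (rule tendsto_upperbound)
      show "(\<lambda>m. \<Sum>i\<in>F. (cmod (coord (X n) i - coord (X m) i))\<^sup>2)
              \<longlonglongrightarrow> (\<Sum>i\<in>F. (cmod (coord (X n) i - l i))\<^sup>2)"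
        by (intro tendsto_intros l)
      have "(\<Sum>i\<in>F. (cmod (coord (X n) i - coord (X m) i))\<^sup>2) \<le> e\<^sup>2" if "m \<ge> N" for m
      proof -
        have "(\<Sum>i\<in>F. (cmod (coord (X n) i - coord (X m) i))\<^sup>2) \<le> (norm (X n - X m))\<^sup>2"
          using finite_sum_le_norm_ell2[OF \<open>finite F\<close>, of "X n - X m"] by simp
        also have "\<dots> \<le> e\<^sup>2" using N[OF that \<open>n \<ge> N\<close>] by (intro power_mono) auto
        finally show ?thesis .
      qed
      then show "\<forall>\<^sub>F m in sequentially. (\<Sum>i\<in>F. (cmod (coord (X n) i - coord (X m) i))\<^sup>2) \<le> e\<^sup>2"
        using eventually_at_top_linorder by blast
    qed simp
    then show ?thesis by blast
  qed
  obtain N where "\<forall>F. finite F \<longrightarrow> (\<Sum>i\<in>F. (cmod (coord (X N) i - l i))\<^sup>2) \<le> 1\<^sup>2"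
    using *[of 1] by auto
  then obtain y where y: "coord y = (\<lambda>i. coord (X N) i - l i)"
    using ell2_ex[of "\<lambda>i. coord (X N) i - l i" 1] by auto
  define x where "x = X N - y"
  have x: "coord x = l" unfolding x_def by (auto simp: y)
  have "X \<longlonglongrightarrow> x"
  proof (rule LIMSEQ_I)
    fix r :: real assume "r > 0"
    then obtain M where M: "\<forall>n\<ge>M. \<forall>F. finite F \<longrightarrow> (\<Sum>i\<in>F. (cmod (coord (X n) i - l i))\<^sup>2) \<le> (r/2)\<^sup>2"
      using *[of "r/2"] by auto
    have "norm (X n - x) \<le> r/2" if "n \<ge> M" for n
      by (rule norm_ell2_le) (use M that \<open>r > 0\<close> x in auto)
    then show "\<exists>no. \<forall>n\<ge>no. norm (X n - x) < r" using \<open>r > 0\<close> by fastforce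
  qed
  with x show ?thesis by blast
qed

instance ell2 :: (type) complete_space
proof
  fix X :: "nat \<Rightarrow> 'a ell2" assume X: "Cauchy X"
  have "\<exists>l. (\<lambda>n. coord (X n) i) \<longlonglongrightarrow> l" for i
  proof -
    have "Cauchy (\<lambda>n. coord (X n) i)"
      by (rule bounded_linear.Cauchy[OF bounded_linear_coord X])
    then show ?thesis by (simp add: Cauchy_convergent_iff convergent_def)
  qed
  then obtain l where "\<And>i. (\<lambda>n. coord (X n) i) \<longlonglongrightarrow> l i" by metis
  then have "\<exists>x. coord x = l \<and> X \<longlonglongrightarrow> x" by (rule ell2_limit[OF X])
  then show "convergent X" by (auto simp: convergent_def)
qed

instance ell2 :: (type) banach ..

section \<open>Operators on square-summable families\<close>

lift_definition scaleC :: "complex \<Rightarrow> 'i ell2 \<Rightarrow> 'i ell2" is "\<lambda>k c i. k * c i"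
  by (rule square_summable_cmult)

declare scaleC.rep_eq [simp]

lemma norm_scaleC [simp]: "norm (scaleC k x) = cmod k * norm x"
proof -
  have "(norm (scaleC k x))\<^sup>2 = (cmod k * norm x)\<^sup>2"
    by (simp add: norm_ell2_sq norm_mult power_mult_distrib infsum_cmult_right')
  then show ?thesis by simp
qed

lift_definition cmul :: "complex \<Rightarrow> 'i ell2 \<Rightarrow>\<^sub>L 'i ell2" is scaleC
  subgoal for k
    by (rule bounded_linear_intro[of _ "cmod k"]) (auto intro: ell2_eqI simp: algebra_simps)
  done

declare cmul.rep_eq [simp]

lemma cmul_minus_1: "cmul (- 1) o\<^sub>L T = - T"
  by (intro blinfun_eqI ell2_eqI) (simp add: blinfun.bilinear_simps)

text \<open>Bounded linear functions are only real-linear, so complex linearity is carried as a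
  separate property.\<close>

definition clin :: "('i ell2 \<Rightarrow>\<^sub>L 'i ell2) \<Rightarrow> bool" where
  "clin T \<longleftrightarrow> (\<forall>k x. T (scaleC k x) = scaleC k (T x))"

lemma scaleC_simps:
  "scaleC k (x + y) = scaleC k x + scaleC k y" "scaleC k (x - y) = scaleC k x - scaleC k y"
  "scaleC k (- x) = - scaleC k x" "scaleC k 0 = 0" "scaleC k (r *\<^sub>R x) = r *\<^sub>R scaleC k x"
  "scaleC k (scaleC l x) = scaleC (k * l) x" "scaleC 1 x = x" "scaleC 0 x = 0"
  "scaleC (k + l) x = scaleC k x + scaleC l x" "scaleC (k - l) x = scaleC k x - scaleC l x"
  by (auto intro!: ell2_eqI simp: algebra_simps)

lemma tendsto_scaleC: "(f \<longlongrightarrow> x) F \<Longrightarrow> ((\<lambda>n. scaleC k (f n)) \<longlongrightarrow> scaleC k x) F"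
  using bounded_linear.tendsto[OF blinfun.bounded_linear_right[of "cmul k"]] by simp

lemma clin_compose [intro]: "clin S \<Longrightarrow> clin T \<Longrightarrow> clin (S o\<^sub>L T)"
  by (simp add: clin_def)

lemma clin_add [intro]: "clin S \<Longrightarrow> clin T \<Longrightarrow> clin (S + T)"
  by (simp add: clin_def blinfun.bilinear_simps scaleC_simps)

lemma clin_diff [intro]: "clin S \<Longrightarrow> clin T \<Longrightarrow> clin (S - T)"
  by (simp add: clin_def blinfun.bilinear_simps scaleC_simps)

lemma clin_cmul [intro, simp]: "clin (cmul k)"
  by (simp add: clin_def scaleC_simps mult.commute)

lemma clin_0 [intro, simp]: "clin 0"
  by (simp add: clin_def scaleC_simps)

lemma clin_sum [intro]: "(\<And>i. i \<in> I \<Longrightarrow> clin (f i)) \<Longrightarrow> clin (sum f I)"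
  by (induction I rule: infinite_finite_induct) auto

lemma clin_cmul_commute: "clin T \<Longrightarrow> T o\<^sub>L cmul k = cmul k o\<^sub>L T"
  by (rule blinfun_eqI) (simp add: clin_def)

lemma clin_limit:
  assumes "X \<longlonglongrightarrow> T" "\<And>n::nat. clin (X n)"
  shows "clin T"
  unfolding clin_def
proof (intro allI)
  fix k x
  have "(\<lambda>n. X n (scaleC k x)) \<longlonglongrightarrow> T (scaleC k x)"
    using assms(1) by (intro tendsto_intros)
  moreover have "(\<lambda>n. X n (scaleC k x)) \<longlonglongrightarrow> scaleC k (T x)"
    using assms(2) unfolding clin_def by (simp, intro tendsto_scaleC tendsto_intros assms(1))
  ultimately show "T (scaleC k x) = scaleC k (T x)" by (rule LIMSEQ_unique)
qed

lift_definition ket :: "'i \<Rightarrow> 'i ell2" is "\<lambda>i j. if j = i then 1 else 0"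
proof -
  fix i :: 'i
  have "(\<lambda>j. (cmod (if j = i then 1 else 0))\<^sup>2) summable_on {i}" by simp
  then show "(\<lambda>j. (cmod (if j = i then 1 else 0))\<^sup>2) summable_on UNIV"
    by (rule summable_on_cong_neutral[THEN iffD1, rotated -1]) auto
qed

declare ket.rep_eq [simp]

lemma cip_ket [simp]: "cip x (ket i) = coord x i"
proof -
  have "cip x (ket i) = (\<Sum>\<^sub>\<infinity>j\<in>{i}. coord x j * cnj (coord (ket i) j))"
    unfolding cip_def by (rule infsum_cong_neutral) auto
  then show ?thesis by simp
qed

lemma cip_commute: "cip y x = cnj (cip x y)"
  unfolding cip_def infsum_cnj[symmetric] by (simp add: mult.commute)

lemma cip_scaleC_left: "cip (scaleC k x) y = k * cip x y"
  unfolding cip_def by (simp add: mult.assoc infsum_cmult_right')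

lemma cip_scaleC_right: "cip x (scaleC k y) = cnj k * cip x y"
  by (metis cip_commute cip_scaleC_left complex_cnj_cnj complex_cnj_mult)

text \<open>Pairing with \<open>scaleC \<i> y\<close> turns the imaginary part of
  \<open>cip x y\<close> into a real part; facts about the real inner product thus transfer to the
  complex one.\<close>

lemma cip_eq_inner: "cip x y = Complex (inner x y) (inner x (scaleC \<i> y))"
  by (simp add: complex_eq_iff inner_ell2_def cip_scaleC_right)

lemma inner_scaleC_left: "inner (scaleC k x) y = inner x (scaleC (cnj k) y)"
  by (simp add: inner_ell2_def cip_scaleC_left cip_scaleC_right)

lemma norm_scaleC_ket_sum:
  assumes "finite F"
  shows "(norm (\<Sum>i\<in>F. scaleC (c i) (ket i)))\<^sup>2 = (\<Sum>i\<in>F. (cmod (c i))\<^sup>2)"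
proof -
  have "coord (\<Sum>i\<in>F. scaleC (c i) (ket i)) j = (if j \<in> F then c j else 0)" for j
    using assms by (simp add: if_distrib[of "\<lambda>x. _ * x"] sum.If_cases)
  then have "(norm (\<Sum>i\<in>F. scaleC (c i) (ket i)))\<^sup>2 = (\<Sum>\<^sub>\<infinity>i. (cmod (if i \<in> F then c i else 0))\<^sup>2)"
    by (simp add: norm_ell2_sq del: coord_sum)
  also have "\<dots> = (\<Sum>\<^sub>\<infinity>i\<in>F. (cmod (c i))\<^sup>2)" by (rule infsum_cong_neutral) auto
  finally show ?thesis using assms by simp
qed

text \<open>Here \<open>y\<close> may be any vector obtained from \<open>x\<close> by deleting
  coordinates outside \<open>F\<close>. This covers finite combinations of basis vectors as well as
  truncations.\<close>

lemma ell2_finite_approx: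
  assumes "e > 0"
  shows "\<exists>F. finite F \<and> (\<forall>y. (\<forall>i\<in>F. coord y i = coord x i) \<longrightarrow> (\<forall>i. coord y i \<in> {coord x i, 0})
           \<longrightarrow> norm (x - y) \<le> e)"
proof -
  have "((\<lambda>i. (cmod (coord x i))\<^sup>2) has_sum (norm x)\<^sup>2) UNIV"
    unfolding norm_ell2_sq by (rule has_sum_infsum) (rule coord_summable)
  from has_sum_finite_approximation[OF this, of "e\<^sup>2"] assms
  obtain F where F: "finite F" "dist (\<Sum>i\<in>F. (cmod (coord x i))\<^sup>2) ((norm x)\<^sup>2) \<le> e\<^sup>2" by auto
  have "norm (x - y) \<le> e"
    if "\<forall>i\<in>F. coord y i = coord x i" "\<forall>i. coord y i \<in> {coord x i, 0}" for y
  proof (rule norm_ell2_le)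
    fix G :: "'a set" assume G: "finite G"
    have "(\<Sum>i\<in>G. (cmod (coord (x - y) i))\<^sup>2) \<le> (\<Sum>i\<in>G - F. (cmod (coord (x - y) i))\<^sup>2)"
      by (subst sum.mono_neutral_right[of G "G - F"]) (use G that in auto)
    also have "\<dots> \<le> (\<Sum>i\<in>G - F. (cmod (coord x i))\<^sup>2)"
    proof (rule sum_mono)
      fix i show "(cmod (coord (x - y) i))\<^sup>2 \<le> (cmod (coord x i))\<^sup>2"
        using that(2)[rule_format, of i] by auto
    qed
    also have "\<dots> = (\<Sum>i\<in>(G - F) \<union> F. (cmod (coord x i))\<^sup>2) - (\<Sum>i\<in>F. (cmod (coord x i))\<^sup>2)"
      by (subst sum.union_disjoint) (use F G in auto)
    also have "\<dots> \<le> (norm x)\<^sup>2 - (\<Sum>i\<in>F. (cmod (coord x i))\<^sup>2)"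
      using finite_sum_le_norm_ell2[of "(G - F) \<union> F" x] F G by simp
    also have "\<dots> \<le> e\<^sup>2" using F(2) by (simp add: dist_real_def)
    finally show "(\<Sum>i\<in>G. (cmod (coord (x - y) i))\<^sup>2) \<le> e\<^sup>2" .
  qed (use assms in simp)
  with F(1) show ?thesis by blast
qed

subsection \<open>Adjoints\<close>

text \<open>Riesz representation by hand. The coordinates of \<open>z\<close> are forced by the
  basis vectors. Testing the functional on the finite combination with coefficients \<open>c\<close>
  itself bounds the square sum of \<open>c\<close>, and finite combinations are dense.\<close>

lemma ex_adjoint_vector: "\<exists>z. \<forall>x. inner (blinfun_apply T x) y = inner x z"
  for T :: "'i ell2 \<Rightarrow>\<^sub>L 'i ell2"
proof -
  \<comment> \<open>\<open>T\<close> is only real-linear, so its values on \<open>ket i\<close> and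
    on the imaginary multiple of \<open>ket i\<close> are independent data.\<close>
  define c where "c i = Complex (inner (T (ket i)) y) (inner (T (scaleC \<i> (ket i))) y)" for i
  have T_ket: "inner (T (scaleC k (ket i))) y = Re (k * cnj (c i))" for k i
  proof -
    have "scaleC k (ket i) = Re k *\<^sub>R ket i + Im k *\<^sub>R scaleC \<i> (ket i)"
      by (auto intro!: ell2_eqI simp: complex_eq_iff)
    then show ?thesis by (simp add: blinfun.bilinear_simps inner_add_left c_def)
  qed
  have fin: "inner (T (\<Sum>i\<in>F. scaleC (d i) (ket i))) y = (\<Sum>i\<in>F. Re (d i * cnj (c i)))" for F d
    by (simp add: blinfun.sum_right inner_sum_left T_ket)
  have bound: "(\<Sum>i\<in>F. (cmod (c i))\<^sup>2) \<le> (norm T * norm y)\<^sup>2" if F: "finite F" for F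
  proof -
    define s where "s = (\<Sum>i\<in>F. (cmod (c i))\<^sup>2)"
    have s0: "s \<ge> 0" unfolding s_def by (simp add: sum_nonneg)
    have "s = inner (T (\<Sum>i\<in>F. scaleC (c i) (ket i))) y"
      unfolding fin s_def by (rule sum.cong) (simp_all add: complex_norm_square[symmetric] Re_complex_of_real del: of_real_power)
    also have "\<dots> \<le> norm T * norm (\<Sum>i\<in>F. scaleC (c i) (ket i)) * norm y"
      by (rule order_trans[OF norm_cauchy_schwarz]) (simp add: mult_right_mono norm_blinfun)
    also have "norm (\<Sum>i\<in>F. scaleC (c i) (ket i)) = sqrt s"
      using norm_scaleC_ket_sum[OF F, of c] unfolding s_def by (metis norm_ge_zero real_sqrt_unique)
    finally have "sqrt s * sqrt s \<le> sqrt s * (norm T * norm y)" using s0 by (simp add: mult_ac)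
    then have "sqrt s \<le> norm T * norm y"
      by (metis mult_le_cancel_left_pos mult_nonneg_nonneg norm_ge_zero not_le order_le_less real_sqrt_ge_zero s0)
    then have "(sqrt s)\<^sup>2 \<le> (norm T * norm y)\<^sup>2" by (intro power_mono) (use s0 in auto)
    then show ?thesis using s0 by (simp add: s_def)
  qed
  obtain z where z: "coord z = c" using ell2_ex[of c, OF bound] by blast
  have fz: "inner (T (\<Sum>i\<in>F. scaleC (d i) (ket i))) y = inner (\<Sum>i\<in>F. scaleC (d i) (ket i)) z" for F d
  proof -
    have "inner (scaleC k (ket i)) z = Re (k * cnj (c i))" for k i
      by (simp add: inner_ell2_def cip_scaleC_left cip_commute[of "ket i"] z)
    then show ?thesis by (simp add: fin inner_sum_left)
  qed
  have "\<bar>inner (T x) y - inner x z\<bar> \<le> 0" for x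
  proof -
    define M where "M = norm T * norm y + norm z"
    have M0: "M \<ge> 0" unfolding M_def by simp
    have *: "\<bar>inner (T x) y - inner x z\<bar> \<le> 0 + e" if "e > 0" for e :: real
    proof -
      \<comment> \<open>Replacing \<open>x\<close> by a finite combination at distance t costs at
        most t times \<open>M\<close>; the denominator \<open>M + 1\<close> also covers
        \<open>M = 0\<close>.\<close>
      have pos: "e / (M + 1) > 0" using \<open>e > 0\<close> M0 by (intro divide_pos_pos) auto
      obtain F where F: "finite F" "\<And>y. (\<forall>i\<in>F. coord y i = coord x i) \<Longrightarrow> (\<forall>i. coord y i \<in> {coord x i, 0})
           \<Longrightarrow> norm (x - y) \<le> e / (M + 1)"
        using ell2_finite_approx[OF pos, of x] by blast
      define w where "w = (\<Sum>i\<in>F. scaleC (coord x i) (ket i))"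
      have cw: "coord w j = (if j \<in> F then coord x j else 0)" for j
        unfolding w_def using F(1)
        by (simp add: if_distrib[of "\<lambda>x. _ * x"] sum.If_cases)
      have d: "norm (x - w) \<le> e / (M + 1)" by (rule F(2)) (auto simp: cw)
      have "inner (T x) y - inner x z = inner (T (x - w)) y - inner (x - w) z"
        using fz[of "coord x" F] by (simp add: w_def blinfun.bilinear_simps inner_diff_left)
      also have "\<bar>\<dots>\<bar> \<le> norm T * norm (x - w) * norm y + norm (x - w) * norm z"
      proof -
        have "\<bar>inner (T (x - w)) y\<bar> \<le> norm T * norm (x - w) * norm y"
          by (rule order_trans[OF Cauchy_Schwarz_ineq2]) (simp add: mult_right_mono norm_blinfun)
        then show ?thesis using Cauchy_Schwarz_ineq2[of "x - w" z] by linarith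
      qed
      also have "\<dots> = norm (x - w) * M" by (simp add: M_def algebra_simps)
      also have "\<dots> \<le> e / (M + 1) * M" using d M0 by (intro mult_right_mono)
      also have "\<dots> \<le> e" using M0 \<open>e > 0\<close> by (simp add: field_simps)
      finally show ?thesis by simp
    qed
    show ?thesis by (rule field_le_epsilon) (rule *)
  qed
  then have "inner (T x) y = inner x z" for x
    by (metis abs_le_zero_iff eq_iff_diff_eq_0)
  then show ?thesis by blast
qed

lemma inner_eqI:
  fixes y z :: "'a :: real_inner"
  assumes "\<And>x. inner x y = inner x z"
  shows "y = z"
proof -
  have "inner (y - z) (y - z) = 0" using assms[of "y - z"] by (simp add: inner_diff_right)
  then show ?thesis by simp
qed

lemma norm_adjoint_vector_le:
  assumes "\<And>x y. inner (blinfun_apply T x) y = inner x (f y)"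
  shows "norm (f y) \<le> norm T * norm y"
proof -
  have "norm (f y) * norm (f y) = inner (T (f y)) y"
    by (simp add: assms power2_norm_eq_inner[symmetric] power2_eq_square)
  also have "\<dots> \<le> norm T * norm (f y) * norm y"
    by (rule order_trans[OF norm_cauchy_schwarz]) (simp add: mult_right_mono norm_blinfun)
  finally have "norm (f y) * norm (f y) \<le> norm (f y) * (norm T * norm y)" by (simp add: mult_ac)
  then show ?thesis
    by (metis mult_le_cancel_left_pos mult_nonneg_nonneg norm_ge_zero order_le_less)
qed

lemma ex_adjoint:
  fixes T :: "'i ell2 \<Rightarrow>\<^sub>L 'i ell2"
  shows "\<exists>S :: 'i ell2 \<Rightarrow>\<^sub>L 'i ell2. \<forall>x y. inner (T x) y = inner x (S y)"
proof -
  obtain f where f: "\<And>x y. inner (T x) y = inner x (f y)" using ex_adjoint_vector[of T] by metis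
  have "bounded_linear f"
  proof (rule bounded_linear_intro)
    show "f (x + y) = f x + f y" for x y
      by (rule inner_eqI) (simp add: f[symmetric] inner_add_right)
    show "f (r *\<^sub>R x) = r *\<^sub>R f x" for r x
      by (rule inner_eqI) (simp add: f[symmetric])
    show "norm (f x) \<le> norm x * norm T" for x
      using norm_adjoint_vector_le[of T f x] f by (simp add: mult.commute)
  qed
  then show ?thesis using f by (metis bounded_linear_Blinfun_apply)
qed

text \<open>The adjoint for the real inner product. On complex-linear operators it is the usual
  Hilbert space adjoint, by \<open>cip_adj\<close>.\<close>

definition adj :: "('i ell2 \<Rightarrow>\<^sub>L 'i ell2) \<Rightarrow> ('i ell2 \<Rightarrow>\<^sub>L 'i ell2)" where
  "adj T = (SOME S. \<forall>x y. inner (T x) y = inner x (blinfun_apply S y))"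

lemma inner_adj: "inner (blinfun_apply T x) y = inner x (adj T y)"
  using someI_ex[OF ex_adjoint[of T]] unfolding adj_def by blast

lemma adj_eqI:
  assumes "\<And>x y. inner (blinfun_apply T x) y = inner x (blinfun_apply S y)"
  shows "adj T = S"
proof (rule blinfun_eqI, rule inner_eqI)
  fix x y show "inner x (adj T y) = inner x (S y)"
    using inner_adj[of T x y] assms[of x y] by (rule trans[OF sym])
qed

lemma adj_adj [simp]: "adj (adj T) = T"
  by (rule adj_eqI) (metis inner_adj inner_commute)

lemma adj_compose: "adj (S o\<^sub>L T) = adj T o\<^sub>L adj S"
  by (rule adj_eqI) (simp add: inner_adj)

lemma adj_add: "adj (S + T) = adj S + adj T"
  by (rule adj_eqI) (simp add: inner_adj blinfun.bilinear_simps inner_add_left inner_add_right)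

lemma adj_diff: "adj (S - T) = adj S - adj T"
  by (rule adj_eqI) (simp add: inner_adj blinfun.bilinear_simps inner_diff_left inner_diff_right)

lemma adj_cmul: "adj (cmul k) = cmul (cnj k)"
  by (rule adj_eqI) (simp add: inner_scaleC_left)

lemma norm_adj_le: "norm (adj T) \<le> norm T"
  by (rule norm_blinfun_bound[OF norm_ge_zero]) (rule norm_adjoint_vector_le, rule inner_adj)

lemma norm_adj [simp]: "norm (adj T) = norm T"
  using norm_adj_le[of T] norm_adj_le[of "adj T"] by simp

lemma clin_adj [intro]: "clin T \<Longrightarrow> clin (adj T)"
  unfolding clin_def
  by (intro allI, rule inner_eqI) (metis inner_adj inner_scaleC_left complex_cnj_cnj)

lemma cip_adj:
  assumes "clin T"
  shows "cip (blinfun_apply T x) y = cip x (adj T y)"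
  using clin_adj[OF assms] unfolding cip_eq_inner inner_adj by (simp add: clin_def)

lemma coord_adj:
  assumes "clin T"
  shows "coord (adj T y) i = cip y (blinfun_apply T (ket i))"
  by (metis assms cip_adj cip_ket clin_adj adj_adj)

subsection \<open>Partial permutations of the basis\<close>

text \<open>The map tells from which index a coordinate is read, so basis vectors move against it:
  \<open>\<pi> i = Some j\<close> sends \<open>ket j\<close> to \<open>ket i\<close>. For injective
  \<open>\<pi>\<close> this is a partial isometry.\<close>

definition pperm :: "('i \<Rightarrow> 'i option) \<Rightarrow> 'i ell2 \<Rightarrow>\<^sub>L 'i ell2" where
  "pperm \<pi> = Blinfun (\<lambda>x. Ell2 (\<lambda>i. case \<pi> i of None \<Rightarrow> 0 | Some j \<Rightarrow> coord x j))"

context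
  fixes \<pi> :: "'i \<Rightarrow> 'i option"
  assumes inj: "inj_on \<pi> (dom \<pi>)"
begin

lemma pperm_aux:
  fixes x :: "'i ell2"
  defines "y \<equiv> Ell2 (\<lambda>i. case \<pi> i of None \<Rightarrow> 0 | Some j \<Rightarrow> coord x j)"
  shows "coord y i = (case \<pi> i of None \<Rightarrow> 0 | Some j \<Rightarrow> coord x j)" "norm y \<le> norm x"
proof -
  let ?c = "\<lambda>i. case \<pi> i of None \<Rightarrow> 0 | Some j \<Rightarrow> coord x j"
  have *: "(\<Sum>i\<in>F. (cmod (?c i))\<^sup>2) \<le> (norm x)\<^sup>2" if F: "finite F" for F
  proof -
    have "(\<Sum>i\<in>F. (cmod (?c i))\<^sup>2) = (\<Sum>i\<in>F \<inter> dom \<pi>. (cmod (coord x (the (\<pi> i))))\<^sup>2)"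
      using F by (intro sum.mono_neutral_cong_right) (auto split: option.splits)
    also have "\<dots> = (\<Sum>j\<in>(\<lambda>i. the (\<pi> i)) ` (F \<inter> dom \<pi>). (cmod (coord x j))\<^sup>2)"
      using inj by (subst sum.reindex) (auto simp: inj_on_def domIff)
    also have "\<dots> \<le> (norm x)\<^sup>2" using F by (intro finite_sum_le_norm_ell2) auto
    finally show ?thesis .
  qed
  obtain z where "coord z = ?c" using ell2_ex[of ?c, OF *] by blast
  then have y: "coord y = ?c" by (metis coord_inverse y_def)
  then show "coord y i = ?c i" by simp
  show "norm y \<le> norm x" by (rule norm_ell2_le) (use * y in simp_all)
qed

lemma pperm_apply: "pperm \<pi> x = Ell2 (\<lambda>i. case \<pi> i of None \<Rightarrow> 0 | Some j \<Rightarrow> coord x j)"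
proof -
  have "bounded_linear (\<lambda>x. Ell2 (\<lambda>i. case \<pi> i of None \<Rightarrow> 0 | Some j \<Rightarrow> coord x j))"
    by (rule bounded_linear_intro[of _ 1])
      (auto intro!: ell2_eqI simp: pperm_aux split: option.splits)
  then show ?thesis unfolding pperm_def by (simp add: bounded_linear_Blinfun_apply)
qed

lemma coord_pperm: "coord (pperm \<pi> x) i = (case \<pi> i of None \<Rightarrow> 0 | Some j \<Rightarrow> coord x j)"
  by (simp add: pperm_apply pperm_aux)

lemma clin_pperm: "clin (pperm \<pi>)"
  unfolding clin_def by (auto intro!: ell2_eqI simp: coord_pperm split: option.splits)

lemma pperm_ket: "\<pi> i = Some j \<Longrightarrow> pperm \<pi> (ket j) = ket i"
  using inj
  by (intro ell2_eqI) (auto simp: coord_pperm inj_on_def domIff split: option.splits)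

lemma pperm_ket_0: "(\<And>i. \<pi> i \<noteq> Some j) \<Longrightarrow> pperm \<pi> (ket j) = 0"
  by (intro ell2_eqI) (auto simp: coord_pperm split: option.splits)

end

lemma adj_pperm:
  assumes "\<And>i j. \<pi> i = Some j \<longleftrightarrow> \<pi>' j = Some i"
  shows "adj (pperm \<pi>) = pperm \<pi>'"
proof (intro blinfun_eqI ell2_eqI)
  have inj: "inj_on \<pi> (dom \<pi>)" "inj_on \<pi>' (dom \<pi>')"
    using assms by (auto simp: inj_on_def dom_def) (metis option.inject)+
  fix y i
  have "pperm \<pi> (ket i) = (case \<pi>' i of None \<Rightarrow> 0 | Some j \<Rightarrow> ket j)"
    by (cases "\<pi>' i") (use assms in \<open>auto intro!: pperm_ket pperm_ket_0 inj\<close>)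
  then show "coord (adj (pperm \<pi>) y) i = coord (pperm \<pi>' y) i"
    by (auto simp: coord_adj clin_pperm inj coord_pperm cip_def[of _ 0] split: option.splits)
qed

section \<open>Compact operators\<close>

primrec depth :: "pants_idx \<Rightarrow> nat" where
  "depth (idxE n) = n"
| "depth (idxF n) = n"
| "depth (idxG n) = n"

lemma finite_depth_less: "finite {i. depth i < n}"
proof -
  have "i \<in> idxE ` {..<n} \<union> idxF ` {..<n} \<union> idxG ` {..<n}" if "depth i < n" for i
    using that by (cases i) auto
  then have "{i. depth i < n} \<subseteq> idxE ` {..<n} \<union> idxF ` {..<n} \<union> idxG ` {..<n}" by blast
  then show ?thesis by (rule finite_subset) simp
qed

lemma countable_pants_idx: "countable (UNIV :: pants_idx set)"
proof -
  have "UNIV = (\<Union>n. {i. depth i < n})" by auto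
  moreover have "countable (\<Union>n. {i. depth i < n})"
    by (intro countable_UN) (auto intro: countable_finite finite_depth_less)
  ultimately show ?thesis by simp
qed

type_synonym hvec = "pants_idx ell2"
type_synonym hop = "pants_idx ell2 \<Rightarrow>\<^sub>L pants_idx ell2"

lemma hvec_eqI:
  fixes x y :: hvec
  assumes "\<And>n. coord x (idxE n) = coord y (idxE n)" "\<And>n. coord x (idxF n) = coord y (idxF n)"
    "\<And>n. coord x (idxG n) = coord y (idxG n)"
  shows "x = y"
proof (rule ell2_eqI)
  show "coord x i = coord y i" for i by (cases i) (use assms in auto)
qed

lemma hvec_eqI_Suc:
  fixes x y :: hvec
  assumes "coord x (idxE 0) = coord y (idxE 0)" "\<And>n. coord x (idxE (Suc n)) = coord y (idxE (Suc n))"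
    "coord x (idxF 0) = coord y (idxF 0)" "\<And>n. coord x (idxF (Suc n)) = coord y (idxF (Suc n))"
    "coord x (idxG 0) = coord y (idxG 0)" "\<And>n. coord x (idxG (Suc n)) = coord y (idxG (Suc n))"
  shows "x = y"
  by (rule hvec_eqI; rename_tac n, case_tac n) (use assms in auto)

text \<open>Only finitely many indices have small depth, so these are finite-rank projections; they
  increase strongly to the identity.\<close>

definition trunc :: "nat \<Rightarrow> hop" where
  "trunc n = pperm (\<lambda>i. if depth i < n then Some i else None)"

lemma trunc_inj: "inj_on (\<lambda>i. if depth i < n then Some i else None) (dom (\<lambda>i. if depth i < n then Some i else None))"
  by (auto simp: inj_on_def dom_def split: if_splits)

lemma coord_trunc [simp]: "coord (trunc n x) i = (if depth i < n then coord x i else 0)"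
  by (simp add: trunc_def coord_pperm[OF trunc_inj])

lemma clin_trunc [simp, intro]: "clin (trunc n)"
  by (simp add: trunc_def clin_pperm[OF trunc_inj])

lemma adj_trunc [simp]: "adj (trunc n) = trunc n"
  unfolding trunc_def by (rule adj_pperm) (auto split: if_splits)

lemma trunc_trunc: "trunc m (trunc n x) = trunc (min m n) x"
  by (rule ell2_eqI) auto

lemma norm_sub_trunc_mono:
  assumes "m \<le> n"
  shows "norm (x - trunc n x) \<le> norm (x - trunc m x)"
proof (rule norm_ell2_le)
  fix F :: "pants_idx set" assume F: "finite F"
  have "(\<Sum>i\<in>F. (cmod (coord (x - trunc n x) i))\<^sup>2) \<le> (\<Sum>i\<in>F. (cmod (coord (x - trunc m x) i))\<^sup>2)"
    by (rule sum_mono) (use assms in auto)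
  also have "\<dots> \<le> (norm (x - trunc m x))\<^sup>2" by (rule finite_sum_le_norm_ell2[OF F])
  finally show "(\<Sum>i\<in>F. (cmod (coord (x - trunc n x) i))\<^sup>2) \<le> (norm (x - trunc m x))\<^sup>2" .
qed simp

lemma norm_sub_trunc_le: "norm (x - trunc n x) \<le> norm x"
proof -
  have "x - trunc 0 x = x" by (rule ell2_eqI) simp
  then show ?thesis using norm_sub_trunc_mono[of 0 n x] by simp
qed

lemma trunc_tendsto: "(\<lambda>n. trunc n x) \<longlonglongrightarrow> x"
proof (rule LIMSEQ_I)
  fix r :: real assume "r > 0"
  then obtain F where F: "finite F" "\<And>y. (\<forall>i\<in>F. coord y i = coord x i) \<Longrightarrow> (\<forall>i. coord y i \<in> {coord x i, 0})
           \<Longrightarrow> norm (x - y) \<le> r / 2"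
    using ell2_finite_approx[of "r/2" x] by auto
  define N where "N = Suc (Max (insert 0 (depth ` F)))"
  have N: "depth i < N" if "i \<in> F" for i
    unfolding N_def less_Suc_eq_le using F(1) that by (intro Max_ge) auto
  have "norm (trunc n x - x) < r" if "n \<ge> N" for n
  proof -
    have "norm (x - trunc n x) \<le> r / 2"
      by (rule F(2)) (use N that in \<open>auto dest: less_le_trans\<close>)
    then show ?thesis using \<open>r > 0\<close> by (simp add: norm_minus_commute)
  qed
  then show "\<exists>no. \<forall>n\<ge>no. norm (trunc n x - x) < r" by blast
qed

lemma trunc_eq_sum: "trunc n x = (\<Sum>i | depth i < n. scaleC (coord x i) (ket i))"
proof (rule ell2_eqI)
  fix j
  show "coord (trunc n x) j = coord (\<Sum>i | depth i < n. scaleC (coord x i) (ket i)) j"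
    using finite_depth_less[of n] by (simp add: if_distrib[of "\<lambda>x. _ * x"] sum.If_cases)
qed

lemma norm_blinfun_bound_unit:
  fixes T :: "'a::real_normed_vector \<Rightarrow>\<^sub>L 'b::real_normed_vector"
  assumes "\<And>x. norm x \<le> 1 \<Longrightarrow> norm (T x) \<le> e" "e \<ge> 0"
  shows "norm T \<le> e"
proof (rule norm_blinfun_bound)
  fix x
  show "norm (T x) \<le> e * norm x"
  proof (cases "x = 0")
    case False
    have "norm (T (x /\<^sub>R norm x)) \<le> e" by (rule assms) (use False in simp)
    then show ?thesis using False by (simp add: blinfun.scaleR_right field_simps)
  qed (simp add: blinfun.zero_right)
qed fact

definition comp_op :: "hop \<Rightarrow> bool" where
  "comp_op T \<longleftrightarrow> (\<forall>x. (\<forall>n::nat. norm (x n) \<le> 1) \<longrightarrow>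
     (\<exists>s l. strict_mono s \<and> (\<lambda>n. T (x (s n))) \<longlonglongrightarrow> l))"

lemma comp_opD:
  assumes "comp_op T" "\<And>n::nat. norm (x n) \<le> B"
  obtains s l where "strict_mono s" "(\<lambda>n. T (x (s n))) \<longlonglongrightarrow> l"
proof -
  define B' where "B' = max B 1"
  have B': "B' > 0" "B \<le> B'" by (auto simp: B'_def)
  have "norm (x n /\<^sub>R B') \<le> 1" for n
    using assms(2)[of n] B' by (simp add: field_simps)
  then obtain s l where s: "strict_mono s" "(\<lambda>n. T (x (s n) /\<^sub>R B')) \<longlonglongrightarrow> l"
    using assms(1)[unfolded comp_op_def, rule_format, of "\<lambda>n. x n /\<^sub>R B'"] by blast
  have "(\<lambda>n. B' *\<^sub>R T (x (s n) /\<^sub>R B')) \<longlonglongrightarrow> B' *\<^sub>R l" by (intro tendsto_intros s(2))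
  then have "(\<lambda>n. T (x (s n))) \<longlonglongrightarrow> B' *\<^sub>R l" using B' by (simp add: blinfun.scaleR_right)
  with s(1) that show ?thesis by blast
qed

lemma comp_op_compose_right:
  assumes "comp_op S"
  shows "comp_op (S o\<^sub>L T)"
  unfolding comp_op_def
proof (intro allI impI)
  fix x :: "nat \<Rightarrow> hvec" assume x: "\<forall>n. norm (x n) \<le> 1"
  have "norm (T (x n)) \<le> norm T" for n
    using norm_blinfun[of T "x n"] x mult_left_le[of "norm (x n)" "norm T"] by auto
  then obtain s l where "strict_mono s" "(\<lambda>n. S (T (x (s n)))) \<longlonglongrightarrow> l"
    using comp_opD[OF assms, of "\<lambda>n. T (x n)"] by metis
  then show "\<exists>s l. strict_mono s \<and> (\<lambda>n. (S o\<^sub>L T) (x (s n))) \<longlonglongrightarrow> l" by auto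
qed

lemma comp_op_compose_left:
  assumes "comp_op T"
  shows "comp_op (S o\<^sub>L T)"
  unfolding comp_op_def
proof (intro allI impI)
  fix x :: "nat \<Rightarrow> hvec" assume x: "\<forall>n. norm (x n) \<le> 1"
  then obtain s l where s: "strict_mono s" "(\<lambda>n. T (x (s n))) \<longlonglongrightarrow> l"
    using assms unfolding comp_op_def by blast
  then have "(\<lambda>n. S (T (x (s n)))) \<longlonglongrightarrow> S l" by (intro tendsto_intros)
  then show "\<exists>s l. strict_mono s \<and> (\<lambda>n. (S o\<^sub>L T) (x (s n))) \<longlonglongrightarrow> l" using s(1) by auto
qed

lemma comp_op_add:
  assumes "comp_op S" "comp_op T"
  shows "comp_op (S + T)"
  unfolding comp_op_def
proof (intro allI impI)
  fix x :: "nat \<Rightarrow> hvec" assume x: "\<forall>n. norm (x n) \<le> 1"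
  then obtain s l where s: "strict_mono s" "(\<lambda>n. S (x (s n))) \<longlonglongrightarrow> l"
    using assms unfolding comp_op_def by blast
  obtain t m where t: "strict_mono t" "(\<lambda>n. T (x (s (t n)))) \<longlonglongrightarrow> m"
    using assms(2)[unfolded comp_op_def, rule_format, of "\<lambda>n. x (s n)"] x by blast
  have "(\<lambda>n. S (x (s (t n))) + T (x (s (t n)))) \<longlonglongrightarrow> l + m"
    using LIMSEQ_subseq_LIMSEQ[OF s(2) t(1)] t(2) by (intro tendsto_add) (auto simp: o_def)
  moreover have "strict_mono (s \<circ> t)" using s(1) t(1) by (rule strict_mono_o)
  ultimately show "\<exists>s l. strict_mono s \<and> (\<lambda>n. (S + T) (x (s n))) \<longlonglongrightarrow> l"
    by (intro exI[of _ "s \<circ> t"] exI[of _ "l + m"]) (simp add: blinfun.add_left)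
qed

lemma comp_op_cmul: "comp_op T \<Longrightarrow> comp_op (cmul k o\<^sub>L T)"
  by (rule comp_op_compose_left)

lemma comp_op_minus:
  assumes "comp_op T"
  shows "comp_op (- T)"
  using comp_op_cmul[OF assms, of "-1"] by (simp add: cmul_minus_1)

lemma comp_op_diff: "comp_op S \<Longrightarrow> comp_op T \<Longrightarrow> comp_op (S - T)"
  using comp_op_add[of S "- T"] comp_op_minus[of T] by simp

lemma comp_op_0 [simp]: "comp_op 0"
  unfolding comp_op_def by (auto intro!: exI[of _ id] exI[of _ 0] strict_mono_id)

text \<open>Otherwise vectors \<open>x n\<close> of the unit ball witness the failure of each
  truncation. Along a subsequence their images converge to some \<open>l\<close>, and the
  truncations of \<open>l\<close> converge to \<open>l\<close>.\<close>

lemma comp_op_imp_approx: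
  assumes T: "comp_op T" and "e > 0"
  shows "\<exists>n. norm (T - (trunc n o\<^sub>L T)) \<le> e"
proof (rule ccontr)
  assume "\<not> ?thesis"
  then have "\<not> norm (T - (trunc n o\<^sub>L T)) \<le> e" for n by blast
  then have "\<exists>x. norm x \<le> 1 \<and> norm ((T - (trunc n o\<^sub>L T)) x) > e" for n
    using norm_blinfun_bound_unit[of "T - (trunc n o\<^sub>L T)" e] \<open>e > 0\<close> by (meson less_imp_le not_le)
  then obtain x where x: "\<And>n. norm (x n) \<le> 1" "\<And>n. norm ((T - (trunc n o\<^sub>L T)) (x n)) > e" by metis
  obtain s l where s: "strict_mono s" "(\<lambda>n. T (x (s n))) \<longlonglongrightarrow> l"
    by (rule comp_opD[OF T x(1)])
  have "(\<lambda>n. norm (T (x (s n)) - l) + norm (l - trunc (s n) l)) \<longlonglongrightarrow> norm (l - l) + norm (l - l)"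
    by (intro tendsto_intros s LIMSEQ_subseq_LIMSEQ[OF trunc_tendsto s(1), unfolded o_def])
  then have "\<forall>\<^sub>F n in sequentially. norm (T (x (s n)) - l) + norm (l - trunc (s n) l) < e"
    using \<open>e > 0\<close> by (intro order_tendstoD) auto
  then obtain n where n: "norm (T (x (s n)) - l) + norm (l - trunc (s n) l) < e"
    by (meson eventually_sequentially order_refl)
  have "norm ((T - (trunc (s n) o\<^sub>L T)) (x (s n))) =
      norm (((T (x (s n)) - l) - trunc (s n) (T (x (s n)) - l)) + (l - trunc (s n) l))"
    by (simp add: blinfun.bilinear_simps)
  also have "\<dots> \<le> norm (T (x (s n)) - l) + norm (l - trunc (s n) l)"
    by (rule order_trans[OF norm_triangle_ineq]) (simp add: norm_sub_trunc_le)
  finally show False using n x(2)[of "s n"] by linarith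
qed

text \<open>A diagonal subsequence makes all coordinates converge; the tails are uniformly small.\<close>

lemma comp_op_approxI:
  assumes T: "\<And>e. e > 0 \<Longrightarrow> \<exists>n. norm (T - (trunc n o\<^sub>L T)) \<le> e"
  shows "comp_op T"
  unfolding comp_op_def
proof (intro allI impI)
  fix x :: "nat \<Rightarrow> hvec" assume x: "\<forall>n. norm (x n) \<le> 1"
  have Tx: "norm (S (x n)) \<le> norm S" for n and S :: hop
    using norm_blinfun[of S "x n"] x mult_left_le[of "norm (x n)" "norm S"] by auto
  have "norm (coord (T (x n)) i) \<le> norm T" for n i
    using coord_le_norm[of "T (x n)" i] Tx[of T n] by linarith
  then obtain s where s: "strict_mono s" "\<And>i. \<exists>l. (\<lambda>n. coord (T (x (s n))) i) \<longlonglongrightarrow> l"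
    using function_convergent_subsequence[OF countable_pants_idx, of "\<lambda>n i. coord (T (x n)) i" "norm T"]
    by (metis UNIV_I)
  have "Cauchy (\<lambda>n. T (x (s n)))"
  proof (rule CauchyI)
    fix e :: real assume "e > 0"
    then obtain n where n: "norm (T - (trunc n o\<^sub>L T)) \<le> e / 4" using T[of "e/4"] by auto
    obtain l where l: "\<And>i. (\<lambda>n. coord (T (x (s n))) i) \<longlonglongrightarrow> l i" using s(2) by metis
    have "(\<lambda>k. trunc n (T (x (s k)))) \<longlonglongrightarrow> (\<Sum>i | depth i < n. scaleC (l i) (ket i))"
      unfolding trunc_eq_sum
    proof (intro tendsto_sum)
      fix i
      have "norm (scaleC (coord (T (x (s k))) i) (ket i) - scaleC (l i) (ket i))
         = norm (coord (T (x (s k))) i - l i) * norm (ket i)" for k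
        by (metis norm_scaleC scaleC_simps(10))
      moreover have "(\<lambda>k. norm (coord (T (x (s k))) i - l i) * norm (ket i)) \<longlonglongrightarrow> 0"
        by (intro tendsto_mult_left_zero tendsto_norm_zero LIM_zero l)
      ultimately have "(\<lambda>k. norm (scaleC (coord (T (x (s k))) i) (ket i) - scaleC (l i) (ket i))) \<longlonglongrightarrow> 0"
        by simp
      then show "(\<lambda>k. scaleC (coord (T (x (s k))) i) (ket i)) \<longlonglongrightarrow> scaleC (l i) (ket i)"
        by (rule LIM_zero_cancel[OF tendsto_norm_zero_cancel])
    qed
    then have "Cauchy (\<lambda>k. trunc n (T (x (s k))))" by (rule LIMSEQ_imp_Cauchy)
    then obtain M where M: "\<And>j k. j \<ge> M \<Longrightarrow> k \<ge> M \<Longrightarrow>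
        norm (trunc n (T (x (s j))) - trunc n (T (x (s k)))) < e / 2"
      using \<open>e > 0\<close> unfolding Cauchy_iff by (meson half_gt_zero)
    have "norm (T (x (s j)) - T (x (s k))) < e" if "j \<ge> M" "k \<ge> M" for j k
    proof -
      have *: "norm (T (x (s j)) - trunc n (T (x (s j)))) \<le> e / 4" for j
        using Tx[of "T - (trunc n o\<^sub>L T)" "s j"] n by (simp add: blinfun.diff_left)
      have "norm (T (x (s j)) - T (x (s k))) \<le> norm (T (x (s j)) - trunc n (T (x (s j)))) +
          norm (trunc n (T (x (s j))) - trunc n (T (x (s k)))) + norm (T (x (s k)) - trunc n (T (x (s k))))"
        using norm_triangle_ineq[of "T (x (s j)) - trunc n (T (x (s j)))" "trunc n (T (x (s j))) - T (x (s k))"]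
          norm_triangle_ineq[of "trunc n (T (x (s j))) - trunc n (T (x (s k)))" "trunc n (T (x (s k))) - T (x (s k))"]
        by (simp add: norm_minus_commute)
      then show ?thesis using *[of j] *[of k] M[OF that] by linarith
    qed
    then show "\<exists>M. \<forall>m\<ge>M. \<forall>n\<ge>M. norm (T (x (s m)) - T (x (s n))) < e" by blast
  qed
  then show "\<exists>s l. strict_mono s \<and> (\<lambda>n. T (x (s n))) \<longlonglongrightarrow> l"
    using s(1) Cauchy_convergent_iff convergent_def by blast
qed

text \<open>A truncation that is good for the nearby compact operator \<open>S\<close> is good for
  \<open>T\<close>, because removing the truncated part never increases norms.\<close>

lemma comp_op_closed:
  assumes "\<And>e. e > 0 \<Longrightarrow> \<exists>S. comp_op S \<and> norm (T - S) \<le> e"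
  shows "comp_op T"
proof (rule comp_op_approxI)
  fix e :: real assume "e > 0"
  then obtain S where S: "comp_op S" "norm (T - S) \<le> e / 2" using assms[of "e/2"] by auto
  obtain n where n: "norm (S - (trunc n o\<^sub>L S)) \<le> e / 2"
    using comp_op_imp_approx[OF S(1), of "e/2"] \<open>e > 0\<close> by auto
  have "norm (T - (trunc n o\<^sub>L T)) \<le> e"
  proof (rule norm_blinfun_bound)
    fix x
    have "(T - (trunc n o\<^sub>L T)) x = ((T - S) x - trunc n ((T - S) x)) + (S - (trunc n o\<^sub>L S)) x"
      by (simp add: blinfun.bilinear_simps)
    also have "norm \<dots> \<le> norm ((T - S) x) + norm ((S - (trunc n o\<^sub>L S)) x)"
      by (rule order_trans[OF norm_triangle_ineq]) (simp add: norm_sub_trunc_le)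
    also have "\<dots> \<le> e / 2 * norm x + e / 2 * norm x"
      using S(2) n norm_blinfun[of "T - S" x] norm_blinfun[of "S - (trunc n o\<^sub>L S)" x]
      by (intro add_mono) (meson mult_right_mono norm_ge_zero order_trans)+
    finally show "norm ((T - (trunc n o\<^sub>L T)) x) \<le> e * norm x" by (simp add: algebra_simps)
  qed (use \<open>e > 0\<close> in simp)
  then show "\<exists>n. norm (T - (trunc n o\<^sub>L T)) \<le> e" by blast
qed

lemma comp_op_trunc: "comp_op (trunc n)"
proof (rule comp_op_approxI)
  fix e :: real assume "e > 0"
  moreover have "trunc n - (trunc n o\<^sub>L trunc n) = 0"
    by (rule blinfun_eqI) (simp add: blinfun.bilinear_simps trunc_trunc)
  ultimately show "\<exists>m. norm (trunc n - (trunc m o\<^sub>L trunc n)) \<le> e" by (intro exI[of _ n]) simp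
qed

text \<open>Taking adjoints turns the approximation of \<open>T\<close> by
  \<open>trunc n o\<^sub>L T\<close> into one of \<open>adj T\<close> by operators that factor
  through a finite-rank projection.\<close>

lemma comp_op_adj:
  assumes "comp_op T"
  shows "comp_op (adj T)"
proof (rule comp_op_closed)
  fix e :: real assume "e > 0"
  then obtain n where n: "norm (T - (trunc n o\<^sub>L T)) \<le> e" using comp_op_imp_approx[OF assms] by blast
  have "adj T - (adj T o\<^sub>L trunc n) = adj (T - (trunc n o\<^sub>L T))"
    by (simp add: adj_diff adj_compose)
  then have "norm (adj T - (adj T o\<^sub>L trunc n)) \<le> e" using n by simp
  then show "\<exists>S. comp_op S \<and> norm (adj T - S) \<le> e"
    using comp_op_compose_left[OF comp_op_trunc] by blast
qed

text \<open>Cutting off the domain shows that a compact operator is small on vectors supported far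
  out along the branches.\<close>

lemma comp_op_imp_approx_right:
  assumes T: "comp_op T" and "e > 0"
  shows "\<exists>n. norm (T - (T o\<^sub>L trunc n)) \<le> e"
proof -
  obtain n where n: "norm (adj T - (trunc n o\<^sub>L adj T)) \<le> e"
    using comp_op_imp_approx[OF comp_op_adj[OF T] \<open>e > 0\<close>] by blast
  have "adj T - (trunc n o\<^sub>L adj T) = adj (T - (T o\<^sub>L trunc n))"
    by (simp add: adj_diff adj_compose)
  with n show ?thesis by auto
qed

section \<open>Polynomial vectors and Parseval's identity\<close>

text \<open>The sum is geometric in \<open>\<zeta>\<close>, which is \<open>\<omega>\<close> to the
  possibly negative power i - j. This is an N-th root of unity, and it equals 1 only for i = j since
  both exponents are below \<open>N\<close>.\<close>

lemma roots_of_unity_orthogonal: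
  fixes N i j :: nat
  defines "\<omega> \<equiv> cis (2 * pi / N)"
  assumes "i < N" "j < N"
  shows "(\<Sum>k<N. (\<omega> ^ k) ^ i * cnj ((\<omega> ^ k) ^ j)) = (if i = j then of_nat N else 0)"
proof -
  define \<zeta> where "\<zeta> = \<omega> ^ i * cnj (\<omega> ^ j)"
  have N: "N > 0" using assms by simp
  have \<omega>N: "\<omega> ^ N = 1" using N Complex.DeMoivre[of "2 * pi / N" N] by (simp add: \<omega>_def)
  have \<omega>1: "\<omega> * cnj \<omega> = 1" by (simp add: \<omega>_def cis_cnj cis_mult)
  have eq: "(\<omega> ^ k) ^ i * cnj ((\<omega> ^ k) ^ j) = \<zeta> ^ k" for k
    by (simp add: \<zeta>_def power_mult_distrib power_mult[symmetric] mult.commute)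
  have "\<zeta> ^ N = 1"
    by (metis \<zeta>_def \<omega>N complex_cnj_one complex_cnj_power mult.commute mult.left_neutral power_mult
        power_mult_distrib power_one)
  moreover have "\<zeta> = 1 \<longleftrightarrow> i = j"
  proof
    assume "\<zeta> = 1"
    have "cnj \<omega> ^ j * \<omega> ^ j = 1"
      using \<omega>1 by (simp add: power_mult_distrib[symmetric] mult.commute)
    then have "\<omega> ^ i = \<zeta> * \<omega> ^ j"
      by (simp add: \<zeta>_def mult.assoc)
    then have "cis (2 * pi * i / N) = cis (2 * pi * j / N)"
      using \<open>\<zeta> = 1\<close> by (simp add: \<omega>_def Complex.DeMoivre mult_ac)
    then have "exp (2 * of_real pi * \<i> * of_nat i / of_nat N) = exp (2 * of_real pi * \<i> * of_nat j / of_nat N)"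
      by (simp add: cis_conv_exp mult_ac)
    then show "i = j" using complex_root_unity_eq[of N i j] N assms by simp
  next
    assume "i = j"
    then show "\<zeta> = 1"
      by (metis \<zeta>_def \<omega>1 complex_cnj_power power_mult_distrib power_one)
  qed
  ultimately show ?thesis
    unfolding eq by (auto simp: sum_gp_strict)
qed

definition l2 :: "complex poly \<Rightarrow> real" where
  "l2 p = (\<Sum>\<^sub>\<infinity>n. (cmod (coeff p n))\<^sup>2)"

lemma l2_has_sum: "((\<lambda>n. (cmod (coeff p n))\<^sup>2) has_sum l2 p) UNIV"
  and l2_eq: "degree p < N \<Longrightarrow> l2 p = (\<Sum>n<N. (cmod (coeff p n))\<^sup>2)"
proof -
  have *: "((\<lambda>n. (cmod (coeff p n))\<^sup>2) has_sum (\<Sum>n<N. (cmod (coeff p n))\<^sup>2)) UNIV"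
    if "degree p < N" for N
  proof -
    have "((\<lambda>n. (cmod (coeff p n))\<^sup>2) has_sum (\<Sum>n<N. (cmod (coeff p n))\<^sup>2)) {..<N}" by simp
    then show ?thesis
      by (rule has_sum_cong_neutral[THEN iffD1, rotated -1]) (use that in \<open>auto simp: coeff_eq_0\<close>)
  qed
  show "degree p < N \<Longrightarrow> l2 p = (\<Sum>n<N. (cmod (coeff p n))\<^sup>2)"
    unfolding l2_def using * by (blast intro: infsumI)
  show "((\<lambda>n. (cmod (coeff p n))\<^sup>2) has_sum l2 p) UNIV"
    using *[of "Suc (degree p)"] unfolding l2_def by (metis infsumI lessI)
qed

text \<open>With more nodes than the degree, averaging over roots of unity is exact and plays the
  part of integration over the circle.\<close>

lemma parseval_roots_of_unity:
  assumes "degree p < N"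
  shows "(\<Sum>k<N. (cmod (poly p (cis (2 * pi / N) ^ k)))\<^sup>2) = N * l2 p"
proof -
  define \<omega> where "\<omega> = cis (2 * pi / N)"
  have poly: "poly p x = (\<Sum>i<N. coeff p i * x ^ i)" for x
  proof -
    have "poly p x = (\<Sum>i\<le>degree p. coeff p i * x ^ i)" by (rule poly_altdef)
    also have "\<dots> = (\<Sum>i<N. coeff p i * x ^ i)"
      by (rule sum.mono_neutral_left) (use assms in \<open>auto simp: coeff_eq_0\<close>)
    finally show ?thesis .
  qed
  have "complex_of_real (\<Sum>k<N. (cmod (poly p (\<omega> ^ k)))\<^sup>2)
      = (\<Sum>k<N. \<Sum>i<N. \<Sum>j<N. coeff p i * cnj (coeff p j) * ((\<omega> ^ k) ^ i * cnj ((\<omega> ^ k) ^ j)))"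
    by (simp add: poly complex_norm_square sum_product mult_ac del: of_real_power complex_cnj_power flip: of_real_power)
  also have "\<dots> = (\<Sum>i<N. \<Sum>k<N. \<Sum>j<N. coeff p i * cnj (coeff p j) * ((\<omega> ^ k) ^ i * cnj ((\<omega> ^ k) ^ j)))"
    by (rule sum.swap)
  also have "\<dots> = (\<Sum>i<N. \<Sum>j<N. \<Sum>k<N. coeff p i * cnj (coeff p j) * ((\<omega> ^ k) ^ i * cnj ((\<omega> ^ k) ^ j)))"
    by (intro sum.cong sum.swap refl)
  also have "\<dots> = (\<Sum>i<N. \<Sum>j<N. coeff p i * cnj (coeff p j) * (if i = j then of_nat N else 0))"
  proof (intro sum.cong refl)
    fix i j assume "i \<in> {..<N}" "j \<in> {..<N}"
    then have "(\<Sum>k<N. (\<omega> ^ k) ^ i * cnj ((\<omega> ^ k) ^ j)) = (if i = j then of_nat N else 0)"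
      unfolding \<omega>_def by (intro roots_of_unity_orthogonal) auto
    then show "(\<Sum>k<N. coeff p i * cnj (coeff p j) * ((\<omega> ^ k) ^ i * cnj ((\<omega> ^ k) ^ j)))
        = coeff p i * cnj (coeff p j) * (if i = j then of_nat N else 0)"
      by (simp only: sum_distrib_left[symmetric])
  qed
  also have "\<dots> = (\<Sum>i<N. coeff p i * cnj (coeff p i) * of_nat N)"
    by (simp add: if_distrib[of "\<lambda>x. _ * x"] cong: if_cong)
  also have "\<dots> = complex_of_real (N * l2 p)"
    by (simp add: l2_eq[OF assms] sum_distrib_left complex_norm_square mult_ac del: of_real_power flip: of_real_power)
  finally show ?thesis unfolding \<omega>_def of_real_eq_iff .
qed

text \<open>Both polynomials are sampled at the same roots of unity, where the pointwise bound
  applies. This is how bounds on symbols become bounds on operators.\<close>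

lemma l2_mono:
  assumes "\<And>u. cmod u = 1 \<Longrightarrow> cmod (poly p u) \<le> M * cmod (poly q u)"
  shows "l2 p \<le> M\<^sup>2 * l2 q"
proof -
  define N where "N = Suc (max (degree p) (degree q))"
  have "N * l2 p = (\<Sum>k<N. (cmod (poly p (cis (2 * pi / N) ^ k)))\<^sup>2)"
    by (rule parseval_roots_of_unity[symmetric]) (simp add: N_def)
  also have "\<dots> \<le> (\<Sum>k<N. (M * cmod (poly q (cis (2 * pi / N) ^ k)))\<^sup>2)"
    by (intro sum_mono power_mono assms) (simp_all add: norm_power)
  also have "\<dots> = M\<^sup>2 * (N * l2 q)"
    by (subst parseval_roots_of_unity[symmetric])
       (simp_all only: power_mult_distrib sum_distrib_left N_def max.commute less_Suc_eq_le max.cobounded1)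
  finally have "real N * l2 p \<le> real N * (M\<^sup>2 * l2 q)" by (simp add: mult_ac)
  then show ?thesis by (simp add: N_def)
qed

lemma l2_le:
  assumes "\<And>u. cmod u = 1 \<Longrightarrow> cmod (poly p u) \<le> M"
  shows "l2 p \<le> M\<^sup>2"
proof -
  have "l2 p \<le> M\<^sup>2 * l2 1" by (rule l2_mono) (simp add: assms)
  also have "l2 1 = 1" by (simp add: l2_eq[of _ 1])
  finally show ?thesis by simp
qed

lemma has_sum_pants_idx:
  fixes f :: "pants_idx \<Rightarrow> 'a :: topological_comm_monoid_add"
  assumes "((\<lambda>n. f (idxE n)) has_sum A) UNIV" "((\<lambda>n. f (idxF n)) has_sum B) UNIV"
    "((\<lambda>n. f (idxG n)) has_sum C) UNIV"
  shows "(f has_sum (A + B + C)) UNIV"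
proof -
  have "(f has_sum A) (range idxE)" "(f has_sum B) (range idxF)" "(f has_sum C) (range idxG)"
    using assms by (simp_all add: has_sum_reindex inj_on_def o_def)
  then have "(f has_sum (A + B + C)) (range idxE \<union> range idxF \<union> range idxG)"
    by (intro has_sum_Un_disjoint) auto
  moreover have "range idxE \<union> range idxF \<union> range idxG = UNIV"
  proof -
    have "i \<in> range idxE \<union> range idxF \<union> range idxG" for i by (cases i) auto
    then show ?thesis by blast
  qed
  ultimately show ?thesis by simp
qed

text \<open>Polynomials give finitely supported vectors; the first argument shifts all three branches
  away from the indices on which the three shifts interact.\<close>

primrec pvec_coord :: "nat \<Rightarrow> complex poly \<Rightarrow> complex poly \<Rightarrow> complex poly \<Rightarrow> pants_idx \<Rightarrow> complex" where
  "pvec_coord m p q r (idxE n) = coeff (monom 1 m * p) n"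
| "pvec_coord m p q r (idxF n) = coeff (monom 1 m * q) n"
| "pvec_coord m p q r (idxG n) = coeff (monom 1 m * r) n"

definition pvec :: "nat \<Rightarrow> complex poly \<Rightarrow> complex poly \<Rightarrow> complex poly \<Rightarrow> hvec" where
  "pvec m p q r = Ell2 (pvec_coord m p q r)"

lemma l2_monom_mult: "l2 (monom 1 m * p) = l2 p"
proof (rule antisym)
  have "l2 (monom 1 m * p) \<le> 1\<^sup>2 * l2 p" "l2 p \<le> 1\<^sup>2 * l2 (monom 1 m * p)"
    by (rule l2_mono; simp add: poly_monom norm_mult norm_power)+
  then show "l2 (monom 1 m * p) \<le> l2 p" "l2 p \<le> l2 (monom 1 m * p)" by simp_all
qed

lemma pvec_has_sum: "((\<lambda>i. (cmod (pvec_coord m p q r i))\<^sup>2) has_sum (l2 p + l2 q + l2 r)) UNIV"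
  using l2_has_sum[of "monom 1 m * p"] l2_has_sum[of "monom 1 m * q"] l2_has_sum[of "monom 1 m * r"]
  unfolding l2_monom_mult by (intro has_sum_pants_idx) simp_all

lemma coord_pvec: "coord (pvec m p q r) = pvec_coord m p q r"
  unfolding pvec_def by (rule Ell2_inverse) (unfold summable_on_def mem_Collect_eq, rule exI, rule pvec_has_sum)

lemma norm_pvec: "(norm (pvec m p q r))\<^sup>2 = l2 p + l2 q + l2 r"
  unfolding norm_ell2_sq coord_pvec by (rule infsumI) (rule pvec_has_sum)

lemma pvec_add: "pvec m p q r + pvec m p' q' r' = pvec m (p + p') (q + q') (r + r')"
  by (rule hvec_eqI) (simp_all add: coord_pvec algebra_simps)

lemma pvec_diff: "pvec m p q r - pvec m p' q' r' = pvec m (p - p') (q - q') (r - r')"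
  by (rule hvec_eqI) (simp_all add: coord_pvec algebra_simps)

lemma scaleC_pvec: "scaleC k (pvec m p q r) = pvec m (smult k p) (smult k q) (smult k r)"
  by (rule hvec_eqI) (simp_all add: coord_pvec)

lemma pvec_shift: "pvec (m + e) p q r = pvec m (monom 1 e * p) (monom 1 e * q) (monom 1 e * r)"
  by (rule hvec_eqI) (simp_all add: coord_pvec mult.assoc[symmetric] mult_monom)

lemma trunc_pvec: "k \<le> m \<Longrightarrow> trunc k (pvec m p q r) = 0"
  by (rule hvec_eqI) (auto simp: coord_pvec coeff_monom_mult)

text \<open>As \<open>n\<close> grows, these polynomial vectors approximate the part of
  \<open>x\<close> beyond depth \<open>d\<close>; estimates for \<open>pvec\<close> therefore extend
  to all of it.\<close>

lemma trunc_diff_eq_pvec: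
  assumes "d \<le> n"
  shows "\<exists>p q r. trunc n x - trunc d x = pvec d p q r"
proof -
  define P where "P f = (\<Sum>i<n-d. monom (coord x (f (i + d))) i)" for f :: "nat \<Rightarrow> pants_idx"
  have P: "coeff (monom 1 d * P f) k = (if d \<le> k \<and> k < n then coord x (f k) else 0)" for f k
    by (auto simp: P_def coeff_monom_mult coeff_sum coeff_monom sum.delta)
  have "trunc n x - trunc d x = pvec d (P idxE) (P idxF) (P idxG)"
    by (rule hvec_eqI) (use assms in \<open>auto simp: coord_pvec P\<close>)
  then show ?thesis by blast
qed

section \<open>Multiplication by the coordinate as an operator on coefficients\<close>

lemma cip_simps:
  "cip x (y + z) = cip x y + cip x z" "cip x (t *\<^sub>R y) = of_real t * cip x y" "cip x 0 = 0"
  by (simp_all add: cip_eq_inner inner_add_right scaleC_simps complex_eq_iff)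

primrec shiftE :: "pants_idx \<Rightarrow> pants_idx option" where
  "shiftE (idxE n) = (case n of 0 \<Rightarrow> None | Suc k \<Rightarrow> Some (idxE k))"
| "shiftE (idxF n) = None"
| "shiftE (idxG n) = None"

text \<open>As in \<open>pperm\<close>, the value is the source of a coordinate. The value at
  \<open>idxE 0\<close> glues the branch to the first one: $z F_{-1} = r_1 E_0$.\<close>

primrec shiftF :: "pants_idx \<Rightarrow> pants_idx option" where
  "shiftF (idxE n) = (case n of 0 \<Rightarrow> Some (idxF 0) | Suc k \<Rightarrow> None)"
| "shiftF (idxF n) = Some (idxF (Suc n))"
| "shiftF (idxG n) = None"

primrec shiftG :: "pants_idx \<Rightarrow> pants_idx option" where
  "shiftG (idxE n) = (case n of 0 \<Rightarrow> Some (idxG 0) | Suc k \<Rightarrow> None)"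
| "shiftG (idxF n) = None"
| "shiftG (idxG n) = Some (idxG (Suc n))"

primrec keepG :: "pants_idx \<Rightarrow> pants_idx option" where
  "keepG (idxE n) = None"
| "keepG (idxF n) = None"
| "keepG (idxG n) = Some (idxG n)"

lemma shift_inj:
  "inj_on shiftE (dom shiftE)" "inj_on shiftF (dom shiftF)"
  "inj_on shiftG (dom shiftG)" "inj_on keepG (dom keepG)"
  by (rule inj_onI, rename_tac i j, case_tac i; case_tac j; auto split: nat.splits)+

locale pair_of_pants =
  fixes a r1 r2 :: real
  assumes r1_pos: "r1 > 0" and r2_pos: "r2 > 0" and a_pos: "0 < a" and a_less: "a < 1"
    and outer: "a + r2 < 1" and disjoint: "r1 + r2 < a"
begin

text \<open>Multiplication by the coordinate, written on coefficients; \<open>expand_Z\<close> ties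
  it to functions.\<close>

definition Z :: hop where
  "Z = pperm shiftE + r1 *\<^sub>R pperm shiftF + r2 *\<^sub>R pperm shiftG + a *\<^sub>R pperm keepG"

lemma coord_Z:
  "coord (Z x) (idxE 0) = of_real r1 * coord x (idxF 0) + of_real r2 * coord x (idxG 0)"
  "coord (Z x) (idxE (Suc n)) = coord x (idxE n)"
  "coord (Z x) (idxF n) = of_real r1 * coord x (idxF (Suc n))"
  "coord (Z x) (idxG n) = of_real r2 * coord x (idxG (Suc n)) + of_real a * coord x (idxG n)"
  by (simp_all add: Z_def blinfun.bilinear_simps coord_pperm shift_inj)

lemma clin_Z [simp, intro]: "clin Z"
  unfolding clin_def by (intro allI hvec_eqI_Suc) (simp_all add: coord_Z algebra_simps)

lemma Z_ket:
  "Z (ket (idxE n)) = ket (idxE (Suc n))"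
  "Z (ket (idxF 0)) = r1 *\<^sub>R ket (idxE 0)"
  "Z (ket (idxF (Suc n))) = r1 *\<^sub>R ket (idxF n)"
  "Z (ket (idxG 0)) = r2 *\<^sub>R ket (idxE 0) + a *\<^sub>R ket (idxG 0)"
  "Z (ket (idxG (Suc n))) = r2 *\<^sub>R ket (idxG n) + a *\<^sub>R ket (idxG (Suc n))"
  by (rule hvec_eqI_Suc; simp add: coord_Z)+

lemma coord_adj_Z:
  "coord (adj Z x) (idxE n) = coord x (idxE (Suc n))"
  "coord (adj Z x) (idxF 0) = of_real r1 * coord x (idxE 0)"
  "coord (adj Z x) (idxF (Suc n)) = of_real r1 * coord x (idxF n)"
  "coord (adj Z x) (idxG 0) = of_real r2 * coord x (idxE 0) + of_real a * coord x (idxG 0)"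
  "coord (adj Z x) (idxG (Suc n)) = of_real r2 * coord x (idxG n) + of_real a * coord x (idxG (Suc n))"
  by (simp_all only: coord_adj[OF clin_Z] Z_ket cip_simps cip_ket)

text \<open>The padding drops by one. A backward step uses it up, a diagonal term must restore one
  factor, and a forward step two. For the adjoint, forward and backward exchange their
  roles.\<close>

lemma Z_pvec: "blinfun_apply Z (pvec (Suc m) p q r) =
  pvec m (monom 1 2 * p) (smult r1 q) (smult a (monom 1 1 * r) + smult r2 r)"
proof (rule ell2_eqI)
  fix i
  show "coord (blinfun_apply Z (pvec (Suc m) p q r)) i =
    coord (pvec m (monom 1 2 * p) (smult r1 q) (smult a (monom 1 1 * r) + smult r2 r)) i"
  proof (cases i)
    case (idxE n)
    then show ?thesis
      by (cases n) (auto simp: coord_Z coord_pvec coeff_monom_mult numeral_2_eq_2 Suc_diff_le mult.assoc[symmetric] mult_monom)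
  next
    case (idxF n)
    then show ?thesis by (auto simp: coord_Z coord_pvec coeff_monom_mult)
  next
    case (idxG n)
    then show ?thesis
      by (auto simp: coord_Z coord_pvec coeff_monom_mult distrib_left mult.assoc[symmetric] mult_monom)
  qed
qed

lemma adj_Z_pvec: "blinfun_apply (adj Z) (pvec (Suc m) p q r) =
  pvec m p (smult r1 (monom 1 2 * q)) (smult a (monom 1 1 * r) + smult r2 (monom 1 2 * r))"
proof (rule ell2_eqI)
  fix i
  show "coord (blinfun_apply (adj Z) (pvec (Suc m) p q r)) i =
    coord (pvec m p (smult r1 (monom 1 2 * q)) (smult a (monom 1 1 * r) + smult r2 (monom 1 2 * r))) i"
  proof (cases i)
    case (idxE n)
    then show ?thesis by (auto simp: coord_adj_Z coord_pvec coeff_monom_mult)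
  next
    case (idxF n)
    then show ?thesis
      by (cases n) (auto simp: coord_adj_Z coord_pvec coeff_monom_mult mult.assoc[symmetric] mult_monom
          numeral_2_eq_2)
  next
    case (idxG n)
    then show ?thesis
      by (cases n) (auto simp: coord_adj_Z coord_pvec coeff_monom_mult mult.assoc[symmetric] mult_monom
         numeral_2_eq_2 distrib_left)
  qed
qed

end

section \<open>Multiplication by symbols on the unit circle, and wave packets\<close>

lemma unit_cnj:
  assumes "cmod u = 1"
  shows "cnj u * (u * y) = y"
proof -
  have "u * cnj u = 1" using assms by (simp add: complex_norm_square[symmetric])
  then have "cnj u * u * y = y" by (simp add: mult.commute[of u])
  then show ?thesis by (simp add: mult.assoc)
qed

text \<open>The factor \<open>u ^ d\<close> is the padding that has been used up; it lets
  \<open>p'\<close> be a polynomial although \<open>f\<close> may involve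
  \<open>cnj u\<close>.\<close>

definition acts :: "(complex \<Rightarrow> complex) \<Rightarrow> nat \<Rightarrow> complex poly \<Rightarrow> complex poly \<Rightarrow> bool" where
  "acts f d p p' \<longleftrightarrow> (\<forall>u. cmod u = 1 \<longrightarrow> poly p' u = f u * u ^ d * poly p u)"

lemma acts_l2:
  assumes "acts f d p p'" "\<And>u. cmod u = 1 \<Longrightarrow> cmod (f u) \<le> M" "M \<ge> 0"
  shows "l2 p' \<le> M\<^sup>2 * l2 p"
  by (rule l2_mono) (use assms in \<open>auto simp: acts_def norm_mult norm_power intro!: mult_right_mono\<close>)

text \<open>A unit vector whose generating function is a geometric sum in \<open>cnj u * v\<close>,
  hence peaks at \<open>v = u\<close>.\<close>

definition wave :: "complex \<Rightarrow> nat \<Rightarrow> complex poly" where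
  "wave u n = (\<Sum>k\<le>n. monom (cnj u ^ k / of_real (sqrt (real (Suc n)))) k)"

lemma coeff_wave: "coeff (wave u n) k = (if k \<le> n then cnj u ^ k / of_real (sqrt (real (Suc n))) else 0)"
  by (auto simp: wave_def coeff_sum coeff_monom sum.delta)

lemma l2_wave:
  assumes "cmod u = 1"
  shows "l2 (wave u n) = 1"
proof -
  have "degree (wave u n) < Suc n"
    unfolding less_Suc_eq_le by (rule degree_le) (simp add: coeff_wave)
  then have "l2 (wave u n) = (\<Sum>k<Suc n. (cmod (coeff (wave u n) k))\<^sup>2)" by (rule l2_eq)
  also have "\<dots> = (\<Sum>k<Suc n. 1 / real (Suc n))"
    by (rule sum.cong) (auto simp: coeff_wave norm_divide norm_power assms power_divide)
  finally show ?thesis by simp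
qed

text \<open>Multiplied by \<open>v - u\<close>, the geometric sum telescopes to two boundary terms
  of modulus one; the normalization supplies the decay.\<close>

lemma poly_wave_bound:
  assumes u: "cmod u = 1" and v: "cmod v = 1"
  shows "cmod (v - u) * cmod (poly (wave u n) v) \<le> 2 / sqrt (real (Suc n))"
proof -
  have uu: "u * cnj u = 1"
    using u by (metis complex_norm_square of_real_1 one_power2)
  have "(v - u) * (\<Sum>k\<le>n. (cnj u * v) ^ k) = cnj u ^ n * v ^ Suc n - u"
  proof (induction n)
    case (Suc n)
    have "(v - u) * (\<Sum>k\<le>Suc n. (cnj u * v) ^ k) = cnj u ^ n * v ^ Suc n - u + (v - u) * (cnj u * v) ^ Suc n"
      using Suc by (simp add: distrib_left)
    also have "(v - u) * (cnj u * v) ^ Suc n = cnj u ^ Suc n * v ^ Suc (Suc n) - (u * cnj u) * cnj u ^ n * v ^ Suc n"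
      by (simp add: power_mult_distrib algebra_simps)
    finally show ?case using uu by simp
  qed (simp add: algebra_simps)
  moreover have "poly (wave u n) v = (\<Sum>k\<le>n. (cnj u * v) ^ k) / of_real (sqrt (real (Suc n)))"
    by (simp add: wave_def poly_sum poly_monom power_mult_distrib sum_divide_distrib mult_ac)
  ultimately have "(v - u) * poly (wave u n) v = (cnj u ^ n * v ^ Suc n - u) / of_real (sqrt (real (Suc n)))"
    by simp
  then have "cmod (v - u) * cmod (poly (wave u n) v) = cmod (cnj u ^ n * v ^ Suc n - u) / sqrt (real (Suc n))"
    by (metis norm_mult norm_divide norm_of_real abs_of_nonneg real_sqrt_ge_zero of_nat_0_le_iff)
  also have "\<dots> \<le> 2 / sqrt (real (Suc n))"
  proof (rule divide_right_mono)
    have "cmod (cnj u ^ n * v ^ Suc n - u) \<le> cmod (cnj u ^ n * v ^ Suc n) + cmod u"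
      by (rule norm_triangle_ineq4)
    also have "\<dots> = 2" using u v by (simp add: norm_mult norm_power)
    finally show "cmod (cnj u ^ n * v ^ Suc n - u) \<le> 2" .
  qed simp
  finally show ?thesis .
qed

text \<open>A residual with a factor of size \<open>cmod (v - u)\<close> cancels the peak of the
  wave, so its norm decays uniformly on the circle.\<close>

lemma l2_wave_multiple:
  assumes u: "cmod u = 1"
    and e: "\<And>v. cmod v = 1 \<Longrightarrow> cmod (poly e v) \<le> C * cmod (v - u) * cmod (poly (wave u n) v)" and "C \<ge> 0"
  shows "l2 e \<le> (2 * C / sqrt (real (Suc n)))\<^sup>2"
proof (rule l2_le)
  fix v :: complex assume v: "cmod v = 1"
  have "cmod (poly e v) \<le> C * (cmod (v - u) * cmod (poly (wave u n) v))"
    using e[OF v] by (simp add: mult.assoc)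
  also have "\<dots> \<le> C * (2 / sqrt (real (Suc n)))"
    using poly_wave_bound[OF u v] \<open>C \<ge> 0\<close> by (intro mult_left_mono)
  finally show "cmod (poly e v) \<le> 2 * C / sqrt (real (Suc n))" by (simp add: mult.commute)
qed

lemma tendsto_wave_bound:
  assumes "\<And>n. (norm (y n :: hvec))\<^sup>2 \<le> (2 * C / sqrt (real (Suc n)))\<^sup>2" "C \<ge> 0"
  shows "y \<longlonglongrightarrow> 0"
proof (rule Lim_null_comparison)
  have "norm (y n) \<le> 2 * C / sqrt (real (Suc n))" for n
    by (rule power2_le_imp_le[OF assms(1)]) (use assms(2) in simp)
  then show "\<forall>\<^sub>F n in sequentially. norm (y n) \<le> 2 * C / sqrt (real (Suc n))" by simp
  have "(\<lambda>n. 2 * C * inverse (sqrt (real (Suc n)))) \<longlonglongrightarrow> 2 * C * 0"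
    by (intro tendsto_intros tendsto_inverse_0_at_top filterlim_compose[OF sqrt_at_top]
        filterlim_compose[OF filterlim_real_sequentially] filterlim_Suc)
  then show "(\<lambda>n. 2 * C / sqrt (real (Suc n))) \<longlonglongrightarrow> 0" by (simp add: divide_inverse)
qed

lemma l2_0 [simp]: "l2 0 = 0"
  by (simp add: l2_def)

lemma pvec_Suc: "pvec (Suc m) p q r = pvec m (monom 1 1 * p) (monom 1 1 * q) (monom 1 1 * r)"
  using pvec_shift[of m 1] by simp

context pair_of_pants
begin

section \<open>Polynomials in the operator and its adjoint\<close>

definition X :: "complex set" where
  "X = sphere 0 1 \<union> sphere 0 r1 \<union> sphere (of_real a) r2"

text \<open>Noncommutative words in \<open>Z\<close> and its adjoint are paired with their
  commutative symbols. It is a relation because one operator may arise from several words. Constants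
  are absent, as the generated algebra is not assumed unital.\<close>

inductive pol :: "hop \<Rightarrow> (complex \<Rightarrow> complex) \<Rightarrow> bool" where
  pol_Z: "pol Z (\<lambda>w. w)"
| pol_adj_Z: "pol (adj Z) cnj"
| pol_add: "pol S F \<Longrightarrow> pol T G \<Longrightarrow> pol (S + T) (\<lambda>w. F w + G w)"
| pol_cmul: "pol T F \<Longrightarrow> pol (cmul k o\<^sub>L T) (\<lambda>w. k * F w)"
| pol_mult: "pol S F \<Longrightarrow> pol T G \<Longrightarrow> pol (S o\<^sub>L T) (\<lambda>w. F w * G w)"

lemma compact_X: "compact X"
  unfolding X_def by (intro compact_Un) auto

lemma X_ne: "X \<noteq> {}"
proof -
  have "1 \<in> X" by (simp add: X_def)
  then show ?thesis by blast
qed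

lemma pol_continuous: "pol T F \<Longrightarrow> continuous_on A F"
  by (induction rule: pol.induct) (auto intro!: continuous_intros)

lemma pol_clin: "pol T F \<Longrightarrow> clin T"
  by (induction rule: pol.induct) auto

lemma pol_diff:
  assumes "pol S F" "pol T G"
  shows "pol (S - T) (\<lambda>w. F w - G w)"
  using pol_add[OF assms(1) pol_cmul[OF assms(2), of "-1"]] by (simp add: cmul_minus_1)

lemma pol_adj: "pol T F \<Longrightarrow> \<exists>S. pol S (\<lambda>w. cnj (F w)) \<and> adj T = S"
proof (induction rule: pol.induct)
  case pol_Z
  then show ?case using pol.pol_adj_Z by simp
next
  case pol_adj_Z
  then show ?case using pol.pol_Z by simp
next
  case (pol_add S F T G)
  then show ?case using pol.pol_add by (auto simp: adj_add)
next
  case (pol_cmul T F k)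
  have "adj (cmul k o\<^sub>L T) = cmul (cnj k) o\<^sub>L adj T"
    using pol_clin[OF pol_cmul(1)] by (simp add: adj_compose adj_cmul clin_cmul_commute clin_adj)
  then show ?case using pol_cmul pol.pol_cmul by auto
next
  case (pol_mult S F T G)
  then have "pol (adj T o\<^sub>L adj S) (\<lambda>w. cnj (G w) * cnj (F w))" using pol.pol_mult by auto
  then show ?case by (auto simp: adj_compose mult.commute)
qed

text \<open>On the second and third branch \<open>Z\<close> moves indices backwards, which is
  multiplication by \<open>cnj u\<close> on the circle; hence the conjugates in the arguments of the
  symbol.\<close>

definition acts3 :: "(complex \<Rightarrow> complex) \<Rightarrow> nat \<Rightarrow> complex poly \<Rightarrow> complex poly \<Rightarrow> complex poly \<Rightarrow>
    complex poly \<Rightarrow> complex poly \<Rightarrow> complex poly \<Rightarrow> bool" where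
  "acts3 F d p q r p' q' r' \<longleftrightarrow> acts F d p p' \<and> acts (\<lambda>u. F (of_real r1 * cnj u)) d q q' \<and>
     acts (\<lambda>u. F (of_real a + of_real r2 * cnj u)) d r r'"

text \<open>The resulting polynomials do not depend on the remaining padding \<open>m\<close>; this
  lets statements for different operators be composed.\<close>

definition acts_as :: "hop \<Rightarrow> (complex \<Rightarrow> complex) \<Rightarrow> nat \<Rightarrow> bool" where
  "acts_as T F d \<longleftrightarrow> (\<forall>p q r. \<exists>p' q' r'. acts3 F d p q r p' q' r' \<and>
     (\<forall>m. T (pvec (m + d) p q r) = pvec m p' q' r'))"

lemma pol_acts:
  assumes "pol T F"
  shows "\<exists>d. acts_as T F d"
  using assms
proof (induction rule: pol.induct)
  case pol_Z
  show ?case unfolding acts_as_def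
  proof (rule exI[of _ "1::nat"], intro allI)
    fix p q r
    show "\<exists>p' q' r'. acts3 (\<lambda>w. w) 1 p q r p' q' r' \<and> (\<forall>m. Z (pvec (m + 1) p q r) = pvec m p' q' r')"
      by (rule exI[of _ "monom 1 2 * p"], rule exI[of _ "smult r1 q"],
          rule exI[of _ "smult a (monom 1 1 * r) + smult r2 r"])
         (auto simp: Z_pvec acts3_def acts_def poly_monom power2_eq_square distrib_right mult.assoc unit_cnj)
  qed
next
  case pol_adj_Z
  show ?case unfolding acts_as_def
  proof (rule exI[of _ "1::nat"], intro allI)
    fix p q r
    show "\<exists>p' q' r'. acts3 cnj 1 p q r p' q' r' \<and> (\<forall>m. adj Z (pvec (m + 1) p q r) = pvec m p' q' r')"
      by (rule exI[of _ "p"], rule exI[of _ "smult r1 (monom 1 2 * q)"],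
          rule exI[of _ "smult a (monom 1 1 * r) + smult r2 (monom 1 2 * r)"])
         (auto simp: adj_Z_pvec acts3_def acts_def poly_monom power2_eq_square distrib_right mult.assoc unit_cnj)
  qed
next
  case (pol_add S F T G)
  then obtain d e where d: "acts_as S F d"
    and e: "acts_as T G e" by blast
  show ?case unfolding acts_as_def
  proof (intro exI[of _ "d + e"] allI)
    fix p q r
    obtain p1 q1 r1' where 1: "acts3 F d p q r p1 q1 r1'" "\<And>m. S (pvec (m + d) p q r) = pvec m p1 q1 r1'"
      using d unfolding acts_as_def by blast
    obtain p2 q2 r2' where 2: "acts3 G e p q r p2 q2 r2'" "\<And>m. T (pvec (m + e) p q r) = pvec m p2 q2 r2'"
      using e unfolding acts_as_def by blast
    \<comment> \<open>The two summands use up different amounts of padding. Extra monomials bring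
      both to the common amount \<open>d + e\<close>.\<close>
    have "acts3 (\<lambda>w. F w + G w) (d + e) p q r (monom 1 e * p1 + monom 1 d * p2)
        (monom 1 e * q1 + monom 1 d * q2) (monom 1 e * r1' + monom 1 d * r2')"
      using 1(1) 2(1) unfolding acts3_def acts_def
      by (simp add: poly_monom power_add algebra_simps)
    moreover have "(S + T) (pvec (m + (d + e)) p q r) = pvec m (monom 1 e * p1 + monom 1 d * p2)
        (monom 1 e * q1 + monom 1 d * q2) (monom 1 e * r1' + monom 1 d * r2')" for m
    proof -
      have "S (pvec (m + (d + e)) p q r) = pvec (m + e) p1 q1 r1'"
        using 1(2)[of "m + e"] by (simp add: add_ac)
      moreover have "T (pvec (m + (d + e)) p q r) = pvec (m + d) p2 q2 r2'"
        using 2(2)[of "m + d"] by (simp add: add_ac)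
      ultimately show ?thesis
        by (simp add: blinfun.add_left pvec_shift[of m e] pvec_shift[of m d] pvec_add)
    qed
    ultimately show "\<exists>p' q' r'. acts3 (\<lambda>w. F w + G w) (d + e) p q r p' q' r' \<and>
      (\<forall>m. (S + T) (pvec (m + (d + e)) p q r) = pvec m p' q' r')" by blast
  qed
next
  case (pol_cmul T F k)
  then obtain d where d: "acts_as T F d" by blast
  show ?case unfolding acts_as_def
  proof (intro exI[of _ d] allI)
    fix p q r
    obtain p1 q1 r1' where 1: "acts3 F d p q r p1 q1 r1'" "\<And>m. T (pvec (m + d) p q r) = pvec m p1 q1 r1'"
      using d unfolding acts_as_def by blast
    have "acts3 (\<lambda>w. k * F w) d p q r (smult k p1) (smult k q1) (smult k r1')"
      using 1(1) unfolding acts3_def acts_def by simp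
    then show "\<exists>p' q' r'. acts3 (\<lambda>w. k * F w) d p q r p' q' r' \<and>
      (\<forall>m. (cmul k o\<^sub>L T) (pvec (m + d) p q r) = pvec m p' q' r')"
      using 1(2) by (auto simp: scaleC_pvec)
  qed
next
  case (pol_mult S F T G)
  then obtain d e where d: "acts_as S F d"
    and e: "acts_as T G e" by blast
  show ?case unfolding acts_as_def
  proof (intro exI[of _ "d + e"] allI)
    fix p q r
    obtain p2 q2 r2' where 2: "acts3 G e p q r p2 q2 r2'" "\<And>m. T (pvec (m + e) p q r) = pvec m p2 q2 r2'"
      using e unfolding acts_as_def by blast
    obtain p1 q1 r1' where 1: "acts3 F d p2 q2 r2' p1 q1 r1'" "\<And>m. S (pvec (m + d) p2 q2 r2') = pvec m p1 q1 r1'"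
      using d unfolding acts_as_def by blast
    have "acts3 (\<lambda>w. F w * G w) (d + e) p q r p1 q1 r1'"
      using 1(1) 2(1) unfolding acts3_def acts_def by (simp add: power_add mult_ac)
    moreover have "(S o\<^sub>L T) (pvec (m + (d + e)) p q r) = pvec m p1 q1 r1'" for m
      using 1(2)[of m] 2(2)[of "m + d"] by (simp add: add_ac)
    ultimately show "\<exists>p' q' r'. acts3 (\<lambda>w. F w * G w) (d + e) p q r p' q' r' \<and>
      (\<forall>m. (S o\<^sub>L T) (pvec (m + (d + e)) p q r) = pvec m p' q' r')" by blast
  qed
qed

section \<open>Norm bounds modulo compact operators\<close>

lemma circle_in_X:
  assumes "cmod u = 1"
  shows "u \<in> X" "of_real r1 * cnj u \<in> X" "of_real a + of_real r2 * cnj u \<in> X"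
  using assms r1_pos r2_pos by (auto simp: X_def dist_norm norm_mult)

text \<open>Beyond depth \<open>d\<close> the operator multiplies generating functions by the symbol
  on the three circles, so Parseval gives the bound there. Composing with \<open>trunc d\<close>
  subtracts everything of smaller depth.\<close>

lemma pol_upper:
  assumes T: "pol T F" and M: "\<And>w. w \<in> X \<Longrightarrow> cmod (F w) \<le> M"
  shows "\<exists>n. norm (T - (T o\<^sub>L trunc n)) \<le> M"
proof -
  have M0: "M \<ge> 0" using X_ne M by (meson equals0I norm_ge_zero order_trans)
  obtain d where d: "acts_as T F d" using pol_acts[OF T] by blast
  have *: "norm (T (pvec d p q r)) \<le> M * norm (pvec d p q r)" for p q r
  proof (rule power2_le_imp_le)
    obtain p' q' r' where p': "acts3 F d p q r p' q' r'" "T (pvec (0 + d) p q r) = pvec 0 p' q' r'"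
      using d unfolding acts_as_def by blast
    have "(norm (T (pvec d p q r)))\<^sup>2 = l2 p' + l2 q' + l2 r'" using p'(2) by (simp add: norm_pvec)
    also have "\<dots> \<le> M\<^sup>2 * l2 p + M\<^sup>2 * l2 q + M\<^sup>2 * l2 r"
      using p'(1) unfolding acts3_def
      by (intro add_mono) (auto intro: acts_l2 M circle_in_X M0)
    also have "\<dots> = (M * norm (pvec d p q r))\<^sup>2"
      by (simp add: power_mult_distrib norm_pvec algebra_simps)
    finally show "(norm (T (pvec d p q r)))\<^sup>2 \<le> (M * norm (pvec d p q r))\<^sup>2" .
  qed (use M0 in simp)
  have "norm (T - (T o\<^sub>L trunc d)) \<le> M"
  proof (rule norm_blinfun_bound)
    fix x
    have "norm (T (x - trunc d x)) \<le> M * norm (x - trunc d x)"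
    \<comment> \<open>The bound holds for the polynomial vectors
      \<open>trunc n x - trunc d x\<close> and passes to the limit in \<open>n\<close>.\<close>
    proof (rule LIMSEQ_le)
      show "(\<lambda>n. norm (T (trunc n x - trunc d x))) \<longlonglongrightarrow> norm (T (x - trunc d x))"
        "(\<lambda>n. M * norm (trunc n x - trunc d x)) \<longlonglongrightarrow> M * norm (x - trunc d x)"
        by (intro tendsto_intros trunc_tendsto)+
      show "\<exists>N. \<forall>n\<ge>N. norm (T (trunc n x - trunc d x)) \<le> M * norm (trunc n x - trunc d x)"
        using trunc_diff_eq_pvec[of d _ x] * by (intro exI[of _ d]) metis
    qed
    also have "\<dots> \<le> M * norm x" by (intro mult_left_mono norm_sub_trunc_le M0)
    finally show "norm ((T - (T o\<^sub>L trunc d)) x) \<le> M * norm x" by (simp add: blinfun.bilinear_simps)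
  qed (rule M0)
  then show ?thesis by blast
qed

text \<open>Since \<open>adj Z\<close> is a generator too, both operators must have \<open>x\<close>
  as approximate eigenvectors. The vanishing truncations make compact operators tend to zero along
  \<open>x\<close>.\<close>

definition approx_eigen :: "complex \<Rightarrow> (nat \<Rightarrow> hvec) \<Rightarrow> bool" where
  "approx_eigen w x \<longleftrightarrow> (\<forall>n. norm (x n) = 1) \<and> (\<forall>n. \<forall>m\<le>n. trunc m (x n) = 0) \<and>
     (\<lambda>n. Z (x n) - scaleC w (x n)) \<longlonglongrightarrow> 0 \<and> (\<lambda>n. adj Z (x n) - scaleC (cnj w) (x n)) \<longlonglongrightarrow> 0"

text \<open>\<open>V\<close> embeds polynomials into one branch, and \<open>e\<close>,
  \<open>e'\<close> are the residuals of the two eigenvalue equations. The padding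
  \<open>Suc n\<close> leaves one unit for \<open>Z\<close> or its adjoint to use up, while the
  vectors still escape to infinity.\<close>

lemma approx_eigenI:
  fixes V :: "nat \<Rightarrow> complex poly \<Rightarrow> hvec"
  assumes u: "cmod u = 1" and C: "C \<ge> 0"
    and norm: "\<And>m p. (norm (V m p))\<^sup>2 = l2 p" and trunc: "\<And>k m p. k \<le> m \<Longrightarrow> trunc k (V m p) = 0"
    and Z: "\<And>m p. Z (V (Suc m) p) - scaleC w (V (Suc m) p) = V m (e p)"
    and adj_Z: "\<And>m p. adj Z (V (Suc m) p) - scaleC (cnj w) (V (Suc m) p) = V m (e' p)"
    and e: "\<And>p v. cmod v = 1 \<Longrightarrow> cmod (poly (e p) v) \<le> C * cmod (v - u) * cmod (poly p v)"
      "\<And>p v. cmod v = 1 \<Longrightarrow> cmod (poly (e' p) v) \<le> C * cmod (v - u) * cmod (poly p v)"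
  shows "approx_eigen w (\<lambda>n. V (Suc n) (wave u n))"
  unfolding approx_eigen_def
proof (intro conjI allI impI)
  fix n
  have "(norm (V (Suc n) (wave u n)))\<^sup>2 = 1" by (simp add: norm l2_wave u)
  then show "norm (V (Suc n) (wave u n)) = 1"
    by (metis norm_ge_zero one_power2 power2_eq_imp_eq zero_le_one)
  show "trunc m (V (Suc n) (wave u n)) = 0" if "m \<le> n" for m using that by (intro trunc) simp
next
  show "(\<lambda>n. Z (V (Suc n) (wave u n)) - scaleC w (V (Suc n) (wave u n))) \<longlonglongrightarrow> 0"
    by (rule tendsto_wave_bound[OF _ C]) (unfold Z norm, rule l2_wave_multiple[OF u e(1) C])
  show "(\<lambda>n. adj Z (V (Suc n) (wave u n)) - scaleC (cnj w) (V (Suc n) (wave u n))) \<longlonglongrightarrow> 0"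
    by (rule tendsto_wave_bound[OF _ C]) (unfold adj_Z norm, rule l2_wave_multiple[OF u e(2) C])
qed

text \<open>On the first branch the wave is centred at \<open>w\<close> itself. On the other two it
  is centred at the conjugate of the rescaled point, because backward shifts multiply by
  \<open>cnj u\<close>.\<close>

lemma ex_approx_eigen:
  assumes "w \<in> X"
  shows "\<exists>x. approx_eigen w x"
proof -
  \<comment> \<open>One residual contains \<open>v - u\<close>, the other
    \<open>1 - cnj u * v\<close>; on the circle they have the same modulus.\<close>
  have one_minus: "cmod (1 - cnj u * v) = cmod (v - u)" if "cmod u = 1" for u v
  proof -
    have "u * cnj u = 1" using that by (metis complex_norm_square of_real_1 one_power2)
    then have "v - u = - u * (1 - cnj u * v)" by (simp add: algebra_simps)
    then show ?thesis using that by (metis norm_mult norm_minus_cancel mult_1)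
  qed
  consider "w \<in> sphere 0 1" | "w \<in> sphere 0 r1" | "w \<in> sphere (of_real a) r2"
    using assms by (auto simp: X_def)
  then show ?thesis
  proof cases
    case 1
    then have w: "cmod w = 1" by simp
    let ?e = "\<lambda>p. monom 1 2 * p - smult w (monom 1 1 * p)" and ?e' = "\<lambda>p. p - smult (cnj w) (monom 1 1 * p)"
    have e: "poly (?e p) v = v * ((v - w) * poly p v)" "poly (?e' p) v = (1 - cnj w * v) * poly p v" for p v
      by (simp_all add: poly_monom power2_eq_square algebra_simps)
    have "approx_eigen w (\<lambda>n. pvec (Suc n) (wave w n) 0 0)"
    proof (rule approx_eigenI[where C = 1 and V = "\<lambda>m p. pvec m p 0 0"])
      show "Z (pvec (Suc m) p 0 0) - scaleC w (pvec (Suc m) p 0 0) = pvec m (?e p) 0 0"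
        "adj Z (pvec (Suc m) p 0 0) - scaleC (cnj w) (pvec (Suc m) p 0 0) = pvec m (?e' p) 0 0" for m p
        unfolding Z_pvec adj_Z_pvec unfolding pvec_Suc scaleC_pvec pvec_diff by simp_all
      show "cmod (poly (?e p) v) \<le> 1 * cmod (v - w) * cmod (poly p v)"
        "cmod (poly (?e' p) v) \<le> 1 * cmod (v - w) * cmod (poly p v)" if "cmod v = 1" for p v
        unfolding e norm_mult one_minus[OF w] using that by simp_all
      show "trunc k (pvec m p 0 0) = 0" if "k \<le> m" for k m p using that by (rule trunc_pvec)
    qed (simp_all add: norm_pvec w)
    then show ?thesis by blast
  next
    case 2
    define u where "u = cnj w / of_real r1"
    have u: "cmod u = 1" and w: "w = of_real r1 * cnj u" "cnj w = of_real r1 * u"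
      using 2 r1_pos by (simp_all add: u_def norm_divide)
    let ?e = "\<lambda>p. smult r1 p - smult w (monom 1 1 * p)"
      and ?e' = "\<lambda>p. smult r1 (monom 1 2 * p) - smult (cnj w) (monom 1 1 * p)"
    have e: "poly (?e p) v = of_real r1 * ((1 - cnj u * v) * poly p v)"
      "poly (?e' p) v = of_real r1 * (v * ((v - u) * poly p v))" for p v
      unfolding w by (simp_all add: poly_monom power2_eq_square algebra_simps)
    have "approx_eigen w (\<lambda>n. pvec (Suc n) 0 (wave u n) 0)"
    proof (rule approx_eigenI[where C = r1 and V = "\<lambda>m p. pvec m 0 p 0"])
      show "Z (pvec (Suc m) 0 p 0) - scaleC w (pvec (Suc m) 0 p 0) = pvec m 0 (?e p) 0"
        "adj Z (pvec (Suc m) 0 p 0) - scaleC (cnj w) (pvec (Suc m) 0 p 0) = pvec m 0 (?e' p) 0" for m p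
        unfolding Z_pvec adj_Z_pvec unfolding pvec_Suc scaleC_pvec pvec_diff by simp_all
      show "cmod (poly (?e p) v) \<le> r1 * cmod (v - u) * cmod (poly p v)"
        "cmod (poly (?e' p) v) \<le> r1 * cmod (v - u) * cmod (poly p v)" if "cmod v = 1" for p v
        unfolding e norm_mult one_minus[OF u] using r1_pos that by simp_all
      show "trunc k (pvec m 0 p 0) = 0" if "k \<le> m" for k m p using that by (rule trunc_pvec)
    qed (use r1_pos in \<open>simp_all add: norm_pvec u\<close>)
    then show ?thesis by blast
  next
    case 3
    define u where "u = cnj (w - of_real a) / of_real r2"
    have "cmod (w - of_real a) = r2" using 3 by (metis dist_commute dist_norm mem_sphere)
    then have u: "cmod u = 1" and w: "w = of_real a + of_real r2 * cnj u" "cnj w = of_real a + of_real r2 * u"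
      using r2_pos by (simp_all add: u_def norm_divide del: complex_cnj_diff) (simp add: u_def)
    let ?e = "\<lambda>p. smult a (monom 1 1 * p) + smult r2 p - smult w (monom 1 1 * p)"
      and ?e' = "\<lambda>p. smult a (monom 1 1 * p) + smult r2 (monom 1 2 * p) - smult (cnj w) (monom 1 1 * p)"
    have e: "poly (?e p) v = of_real r2 * ((1 - cnj u * v) * poly p v)"
      "poly (?e' p) v = of_real r2 * (v * ((v - u) * poly p v))" for p v
      unfolding w by (simp_all add: poly_monom power2_eq_square algebra_simps)
    have "approx_eigen w (\<lambda>n. pvec (Suc n) 0 0 (wave u n))"
    proof (rule approx_eigenI[where C = r2 and V = "\<lambda>m p. pvec m 0 0 p"])
      show "Z (pvec (Suc m) 0 0 p) - scaleC w (pvec (Suc m) 0 0 p) = pvec m 0 0 (?e p)"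
        "adj Z (pvec (Suc m) 0 0 p) - scaleC (cnj w) (pvec (Suc m) 0 0 p) = pvec m 0 0 (?e' p)" for m p
        unfolding Z_pvec adj_Z_pvec unfolding pvec_Suc scaleC_pvec pvec_diff by simp_all
      show "cmod (poly (?e p) v) \<le> r2 * cmod (v - u) * cmod (poly p v)"
        "cmod (poly (?e' p) v) \<le> r2 * cmod (v - u) * cmod (poly p v)" if "cmod v = 1" for p v
        unfolding e norm_mult one_minus[OF u] using r2_pos that by simp_all
      show "trunc k (pvec m 0 0 p) = 0" if "k \<le> m" for k m p using that by (rule trunc_pvec)
    qed (use r2_pos in \<open>simp_all add: norm_pvec u\<close>)
    then show ?thesis by blast
  qed
qed

lemma pol_approx_eigen:
  assumes "pol T F" "approx_eigen w x"
  shows "(\<lambda>n. T (x n) - scaleC (F w) (x n)) \<longlonglongrightarrow> 0"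
  using assms(1)
proof (induction rule: pol.induct)
  case (pol_add S F T G)
  have "(\<lambda>n. (S (x n) - scaleC (F w) (x n)) + (T (x n) - scaleC (G w) (x n))) \<longlonglongrightarrow> 0 + 0"
    by (intro tendsto_add pol_add.IH)
  then show ?case by (simp add: blinfun.add_left scaleC_simps algebra_simps)
next
  case (pol_cmul T F k)
  have "(\<lambda>n. scaleC k (T (x n) - scaleC (F w) (x n))) \<longlonglongrightarrow> scaleC k 0"
    by (intro tendsto_scaleC pol_cmul.IH)
  then show ?case by (simp add: scaleC_simps)
next
  case (pol_mult S F T G)
  have "(\<lambda>n. S (T (x n) - scaleC (G w) (x n)) + scaleC (G w) (S (x n) - scaleC (F w) (x n)))
      \<longlonglongrightarrow> S 0 + scaleC (G w) 0"
    by (intro tendsto_add tendsto_scaleC pol_mult.IH blinfun.tendsto tendsto_const)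
  moreover have "S (T (x n) - scaleC (G w) (x n)) + scaleC (G w) (S (x n) - scaleC (F w) (x n))
      = (S o\<^sub>L T) (x n) - scaleC (F w * G w) (x n)" for n
    using pol_clin[OF pol_mult.hyps(1)]
    by (simp add: clin_def blinfun.bilinear_simps scaleC_simps mult.commute)
  ultimately show ?case by (simp add: blinfun.zero_right scaleC_simps)
qed (use assms(2) in \<open>simp_all add: approx_eigen_def\<close>)

text \<open>A compact operator almost factors through some \<open>trunc m\<close>, which annihilates
  \<open>x n\<close> for \<open>n \<ge> m\<close>.\<close>

lemma comp_op_approx_eigen:
  assumes "comp_op k" "approx_eigen w x"
  shows "(\<lambda>n. k (x n)) \<longlonglongrightarrow> 0"
proof (rule LIMSEQ_I)
  fix e :: real assume "e > 0"
  then obtain m where m: "norm (k - (k o\<^sub>L trunc m)) \<le> e / 2"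
    using comp_op_imp_approx_right[OF assms(1), of "e/2"] by auto
  have "norm (k (x n) - 0) < e" if "n \<ge> m" for n
  proof -
    have x: "trunc m (x n) = 0" "norm (x n) = 1" using assms(2) that by (auto simp: approx_eigen_def)
    then have "k (x n) = (k - (k o\<^sub>L trunc m)) (x n)" by (simp add: blinfun.bilinear_simps)
    then show ?thesis
      using norm_blinfun[of "k - (k o\<^sub>L trunc m)" "x n"] m x \<open>e > 0\<close> by simp
  qed
  then show "\<exists>no. \<forall>n\<ge>no. norm (k (x n) - 0) < e" by blast
qed

text \<open>Along approximate eigenvectors at \<open>w\<close>, \<open>T + k\<close> acts in the
  limit as the scalar \<open>F w\<close>, whatever the compact operator \<open>k\<close>.\<close>

lemma pol_lower:
  assumes "pol T F" "comp_op k" "w \<in> X"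
  shows "cmod (F w) \<le> norm (T + k)"
proof -
  obtain x where x: "approx_eigen w x" using ex_approx_eigen[OF assms(3)] by blast
  have "(\<lambda>n. norm ((T (x n) - scaleC (F w) (x n)) + k (x n)) + norm (T + k)) \<longlonglongrightarrow> norm (0 + 0 :: hvec) + norm (T + k)"
    by (intro tendsto_intros pol_approx_eigen[OF assms(1) x] comp_op_approx_eigen[OF assms(2) x])
  then have "(\<lambda>n. norm ((T (x n) - scaleC (F w) (x n)) + k (x n)) + norm (T + k)) \<longlonglongrightarrow> norm (T + k)" by simp
  moreover have "cmod (F w) \<le> norm ((T (x n) - scaleC (F w) (x n)) + k (x n)) + norm (T + k)" for n
  proof -
    have x1: "norm (x n) = 1" using x by (simp add: approx_eigen_def)
    have "cmod (F w) = norm ((T + k) (x n) - ((T (x n) - scaleC (F w) (x n)) + k (x n)))"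
      by (simp add: blinfun.add_left x1)
    also have "\<dots> \<le> norm ((T + k) (x n)) + norm ((T (x n) - scaleC (F w) (x n)) + k (x n))"
      by (rule norm_triangle_ineq4)
    also have "norm ((T + k) (x n)) \<le> norm (T + k)" using norm_blinfun[of "T + k" "x n"] x1 by simp
    finally show ?thesis by simp
  qed
  ultimately show ?thesis by (intro LIMSEQ_le_const) auto
qed

end

section \<open>Closed subalgebras of operators\<close>

text \<open>The counterpart of \<open>is_cstar_subalgebra\<close> on coefficients;
  \<open>csub_preimage\<close> translates from there.\<close>

definition csub :: "hop set \<Rightarrow> bool" where
  "csub A \<longleftrightarrow> (\<forall>T\<in>A. clin T) \<and> 0 \<in> A \<and> (\<forall>S\<in>A. \<forall>T\<in>A. S + T \<in> A) \<and>
     (\<forall>k. \<forall>T\<in>A. cmul k o\<^sub>L T \<in> A) \<and> (\<forall>S\<in>A. \<forall>T\<in>A. S o\<^sub>L T \<in> A) \<and> (\<forall>T\<in>A. adj T \<in> A) \<and>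
     (\<forall>f T. (\<forall>n::nat. f n \<in> A) \<and> f \<longlonglongrightarrow> T \<longrightarrow> T \<in> A)"

text \<open>The matrix unit that sends \<open>ket j\<close> to \<open>ket i\<close>.\<close>

definition unit_op :: "pants_idx \<Rightarrow> pants_idx \<Rightarrow> hop" where
  "unit_op i j = pperm (\<lambda>k. if k = i then Some j else None)"

lemma unit_op_inj: "inj_on (\<lambda>k. if k = i then Some j else None) (dom (\<lambda>k. if k = i then Some j else None))"
  by (auto simp: inj_on_def dom_def split: if_splits)

lemma coord_unit_op [simp]: "coord (blinfun_apply (unit_op i j) x) k = (if k = i then coord x j else 0)"
  by (simp add: unit_op_def coord_pperm[OF unit_op_inj])

lemma adj_unit_op: "adj (unit_op i j) = unit_op j i"
  unfolding unit_op_def by (rule adj_pperm) (auto split: if_splits)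

lemma unit_op_compose: "unit_op i j o\<^sub>L unit_op j l = unit_op i l"
  by (intro blinfun_eqI ell2_eqI) simp

text \<open>The finite matrix of \<open>T\<close>. Matrix units thus generate all two-sided
  truncations, which approximate a compact operator in norm.\<close>

lemma trunc_sandwich:
  assumes T: "clin T"
  shows "trunc n o\<^sub>L T o\<^sub>L trunc m =
    (\<Sum>i | depth i < n. \<Sum>j | depth j < m. cmul (coord (blinfun_apply T (ket j)) i) o\<^sub>L unit_op i j)"
proof (intro blinfun_eqI ell2_eqI)
  fix x k
  let ?c = "\<lambda>i j. coord (blinfun_apply T (ket j)) i"
  have "coord (blinfun_apply (trunc n o\<^sub>L T o\<^sub>L trunc m) x) k =
      (if depth k < n then \<Sum>j | depth j < m. ?c k j * coord x j else 0)"
    using T by (simp add: trunc_eq_sum[of m] blinfun.sum_right clin_def mult.commute)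
  also have "\<dots> = (\<Sum>i | depth i < n. if k = i then \<Sum>j | depth j < m. ?c i j * coord x j else 0)"
    using finite_depth_less[of n] by simp
  also have "\<dots> = (\<Sum>i | depth i < n. \<Sum>j | depth j < m. ?c i j * (if k = i then coord x j else 0))"
    by (intro sum.cong) auto
  also have "\<dots> = coord (blinfun_apply (\<Sum>i | depth i < n. \<Sum>j | depth j < m. cmul (?c i j) o\<^sub>L unit_op i j) x) k"
    by (simp add: blinfun.sum_left)
  finally show "coord (blinfun_apply (trunc n o\<^sub>L T o\<^sub>L trunc m) x) k = \<dots>" .
qed

lemma csub_closed:
  assumes "csub A" "\<And>n. f n \<in> A" "f \<longlonglongrightarrow> T"
  shows "T \<in> A"
  using assms unfolding csub_def by blast

context pair_of_pants
begin

section \<open>Density of polynomial symbols\<close>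

definition pol_approx :: "(complex \<Rightarrow> complex) \<Rightarrow> bool" where
  "pol_approx F \<longleftrightarrow> (\<forall>e>0. \<exists>T p. pol T p \<and> (\<forall>w\<in>X. cmod (F w - p w) < e))"

lemma pol_approxI: "pol T F \<Longrightarrow> pol_approx F"
  unfolding pol_approx_def by (metis norm_zero right_minus_eq)

lemma pol_approx_add:
  assumes "pol_approx F" "pol_approx G"
  shows "pol_approx (\<lambda>w. F w + G w)"
  unfolding pol_approx_def
proof (intro allI impI)
  fix e :: real assume "e > 0"
  then obtain S p T q where p: "pol S p" "\<forall>w\<in>X. cmod (F w - p w) < e / 2"
    and q: "pol T q" "\<forall>w\<in>X. cmod (G w - q w) < e / 2"
    using assms unfolding pol_approx_def by (meson half_gt_zero)
  have "cmod (F w + G w - (p w + q w)) < e" if "w \<in> X" for w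
  proof -
    have "cmod (F w + G w - (p w + q w)) \<le> cmod (F w - p w) + cmod (G w - q w)"
      using norm_triangle_ineq[of "F w - p w" "G w - q w"] by (simp add: algebra_simps)
    then show ?thesis using p(2) q(2) that by fastforce
  qed
  then show "\<exists>T p. pol T p \<and> (\<forall>w\<in>X. cmod (F w + G w - p w) < e)"
    using pol_add[OF p(1) q(1)] by blast
qed

lemma pol_approx_mult:
  assumes "pol_approx F" "pol_approx G" and cont: "continuous_on X F" "continuous_on X G"
  shows "pol_approx (\<lambda>w. F w * G w)"
  unfolding pol_approx_def
proof (intro allI impI)
  fix e :: real assume "e > 0"
  have "bounded (F ` X)" "bounded (G ` X)"
    using cont compact_X by (auto intro: compact_imp_bounded compact_continuous_image)
  then obtain A B where A: "\<And>w. w \<in> X \<Longrightarrow> cmod (F w) \<le> A" and B: "\<And>w. w \<in> X \<Longrightarrow> cmod (G w) \<le> B"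
    unfolding bounded_iff by blast
  have AB: "A \<ge> 0" "B \<ge> 0" using X_ne A B by (meson equals0I norm_ge_zero order_trans)+
  \<comment> \<open>\<open>d \<le> 1\<close> gives \<open>cmod (q w) \<le> B + 1\<close>, so the
    error is at most \<open>A * d + d * (B + 1)\<close>, which is less than
    \<open>d * (A + B + 2)\<close>.\<close>
  define d where "d = min 1 (e / (A + B + 2))"
  have d: "0 < d" "d \<le> 1" "d * (A + B + 2) \<le> e"
  proof -
    show "0 < d" "d \<le> 1" using AB \<open>e > 0\<close> by (auto simp: d_def)
    have "d \<le> e / (A + B + 2)" by (simp add: d_def)
    then show "d * (A + B + 2) \<le> e" using AB by (subst (asm) pos_le_divide_eq) auto
  qed
  obtain S p T q where p: "pol S p" "\<And>w. w \<in> X \<Longrightarrow> cmod (F w - p w) < d"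
    and q: "pol T q" "\<And>w. w \<in> X \<Longrightarrow> cmod (G w - q w) < d"
    using assms(1,2) \<open>d > 0\<close> unfolding pol_approx_def by metis
  have "cmod (F w * G w - p w * q w) < e" if w: "w \<in> X" for w
  proof -
    have "cmod (q w) \<le> cmod (G w) + cmod (G w - q w)"
      by (metis norm_minus_commute norm_triangle_sub)
    then have qb: "cmod (q w) \<le> B + 1" using B[OF w] q(2)[OF w] d(2) by linarith
    have "F w * G w - p w * q w = F w * (G w - q w) + (F w - p w) * q w" by (simp add: algebra_simps)
    then have "cmod (F w * G w - p w * q w) \<le> cmod (F w) * cmod (G w - q w) + cmod (F w - p w) * cmod (q w)"
      by (metis norm_mult norm_triangle_ineq)
    also have "\<dots> \<le> A * d + d * (B + 1)"
      using A[OF w] qb p(2)[OF w] q(2)[OF w] AB d(1) by (intro add_mono mult_mono) auto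
    also have "\<dots> < d * (A + B + 2)" using d(1) by (simp add: algebra_simps)
    finally show ?thesis using d(3) by linarith
  qed
  then show "\<exists>T r. pol T r \<and> (\<forall>w\<in>X. cmod (F w * G w - r w) < e)"
    using pol_mult[OF p(1) q(1)] by blast
qed

text \<open>The origin lies in the hole of radius \<open>r1\<close>, and the other hole keeps
  distance \<open>a - r2\<close> from it. The upper bound for the circle around \<open>a\<close> is
  \<open>a + r2 < 1\<close>.\<close>

lemma X_bounds: "\<exists>\<delta>>0. \<forall>w\<in>X. \<delta> \<le> cmod w \<and> cmod w \<le> 1"
proof -
  define \<delta> where "\<delta> = min r1 (a - r2)"
  have "\<delta> > 0" using r1_pos disjoint by (auto simp: \<delta>_def)
  moreover have "\<delta> \<le> cmod w \<and> cmod w \<le> 1" if "w \<in> X" for w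
  proof -
    have "cmod w \<le> a + r2" "cmod w \<ge> a - r2" if "dist (of_real a) w = r2"
      using that norm_triangle_ineq[of "of_real a" "w - of_real a"] a_pos
        norm_triangle_ineq2[of "of_real a" "of_real a - w"]
      by (auto simp: dist_norm norm_minus_commute)
    then show ?thesis using \<open>w \<in> X\<close> r1_pos r2_pos disjoint outer a_less by (auto simp: X_def \<delta>_def)
  qed
  ultimately show ?thesis by blast
qed

text \<open>The identity is not among the generators, but \<open>0 \<notin> X\<close>, so the constant \<open>1\<close> is the uniform limit
  of the polynomials $1 - (1 - |w|^2)^n$ without constant term.\<close>

lemma pol_approx_1: "pol_approx (\<lambda>w. 1)"
  unfolding pol_approx_def
proof (intro allI impI)
  fix e :: real assume "e > 0"
  obtain \<delta> where \<delta>: "\<delta> > 0" "\<And>w. w \<in> X \<Longrightarrow> \<delta> \<le> cmod w \<and> cmod w \<le> 1" using X_bounds by blast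
  have "\<delta> \<le> 1" using \<delta>(2) X_ne by force
  define c where "c = 1 - \<delta>\<^sup>2"
  have c: "0 \<le> c" "c < 1" using \<delta>(1) \<open>\<delta> \<le> 1\<close> by (auto simp: c_def power_le_one)
  obtain n where n: "c ^ n < e" using c \<open>e > 0\<close> real_arch_pow_inv by blast
  have "\<exists>T. pol T (\<lambda>w. 1 - (1 - w * cnj w) ^ Suc n)" for n
  proof (induction n)
    case 0
    show ?case using pol_mult[OF pol_Z pol_adj_Z] by auto
  next
    case (Suc n)
    define P where "P w = 1 - (1 - w * cnj w) ^ Suc n" for w
    obtain T where "pol T P" using Suc unfolding P_def by blast
    \<comment> \<open>With t = |w|^2, the next polynomial is 1 - (1 - t)(1 - P) = t + P - tP, again
      without constant term.\<close>
    from pol_diff[OF pol_add[OF pol_mult[OF pol_Z pol_adj_Z] this] pol_mult[OF pol_mult[OF pol_Z pol_adj_Z] this]]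
    obtain S where "pol S (\<lambda>w. w * cnj w + P w - w * cnj w * P w)" by blast
    moreover have "(\<lambda>w. w * cnj w + P w - w * cnj w * P w) = (\<lambda>w. 1 - (1 - w * cnj w) ^ Suc (Suc n))"
      by (rule ext) (simp add: P_def algebra_simps)
    ultimately show ?case by auto
  qed
  then obtain T where T: "pol T (\<lambda>w. 1 - (1 - w * cnj w) ^ Suc n)" by blast
  have "cmod (1 - (1 - (1 - w * cnj w) ^ Suc n)) < e" if "w \<in> X" for w
  proof -
    have w: "\<delta>\<^sup>2 \<le> (cmod w)\<^sup>2" "(cmod w)\<^sup>2 \<le> 1" using \<delta>(2)[OF that] \<delta>(1) by (auto intro: power_mono power_le_one)
    have "1 - w * cnj w = of_real (1 - (cmod w)\<^sup>2)"
      by (simp add: complex_norm_square[symmetric])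
    then have "cmod (1 - w * cnj w) = 1 - (cmod w)\<^sup>2" using w(2) by (simp only: norm_of_real)
    then have "cmod (1 - (1 - (1 - w * cnj w) ^ Suc n)) = (1 - (cmod w)\<^sup>2) ^ Suc n" by (simp add: norm_power norm_mult)
    also have "\<dots> \<le> c ^ Suc n" using w by (intro power_mono) (auto simp: c_def)
    also have "\<dots> \<le> c ^ n" using c by (simp add: mult_left_le_one_le)
    finally show ?thesis using n by linarith
  qed
  with T show "\<exists>T p. pol T p \<and> (\<forall>w\<in>X. cmod (1 - p w) < e)" by blast
qed

lemma pol_approx_cmul:
  assumes "pol_approx F"
  shows "pol_approx (\<lambda>w. c * F w)"
  unfolding pol_approx_def
proof (intro allI impI)
  fix e :: real assume "e > 0"
  then have "e / (cmod c + 1) > 0" by (simp add: add_nonneg_pos)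
  then obtain T p where T: "pol T p" "\<And>w. w \<in> X \<Longrightarrow> cmod (F w - p w) < e / (cmod c + 1)"
    using assms unfolding pol_approx_def by blast
  have "cmod (c * F w - c * p w) < e" if "w \<in> X" for w
  proof -
    have "cmod (c * F w - c * p w) = cmod c * cmod (F w - p w)"
      by (simp add: norm_mult flip: right_diff_distrib)
    also have "\<dots> \<le> (cmod c + 1) * cmod (F w - p w)" by (simp add: mult_right_mono)
    also have "\<dots> < (cmod c + 1) * (e / (cmod c + 1))"
      using T(2)[OF that] by (intro mult_strict_left_mono) (auto simp: add_nonneg_pos)
    also have "\<dots> = e" by (simp add: add_nonneg_eq_0_iff)
    finally show ?thesis .
  qed
  then show "\<exists>T p. pol T p \<and> (\<forall>w\<in>X. cmod (c * F w - p w) < e)" using pol_cmul[OF T(1)] by blast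
qed

text \<open>Stone-Weierstrass is applied to the ring of continuous real functions that are uniformly
  approximable by complex polynomial symbols; the real and imaginary part already separate
  points.\<close>

lemma pol_approx_real:
  fixes f :: "complex \<Rightarrow> real"
  assumes f: "continuous_on X f"
  shows "pol_approx (\<lambda>w. of_real (f w))"
proof -
  define R where "R = {u :: complex \<Rightarrow> real. continuous_on X u \<and> pol_approx (\<lambda>w. of_real (u w))}"
  have Re: "Re \<in> R"
  proof -
    have "pol_approx (\<lambda>w. (1/2) * (w + cnj w))"
      by (rule pol_approxI[OF pol_cmul[OF pol_add[OF pol_Z pol_adj_Z]]])
    moreover have "(\<lambda>w. (1/2) * (w + cnj w)) = (\<lambda>w. of_real (Re w))" by (simp add: complex_add_cnj fun_eq_iff)
    ultimately show ?thesis by (auto simp: R_def intro: continuous_intros)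
  qed
  have Im: "Im \<in> R"
  proof -
    have "pol_approx (\<lambda>w. (- \<i> / 2) * (w - cnj w))"
      by (rule pol_approxI[OF pol_cmul[OF pol_diff[OF pol_Z pol_adj_Z]]])
    moreover have "(\<lambda>w. (- \<i> / 2) * (w - cnj w)) = (\<lambda>w. of_real (Im w))"
      by (simp add: fun_eq_iff complex_eq_iff)
    ultimately show ?thesis by (auto simp: R_def intro: continuous_intros)
  qed
  interpret function_ring_on R X
  proof
    show "compact X" by (rule compact_X)
    show "f \<in> R \<Longrightarrow> continuous_on X f" for f by (simp add: R_def)
    show "(\<lambda>x. f x + g x) \<in> R" if "f \<in> R" "g \<in> R" for f g
      using that pol_approx_add[of "\<lambda>w. of_real (f w)" "\<lambda>w. of_real (g w)"]
      by (auto simp: R_def intro: continuous_intros)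
    show "(\<lambda>x. f x * g x) \<in> R" if "f \<in> R" "g \<in> R" for f g
      using that pol_approx_mult[of "\<lambda>w. of_real (f w)" "\<lambda>w. of_real (g w)"]
      by (auto simp: R_def intro: continuous_intros)
    show "(\<lambda>_. c) \<in> R" for c
      using pol_approx_cmul[OF pol_approx_1, of "of_real c"] by (auto simp: R_def intro: continuous_intros)
    show "\<exists>f\<in>R. f x \<noteq> f y" if "x \<noteq> y" for x y
      using that Re Im complex_eq_iff by blast
  qed
  show ?thesis
    unfolding pol_approx_def
  proof (intro allI impI)
    fix e :: real assume "e > 0"
    then obtain g where g: "g \<in> R" "\<And>w. w \<in> X \<Longrightarrow> \<bar>f w - g w\<bar> < e / 2"
      using Stone_Weierstrass_basic[OF f, of "e/2"] by auto
    obtain T p where p: "pol T p" "\<And>w. w \<in> X \<Longrightarrow> cmod (of_real (g w) - p w) < e / 2"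
      using g(1) \<open>e > 0\<close> unfolding R_def pol_approx_def by (auto dest!: spec[of _ "e/2"])
    have "cmod (of_real (f w) - p w) < e" if "w \<in> X" for w
    proof -
      have "cmod (of_real (f w) - p w) \<le> cmod (of_real (f w) - of_real (g w)) + cmod (of_real (g w) - p w)"
        using norm_triangle_ineq[of "of_real (f w) - of_real (g w)" "of_real (g w) - p w"] by simp
      also have "cmod (of_real (f w) - of_real (g w)) = \<bar>f w - g w\<bar>"
        by (metis norm_of_real of_real_diff)
      finally show ?thesis using g(2)[OF that] p(2)[OF that] by linarith
    qed
    with p(1) show "\<exists>T p. pol T p \<and> (\<forall>w\<in>X. cmod (of_real (f w) - p w) < e)" by blast
  qed
qed

lemma pol_dense:
  assumes F: "continuous_on X F"
  shows "pol_approx F"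
proof -
  have "pol_approx (\<lambda>w. of_real (Re (F w)) + \<i> * of_real (Im (F w)))"
    by (intro pol_approx_add pol_approx_cmul pol_approx_real continuous_intros F)
  then show ?thesis by (simp add: complex_eq[symmetric])
qed

text \<open>For the self-commutator \<open>C\<close> of the operator \<open>z\<close>, which has rank three, \<open>C z^2 C - a C z C\<close> has
  rank one; moving it along the branches produces all matrix units.\<close>

lemma unit_op_in_csub:
  assumes A: "csub A" "Z \<in> A"
  shows "unit_op i j \<in> A"
proof -
  let ?G = "idxG 0"
  have add: "S + T \<in> A" and comp: "S o\<^sub>L T \<in> A" and cm: "cmul k o\<^sub>L T \<in> A" and ad: "adj T \<in> A"
    if "S \<in> A" "T \<in> A" for S T k
    using A(1) that unfolding csub_def by blast+
  have diff: "S - T \<in> A" if "S \<in> A" "T \<in> A" for S T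
  proof -
    have "S - T = S + (cmul (- 1) o\<^sub>L T)" by (simp add: cmul_minus_1)
    then show ?thesis using add[OF that(1) cm[OF that(2,2), of "- 1"]] by (simp only:)
  qed
  have cancel: "T \<in> A" if "cmul k o\<^sub>L T \<in> A" "k \<noteq> 0" for k T
  proof -
    have "T = cmul (1 / k) o\<^sub>L (cmul k o\<^sub>L T)"
      using that(2) by (intro blinfun_eqI ell2_eqI) simp
    then show ?thesis using cm that(1) by metis
  qed
  have Z: "Z \<in> A" "adj Z \<in> A" using A ad by auto
  define C where "C = (adj Z o\<^sub>L Z) - (Z o\<^sub>L adj Z)"
  \<comment> \<open>\<open>C\<close> has range in, and sees only, the first vectors of the three
    branches. On these, C (Z - a) Z kills \<open>ket (idxE 0)\<close> and
    \<open>ket (idxG 0)\<close> and sends \<open>ket (idxF 0)\<close> to -a r1 times the image of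
    \<open>ket (idxE 0)\<close> under \<open>C\<close>. As the \<open>idxF 0\<close> coordinate
    after \<open>C\<close> comes from \<open>idxG 0\<close> alone, \<open>R\<close> has rank
    one.\<close>
  define R where "R = (C o\<^sub>L Z o\<^sub>L Z o\<^sub>L C) - (cmul a o\<^sub>L (C o\<^sub>L Z o\<^sub>L C))"
  have "C \<in> A" unfolding C_def by (intro diff comp Z)
  then have "R \<in> A" unfolding R_def by (intro diff comp cm Z)
  have C: "coord (blinfun_apply C x) (idxE 0) = (1 - r1\<^sup>2 - r2\<^sup>2) * coord x (idxE 0) - a * r2 * coord x ?G"
      "coord (blinfun_apply C x) (idxE (Suc n)) = 0"
      "coord (blinfun_apply C x) (idxF 0) = r1 * r2 * coord x ?G"
      "coord (blinfun_apply C x) (idxF (Suc n)) = 0"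
      "coord (blinfun_apply C x) ?G = r1 * r2 * coord x (idxF 0) - a * r2 * coord x (idxE 0)"
      "coord (blinfun_apply C x) (idxG (Suc n)) = 0" for x n
    by (simp_all add: C_def blinfun.diff_left coord_Z coord_adj_Z algebra_simps power2_eq_square)
  define \<alpha> where "\<alpha> = - a * r1\<^sup>2 * r2 * (1 - r1\<^sup>2 - r2\<^sup>2)"
  define \<beta> where "\<beta> = a\<^sup>2 * r1\<^sup>2 * r2\<^sup>2"
  have R: "R = (cmul \<alpha> o\<^sub>L unit_op (idxE 0) ?G) + (cmul \<beta> o\<^sub>L unit_op ?G ?G)"
      by (rule blinfun_eqI, rule hvec_eqI_Suc) (simp_all add: R_def blinfun.diff_left blinfun.add_left C coord_Z \<alpha>_def \<beta>_def algebra_simps power2_eq_square)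
  \<comment> \<open>\<open>R\<close> reads only the coordinate at \<open>idxG 0\<close>, so this
    product is a multiple of one diagonal matrix unit; \<open>\<beta>\<close> keeps the multiple
    nonzero.\<close>
  have "adj R o\<^sub>L R = cmul (\<alpha>\<^sup>2 + \<beta>\<^sup>2) o\<^sub>L unit_op ?G ?G"
  proof -
    have "adj R = (unit_op ?G (idxE 0) o\<^sub>L cmul \<alpha>) + (unit_op ?G ?G o\<^sub>L cmul \<beta>)"
      by (simp add: R adj_add adj_compose adj_unit_op adj_cmul)
    then show ?thesis
      by (intro blinfun_eqI ell2_eqI) (simp add: R blinfun.add_left algebra_simps power2_eq_square)
  qed
  moreover have "\<alpha>\<^sup>2 + \<beta>\<^sup>2 \<noteq> 0"
  proof -
    have "\<beta> \<noteq> 0" using a_pos r1_pos r2_pos by (simp add: \<beta>_def)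
    then have "0 < \<alpha>\<^sup>2 + \<beta>\<^sup>2" by (simp add: add_nonneg_pos)
    then show ?thesis by (rule less_imp_neq[symmetric])
  qed
  then have "(complex_of_real \<alpha>)\<^sup>2 + (complex_of_real \<beta>)\<^sup>2 \<noteq> 0"
    by (metis of_real_add of_real_eq_0_iff of_real_power)
  moreover have "adj R o\<^sub>L R \<in> A" using \<open>R \<in> A\<close> by (intro comp ad)
  ultimately have G0: "unit_op ?G ?G \<in> A" using cancel by simp
  have nz: "complex_of_real r1 \<noteq> 0" "complex_of_real r2 \<noteq> 0" using r1_pos r2_pos by auto
  \<comment> \<open>Every branch is reached from \<open>idxG 0\<close> by solving the action of
    \<open>Z\<close> or its adjoint on a basis vector for the next one. Diagonal terms are
    subtracted and the nonzero weights \<open>r1\<close>, \<open>r2\<close> divided out.\<close>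
  have G: "unit_op (idxG n) ?G \<in> A" for n
  proof (induction n)
    case (Suc n)
    have "cmul r2 o\<^sub>L unit_op (idxG (Suc n)) ?G = (adj Z o\<^sub>L unit_op (idxG n) ?G) - (cmul a o\<^sub>L unit_op (idxG n) ?G)"
      by (rule blinfun_eqI, rule hvec_eqI_Suc) (auto simp: blinfun.diff_left coord_adj_Z)
    also have "\<dots> \<in> A" using Suc by (intro diff comp cm Z)
    finally show ?case using nz(2) by (rule cancel)
  qed (rule G0)
  have E0: "unit_op (idxE 0) ?G \<in> A"
  proof -
    have "cmul r2 o\<^sub>L unit_op (idxE 0) ?G = (Z o\<^sub>L unit_op ?G ?G) - (cmul a o\<^sub>L unit_op ?G ?G)"
      by (rule blinfun_eqI, rule hvec_eqI_Suc) (auto simp: blinfun.diff_left coord_Z)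
    also have "\<dots> \<in> A" using G0 by (intro diff comp cm Z)
    finally show ?thesis using nz(2) by (rule cancel)
  qed
  have E: "unit_op (idxE n) ?G \<in> A" for n
  proof (induction n)
    case (Suc n)
    have "unit_op (idxE (Suc n)) ?G = Z o\<^sub>L unit_op (idxE n) ?G"
      by (rule blinfun_eqI, rule hvec_eqI_Suc) (auto simp: coord_Z)
    then show ?case using Suc by (simp add: comp Z)
  qed (rule E0)
  have F: "unit_op (idxF n) ?G \<in> A" for n
  proof (induction n)
    case 0
    have "cmul r1 o\<^sub>L unit_op (idxF 0) ?G = (adj Z o\<^sub>L unit_op (idxE 0) ?G) - (cmul r2 o\<^sub>L unit_op ?G ?G)"
      by (rule blinfun_eqI, rule hvec_eqI_Suc) (auto simp: blinfun.diff_left coord_adj_Z)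
    also have "\<dots> \<in> A" using G0 E0 by (intro diff comp cm Z)
    finally show ?case using nz(1) by (rule cancel)
  next
    case (Suc n)
    have "cmul r1 o\<^sub>L unit_op (idxF (Suc n)) ?G = adj Z o\<^sub>L unit_op (idxF n) ?G"
      by (rule blinfun_eqI, rule hvec_eqI_Suc) (auto simp: coord_adj_Z)
    also have "\<dots> \<in> A" using Suc by (intro comp Z)
    finally show ?case using nz(1) by (rule cancel)
  qed
  have col: "unit_op i ?G \<in> A" for i by (cases i) (use E F G in auto)
  have "unit_op i j = unit_op i ?G o\<^sub>L adj (unit_op j ?G)" by (simp add: adj_unit_op unit_op_compose)
  also have "\<dots> \<in> A" by (intro comp ad[OF Z(1)] col)
  finally show ?thesis .
qed

text \<open>Truncating on both sides approximates \<open>T\<close> by finite combinations of matrix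
  units. This is what makes \<open>Alg\<close> minimal.\<close>

lemma compact_in_csub:
  assumes A: "csub A" "Z \<in> A" and T: "comp_op T" "clin T"
  shows "T \<in> A"
proof -
  have "\<exists>S\<in>A. norm (T - S) \<le> e" if e: "e > 0" for e
  proof -
    obtain n where n: "norm (T - (trunc n o\<^sub>L T)) \<le> e / 2"
      using comp_op_imp_approx[OF T(1), of "e/2"] e by auto
    obtain m where m: "norm ((trunc n o\<^sub>L T) - ((trunc n o\<^sub>L T) o\<^sub>L trunc m)) \<le> e / 2"
      using comp_op_imp_approx_right[OF comp_op_compose_left[OF T(1)], of "e/2" "trunc n"] e by auto
    have "trunc n o\<^sub>L T o\<^sub>L trunc m \<in> A"
    proof -
      have sum: "sum f I \<in> A" if "finite I" "\<And>i. i \<in> I \<Longrightarrow> f i \<in> A" for f and I :: "pants_idx set"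
        using that A(1) by (induction I rule: finite_induct) (auto simp: csub_def)
      show ?thesis unfolding trunc_sandwich[OF T(2)]
        using A unit_op_in_csub by (intro sum finite_depth_less) (auto simp: csub_def)
    qed
    moreover have "norm (T - (trunc n o\<^sub>L T o\<^sub>L trunc m)) \<le> e"
      using norm_triangle_ineq[of "T - (trunc n o\<^sub>L T)" "(trunc n o\<^sub>L T) - ((trunc n o\<^sub>L T) o\<^sub>L trunc m)"] n m
      by simp
    ultimately show ?thesis by blast
  qed
  then have "\<exists>S\<in>A. norm (T - S) \<le> 1 / real (Suc n)" for n by simp
  then obtain S where S: "\<And>n. S n \<in> A" "\<And>n. norm (T - S n) \<le> 1 / real (Suc n)" by metis
  have "(\<lambda>n. T - S n) \<longlonglongrightarrow> 0"
    by (rule Lim_null_comparison[OF _ LIMSEQ_Suc[OF lim_1_over_n]]) (use S(2) in simp)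
  then have "(\<lambda>n. T - (T - S n)) \<longlonglongrightarrow> T - 0" by (intro tendsto_intros)
  then have "S \<longlonglongrightarrow> T" by simp
  then show ?thesis using A(1) S(1) unfolding csub_def by blast
qed

section \<open>The symbol\<close>

definition symb_seq :: "(nat \<Rightarrow> hop) \<Rightarrow> (nat \<Rightarrow> complex \<Rightarrow> complex) \<Rightarrow> (nat \<Rightarrow> hop) \<Rightarrow> bool" where
  "symb_seq S p k \<longleftrightarrow> (\<forall>n. pol (S n) (p n) \<and> comp_op (k n) \<and> clin (k n))"

text \<open>The compact corrections vary with n because polynomial operators with uniformly
  convergent symbols converge only modulo compact operators. Only the values of \<open>F\<close> on
  \<open>X\<close> are determined.\<close>

definition symb :: "hop \<Rightarrow> (complex \<Rightarrow> complex) \<Rightarrow> bool" where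
  "symb T F \<longleftrightarrow> (\<exists>S p k. symb_seq S p k \<and> (\<lambda>n. S n + k n) \<longlonglongrightarrow> T \<and> uniform_limit X p F sequentially)"

lemma symb_continuous:
  assumes "symb T F"
  shows "continuous_on X F"
proof -
  obtain S p k where S: "symb_seq S p k" "uniform_limit X p F sequentially"
    using assms unfolding symb_def by blast
  have "continuous_on X (p n)" for n
    using S(1) pol_continuous unfolding symb_seq_def by blast
  then have "\<forall>\<^sub>F n in sequentially. continuous_on X (p n)" by simp
  then show ?thesis by (rule uniform_limit_theorem[OF _ S(2)]) simp
qed

lemma symb_clin:
  assumes "symb T F"
  shows "clin T"
proof -
  obtain S p k where S: "symb_seq S p k" "(\<lambda>n. S n + k n) \<longlonglongrightarrow> T"
    using assms unfolding symb_def by blast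
  have "clin (S n + k n)" for n using S(1) pol_clin unfolding symb_seq_def by blast
  then show ?thesis by (rule clin_limit[OF S(2)])
qed

lemma symb_pol_add_comp:
  assumes "pol T F" "comp_op k" "clin k"
  shows "symb (T + k) F"
  unfolding symb_def symb_seq_def
  by (rule exI[of _ "\<lambda>_. T"], rule exI[of _ "\<lambda>_. F"], rule exI[of _ "\<lambda>_. k"])
    (use assms in \<open>auto simp: uniform_limit_iff\<close>)

lemma symb_pol: "pol T F \<Longrightarrow> symb T F"
  using symb_pol_add_comp[of T F 0] by simp

lemma symb_comp:
  assumes "comp_op T" "clin T"
  shows "symb T (\<lambda>w. 0)"
proof -
  have "cmul 0 o\<^sub>L Z = 0" by (intro blinfun_eqI ell2_eqI) simp
  then have "pol 0 (\<lambda>w. 0)" using pol_cmul[OF pol_Z, of 0] by simp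
  then show ?thesis using symb_pol_add_comp assms by fastforce
qed

lemma symb_add:
  assumes "symb S F" "symb T G"
  shows "symb (S + T) (\<lambda>w. F w + G w)"
proof -
  obtain s p k where 1: "symb_seq s p k" "(\<lambda>n. s n + k n) \<longlonglongrightarrow> S" "uniform_limit X p F sequentially"
    using assms(1) unfolding symb_def by blast
  obtain t q l where 2: "symb_seq t q l" "(\<lambda>n. t n + l n) \<longlonglongrightarrow> T" "uniform_limit X q G sequentially"
    using assms(2) unfolding symb_def by blast
  have "symb_seq (\<lambda>n. s n + t n) (\<lambda>n w. p n w + q n w) (\<lambda>n. k n + l n)"
    using 1(1) 2(1) unfolding symb_seq_def by (auto intro: pol_add comp_op_add)
  moreover have "(\<lambda>n. (s n + t n) + (k n + l n)) \<longlonglongrightarrow> S + T"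
    using tendsto_add[OF 1(2) 2(2)] by (simp add: algebra_simps)
  ultimately show ?thesis unfolding symb_def using uniform_limit_add[OF 1(3) 2(3)] by blast
qed

lemma symb_mult:
  assumes "symb S F" "symb T G"
  shows "symb (S o\<^sub>L T) (\<lambda>w. F w * G w)"
proof -
  obtain s p k where 1: "symb_seq s p k" "(\<lambda>n. s n + k n) \<longlonglongrightarrow> S" "uniform_limit X p F sequentially"
    using assms(1) unfolding symb_def by blast
  obtain t q l where 2: "symb_seq t q l" "(\<lambda>n. t n + l n) \<longlonglongrightarrow> T" "uniform_limit X q G sequentially"
    using assms(2) unfolding symb_def by blast
  \<comment> \<open>Expanding (s + k)(t + l) as st plus the compact remainder sl + k(t + l).\<close>
  have "symb_seq (\<lambda>n. s n o\<^sub>L t n) (\<lambda>n w. p n w * q n w) (\<lambda>n. (s n o\<^sub>L l n) + (k n o\<^sub>L (t n + l n)))"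
    using 1(1) 2(1) unfolding symb_seq_def
    by (intro allI conjI pol_mult comp_op_add comp_op_compose_left[where T = "l _"] comp_op_compose_right
        clin_add clin_compose) (blast intro: pol_clin)+
  moreover have "(\<lambda>n. (s n o\<^sub>L t n) + ((s n o\<^sub>L l n) + (k n o\<^sub>L (t n + l n)))) \<longlonglongrightarrow> (S o\<^sub>L T)"
    using bounded_bilinear.tendsto[OF bounded_bilinear_blinfun_compose 1(2) 2(2)]
    by (simp add: bounded_bilinear.add_left[OF bounded_bilinear_blinfun_compose] bounded_bilinear.add_right[OF bounded_bilinear_blinfun_compose] add_ac)
  moreover have "uniform_limit X (\<lambda>n w. p n w * q n w) (\<lambda>w. F w * G w) sequentially"
    by (rule uniform_lim_mult[OF 1(3) 2(3)])
      (use assms compact_X in \<open>auto intro!: compact_imp_bounded compact_continuous_image symb_continuous\<close>)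
  ultimately show ?thesis unfolding symb_def by blast
qed

lemma symb_cmul:
  assumes "symb T F"
  shows "symb (cmul c o\<^sub>L T) (\<lambda>w. c * F w)"
proof -
  obtain t q l where 2: "symb_seq t q l" "(\<lambda>n. t n + l n) \<longlonglongrightarrow> T" "uniform_limit X q F sequentially"
    using assms unfolding symb_def by blast
  have "symb_seq (\<lambda>n. cmul c o\<^sub>L t n) (\<lambda>n w. c * q n w) (\<lambda>n. cmul c o\<^sub>L l n)"
    using 2(1) unfolding symb_seq_def by (auto intro: pol_cmul comp_op_cmul)
  moreover have "(\<lambda>n. (cmul c o\<^sub>L t n) + (cmul c o\<^sub>L l n)) \<longlonglongrightarrow> (cmul c o\<^sub>L T)"
    using bounded_bilinear.tendsto[OF bounded_bilinear_blinfun_compose tendsto_const 2(2), of "cmul c"]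
    by (simp add: bounded_bilinear.add_right[OF bounded_bilinear_blinfun_compose])
  moreover have "uniform_limit X (\<lambda>n w. c * q n w) (\<lambda>w. c * F w) sequentially"
    by (rule bounded_linear.uniform_limit[OF bounded_linear_mult_right 2(3)])
  ultimately show ?thesis unfolding symb_def by blast
qed

lemma symb_diff:
  assumes "symb S F" "symb T G"
  shows "symb (S - T) (\<lambda>w. F w - G w)"
  using symb_add[OF assms(1) symb_cmul[OF assms(2), of "-1"]] by (simp add: cmul_minus_1)

lemma symb_adj:
  assumes "symb T F"
  shows "symb (adj T) (\<lambda>w. cnj (F w))"
proof -
  obtain t q l where 2: "symb_seq t q l" "(\<lambda>n. t n + l n) \<longlonglongrightarrow> T" "uniform_limit X q F sequentially"
    using assms unfolding symb_def by blast
  have "symb_seq (\<lambda>n. adj (t n)) (\<lambda>n w. cnj (q n w)) (\<lambda>n. adj (l n))"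
    using 2(1) pol_adj unfolding symb_seq_def by (auto intro: comp_op_adj)
  moreover have "(\<lambda>n. adj (t n) + adj (l n)) \<longlonglongrightarrow> adj T"
  proof -
    have "(\<lambda>n. norm (adj (t n) + adj (l n) - adj T)) \<longlonglongrightarrow> 0"
      using tendsto_norm_zero[OF LIM_zero[OF 2(2)]] by (simp flip: adj_add adj_diff)
    then show ?thesis by (rule LIM_zero_cancel[OF tendsto_norm_zero_cancel])
  qed
  moreover have "uniform_limit X (\<lambda>n w. cnj (q n w)) (\<lambda>w. cnj (F w)) sequentially"
    by (rule bounded_linear.uniform_limit[OF bounded_linear_cnj 2(3)])
  ultimately show ?thesis unfolding symb_def by blast
qed

lemma symb_lower:
  assumes "symb T F" "comp_op k" "w \<in> X"
  shows "cmod (F w) \<le> norm (T + k)"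
proof -
  obtain t q l where 2: "symb_seq t q l" "(\<lambda>n. t n + l n) \<longlonglongrightarrow> T" "uniform_limit X q F sequentially"
    using assms unfolding symb_def by blast
  have "(\<lambda>n. cmod (q n w)) \<longlonglongrightarrow> cmod (F w)"
    by (intro tendsto_norm tendsto_uniform_limitI[OF 2(3) assms(3)])
  moreover have "(\<lambda>n. norm ((t n + l n) + k)) \<longlonglongrightarrow> norm (T + k)" by (intro tendsto_intros 2(2))
  moreover have "cmod (q n w) \<le> norm ((t n + l n) + k)" for n
    using pol_lower[of "t n" "q n" "l n + k" w] 2(1) assms(2,3) comp_op_add
    by (simp add: symb_seq_def add.assoc)
  ultimately show ?thesis by (intro LIMSEQ_le) auto
qed

text \<open>With \<open>symb_lower\<close> this identifies the distance of \<open>T\<close> to the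
  compact operators with the supremum of its symbol on \<open>X\<close>.\<close>

lemma symb_upper:
  assumes "symb T F" "\<And>w. w \<in> X \<Longrightarrow> cmod (F w) \<le> M" "e > 0"
  shows "\<exists>k. comp_op k \<and> clin k \<and> norm (T + k) \<le> M + e"
proof -
  obtain t q l where 2: "symb_seq t q l" "(\<lambda>n. t n + l n) \<longlonglongrightarrow> T" "uniform_limit X q F sequentially"
    using assms unfolding symb_def by blast
  have "\<forall>\<^sub>F n in sequentially. \<forall>w\<in>X. dist (q n w) (F w) < e / 2"
    using 2(3) half_gt_zero[OF \<open>e > 0\<close>] unfolding uniform_limit_iff by blast
  moreover have "\<forall>\<^sub>F n in sequentially. dist (t n + l n) T < e / 2"
    using 2(2) half_gt_zero[OF \<open>e > 0\<close>] unfolding tendsto_iff by blast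
  ultimately have "\<forall>\<^sub>F n in sequentially. (\<forall>w\<in>X. dist (q n w) (F w) < e / 2) \<and> dist (t n + l n) T < e / 2"
    by (rule eventually_conj)
  then obtain n where "(\<forall>w\<in>X. dist (q n w) (F w) < e / 2) \<and> dist (t n + l n) T < e / 2"
    using eventually_happens'[OF sequentially_bot] by blast
  then have n: "\<And>w. w \<in> X \<Longrightarrow> dist (q n w) (F w) < e / 2" "dist (t n + l n) T < e / 2" by auto
  have "cmod (q n w) \<le> M + e / 2" if "w \<in> X" for w
    using n(1)[OF that] assms(2)[OF that] norm_triangle_sub[of "q n w" "F w"] by (simp add: dist_norm)
  then obtain m where m: "norm (t n - (t n o\<^sub>L trunc m)) \<le> M + e / 2"
    using pol_upper[of "t n" "q n" "M + e / 2"] 2(1) by (auto simp: symb_seq_def)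
  \<comment> \<open>Removes both the compact correction of the approximant and the part of its
    polynomial at small depth, which leaves the operator estimated by
    \<open>pol_upper\<close>.\<close>
  define k where "k = - (l n + (t n o\<^sub>L trunc m))"
  have "comp_op k"
    using 2(1) unfolding k_def symb_seq_def by (intro comp_op_minus comp_op_add comp_op_compose_left comp_op_trunc) auto
  moreover have "clin k"
  proof -
    have "clin (0 - (l n + (t n o\<^sub>L trunc m)))"
      using 2(1) unfolding symb_seq_def by (intro clin_diff clin_add clin_compose clin_0 clin_trunc) (auto dest: pol_clin)
    then show ?thesis by (simp add: k_def)
  qed
  moreover have "norm (T + k) \<le> M + e"
  proof -
    have "T + k = (T - (t n + l n)) + (t n - (t n o\<^sub>L trunc m))" by (simp add: k_def)
    then have "norm (T + k) \<le> norm (T - (t n + l n)) + norm (t n - (t n o\<^sub>L trunc m))"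
      by (metis norm_triangle_ineq)
    then show ?thesis using n(2) m by (simp add: dist_norm norm_minus_commute)
  qed
  ultimately show ?thesis by blast
qed

lemma symb_zero_imp_comp:
  assumes "symb T F" "\<And>w. w \<in> X \<Longrightarrow> F w = 0"
  shows "comp_op T"
proof (rule comp_op_closed)
  fix e :: real assume "e > 0"
  then obtain k where "comp_op k" "norm (T + k) \<le> 0 + e"
    using symb_upper[OF assms(1), of 0 e] assms(2) by auto
  then show "\<exists>S. comp_op S \<and> norm (T - S) \<le> e"
    using comp_op_minus[of k] by (intro exI[of _ "- k"]) simp
qed

lemma symb_unique:
  assumes "symb T F" "symb T G" "w \<in> X"
  shows "F w = G w"
  using symb_lower[OF symb_diff[OF assms(1,2)] comp_op_0 assms(3)] by simp

text \<open>Applied to differences, the lower norm bound makes the symbols uniformly Cauchy on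
  \<open>X\<close> as soon as the operators converge.\<close>

lemma symb_limit:
  assumes S: "symb_seq S p k" and T: "(\<lambda>n. S n + k n) \<longlonglongrightarrow> T"
  shows "\<exists>F. symb T F"
proof -
  have "uniformly_Cauchy_on X p"
    unfolding uniformly_Cauchy_on_def
  proof (intro allI impI)
    fix e :: real assume "e > 0"
    have "Cauchy (\<lambda>n. S n + k n)" using T by (rule LIMSEQ_imp_Cauchy)
    then obtain M where M: "\<And>m n. m \<ge> M \<Longrightarrow> n \<ge> M \<Longrightarrow> norm ((S m + k m) - (S n + k n)) < e"
      using \<open>e > 0\<close> unfolding Cauchy_iff by blast
    have "dist (p m w) (p n w) < e" if "w \<in> X" "m \<ge> M" "n \<ge> M" for w m n
    proof -
      have "cmod (p m w - p n w) \<le> norm ((S m - S n) + (k m - k n))"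
        using S \<open>w \<in> X\<close> unfolding symb_seq_def
        by (intro pol_lower[where F = "\<lambda>w. p m w - p n w"] pol_diff comp_op_diff) auto
      also have "(S m - S n) + (k m - k n) = (S m + k m) - (S n + k n)" by simp
      finally show ?thesis using M[OF that(2,3)] by (simp add: dist_norm)
    qed
    then show "\<exists>M. \<forall>x\<in>X. \<forall>m\<ge>M. \<forall>n\<ge>M. dist (p m x) (p n x) < e" by blast
  qed
  then obtain F where "uniform_limit X p F sequentially"
    using Cauchy_uniformly_convergent uniformly_convergent_on_def by blast
  then show ?thesis using S T unfolding symb_def by blast
qed

text \<open>Each \<open>f n\<close> is replaced by one of its own approximants at distance below
  \<open>1 / real (Suc n)\<close>, which reduces the claim to \<open>symb_limit\<close>.\<close>

lemma symb_closed:
  assumes f: "\<And>n. symb (f n) (F n)" and T: "f \<longlonglongrightarrow> T"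
  shows "\<exists>F. symb T F"
proof -
  have "\<exists>S p k. pol S p \<and> comp_op k \<and> clin k \<and> norm (S + k - f n) < 1 / real (Suc n)" for n
  proof -
    obtain S p k where S: "symb_seq S p k" "(\<lambda>n. S n + k n) \<longlonglongrightarrow> f n" using f[of n] unfolding symb_def by blast
    obtain m where "norm (S m + k m - f n) < 1 / real (Suc n)"
      using LIMSEQ_D[OF S(2), of "1 / real (Suc n)"] by auto
    then show ?thesis using S(1) unfolding symb_seq_def by blast
  qed
  then obtain S p k where S: "\<And>n. pol (S n) (p n)" "\<And>n. comp_op (k n)" "\<And>n. clin (k n)"
    "\<And>n. norm (S n + k n - f n) < 1 / real (Suc n)" by metis
  have "(\<lambda>n. S n + k n - f n) \<longlonglongrightarrow> 0"
    by (rule Lim_null_comparison[OF _ LIMSEQ_Suc[OF lim_1_over_n]]) (use S(4) in \<open>simp add: less_imp_le\<close>)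
  from tendsto_add[OF this T] have "(\<lambda>n. S n + k n) \<longlonglongrightarrow> T" by simp
  then show ?thesis using S(1-3) by (intro symb_limit[of S p k]) (auto simp: symb_seq_def)
qed

text \<open>The differences of successive polynomial approximations are cut off by \<^const>\<open>trunc\<close> so that
  their norms become summable.\<close>

lemma symb_surj:
  assumes F: "continuous_on X F"
  shows "\<exists>T. symb T F"
proof -
  have "\<exists>S p. pol S p \<and> (\<forall>w\<in>X. cmod (F w - p w) < (1/2) ^ n)" for n
    using pol_dense[OF F] unfolding pol_approx_def by simp
  then obtain S p where S: "\<And>n. pol (S n) (p n)" and p: "\<And>n w. w \<in> X \<Longrightarrow> cmod (F w - p n w) < (1/2) ^ n"
    by metis
  define D where "D n = S (Suc n) - S n" for n
  have "\<exists>m. norm (D n - (D n o\<^sub>L trunc m)) \<le> 2 * (1/2) ^ n" for n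
  proof (rule pol_upper)
    show "pol (D n) (\<lambda>w. p (Suc n) w - p n w)" unfolding D_def by (intro pol_diff S)
    fix w assume w: "w \<in> X"
    have "cmod (p (Suc n) w - p n w) \<le> cmod (F w - p n w) + cmod (F w - p (Suc n) w)"
      using norm_triangle_ineq4[of "F w - p n w" "F w - p (Suc n) w"] by simp
    also have "\<dots> \<le> (1/2) ^ n + (1/2) ^ Suc n"
      using p[OF w, of n] p[OF w, of "Suc n"] by linarith
    also have "\<dots> \<le> 2 * (1/2) ^ n" by simp
    finally show "cmod (p (Suc n) w - p n w) \<le> 2 * (1/2) ^ n" .
  qed
  then obtain m where m: "\<And>n. norm (D n - (D n o\<^sub>L trunc (m n))) \<le> 2 * (1/2) ^ n" by metis
  have "summable (\<lambda>n. D n - (D n o\<^sub>L trunc (m n)))"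
    by (rule summable_comparison_test'[of "\<lambda>n. 2 * (1/2) ^ n"]) (auto intro: m summable_mult summable_geometric)
  then have lim: "(\<lambda>n. \<Sum>i<n. D i - (D i o\<^sub>L trunc (m i))) \<longlonglongrightarrow> (\<Sum>n. D n - (D n o\<^sub>L trunc (m n)))" (is "_ \<longlonglongrightarrow> ?T")
    by (rule summable_LIMSEQ)
  \<comment> \<open>With the cut-off parts collected here, the partial sums of the convergent series
    telescope to \<open>S n + k n - S 0\<close>.\<close>
  define k where "k n = - (\<Sum>i<n. D i o\<^sub>L trunc (m i))" for n
  have "(\<Sum>i<n. D i) = S n - S 0" for n
    unfolding D_def by (rule sum_lessThan_telescope)
  then have "(\<Sum>i<n. D i - (D i o\<^sub>L trunc (m i))) + S 0 = S n + k n" for n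
    by (simp add: sum_subtractf k_def)
  then have T: "(\<lambda>n. S n + k n) \<longlonglongrightarrow> ?T + S 0" using tendsto_add[OF lim tendsto_const[of "S 0"]] by simp
  have D: "clin (D n)" for n using pol_clin[OF S] by (auto simp: D_def)
  have ck: "comp_op (- k n)" for n
    unfolding k_def by (induction n) (auto intro: comp_op_add comp_op_compose_left comp_op_trunc)
  have lk: "clin (0 - (- k n))" for n
    unfolding k_def minus_minus by (intro clin_diff clin_0 clin_sum clin_compose D clin_trunc)
  have "comp_op (k n)" "clin (k n)" for n
    using comp_op_minus[OF ck[of n]] lk[of n] by simp_all
  then have "symb_seq S p k" using S by (simp add: symb_seq_def)
  moreover have "uniform_limit X p F sequentially"
    unfolding uniform_limit_iff
  proof (intro allI impI)
    fix e :: real assume "e > 0"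
    then obtain N where N: "(1/2) ^ N < e" using real_arch_pow_inv[of e "1/2"] by auto
    have "\<forall>w\<in>X. dist (p n w) (F w) < e" if "n \<ge> N" for n
    proof
      fix w assume "w \<in> X"
      have "dist (p n w) (F w) < (1/2) ^ n" using p[OF \<open>w \<in> X\<close>] by (simp add: dist_norm norm_minus_commute)
      also have "\<dots> \<le> (1/2) ^ N" using that by (intro power_decreasing) auto
      finally show "dist (p n w) (F w) < e" using N by linarith
    qed
    then show "\<forall>\<^sub>F n in sequentially. \<forall>w\<in>X. dist (p n w) (F w) < e"
      by (auto simp: eventually_sequentially)
  qed
  ultimately show ?thesis using T unfolding symb_def by blast
qed

definition Alg :: "hop set" where
  "Alg = {T. \<exists>F. symb T F}"

lemma csub_Alg: "csub Alg"
  unfolding csub_def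
proof (intro conjI ballI allI impI)
  show "T \<in> Alg \<Longrightarrow> clin T" for T by (auto simp: Alg_def symb_clin)
  show "0 \<in> Alg" unfolding Alg_def using symb_comp[OF comp_op_0 clin_0] by blast
  show "S \<in> Alg \<Longrightarrow> T \<in> Alg \<Longrightarrow> S + T \<in> Alg" for S T unfolding Alg_def by (blast intro: symb_add)
  show "T \<in> Alg \<Longrightarrow> cmul k o\<^sub>L T \<in> Alg" for k T unfolding Alg_def by (blast intro: symb_cmul)
  show "S \<in> Alg \<Longrightarrow> T \<in> Alg \<Longrightarrow> S o\<^sub>L T \<in> Alg" for S T unfolding Alg_def by (blast intro: symb_mult)
  show "T \<in> Alg \<Longrightarrow> adj T \<in> Alg" for T unfolding Alg_def by (blast intro: symb_adj)
  fix f :: "nat \<Rightarrow> hop" and T assume f: "(\<forall>n. f n \<in> Alg) \<and> f \<longlonglongrightarrow> T"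
  then have "\<forall>n. \<exists>F. symb (f n) F" by (simp add: Alg_def)
  then obtain F where "\<And>n. symb (f n) (F n)" by metis
  then show "T \<in> Alg" unfolding Alg_def using symb_closed f by blast
qed

lemma Z_in_Alg: "Z \<in> Alg"
  unfolding Alg_def using symb_pol[OF pol_Z] by blast

text \<open>The polynomial part is generated by \<open>Z\<close>, the compact part is in
  \<open>A\<close> by \<open>compact_in_csub\<close>, and \<open>A\<close> is closed under
  limits.\<close>

lemma Alg_least:
  assumes A: "csub A" "Z \<in> A"
  shows "Alg \<subseteq> A"
proof
  fix T assume "T \<in> Alg"
  then obtain S p k where S: "symb_seq S p k" "(\<lambda>n. S n + k n) \<longlonglongrightarrow> T"
    unfolding Alg_def symb_def by blast
  have pol: "S \<in> A" if "pol S F" for S F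
    using that
  proof (induction rule: pol.induct)
    case (pol_add S F T G)
    then show ?case using A unfolding csub_def by blast
  next
    case (pol_mult S F T G)
    then show ?case using A unfolding csub_def by blast
  qed (use A in \<open>auto simp: csub_def\<close>)
  have "S n + k n \<in> A" for n
  proof -
    have "S n \<in> A" "k n \<in> A" using S(1) pol compact_in_csub[OF A] by (auto simp: symb_seq_def)
    then show ?thesis using A(1) unfolding csub_def by blast
  qed
  then show "T \<in> A" by (rule csub_closed[OF A(1) _ S(2)])
qed

end

section \<open>The Hilbert space of the pair of pants\<close>

definition pser :: "(nat \<Rightarrow> complex) \<Rightarrow> complex \<Rightarrow> complex" where
  "pser c w = (\<Sum>n. c n * w ^ n)"

context
  fixes c :: "nat \<Rightarrow> complex" and B :: real
  assumes B: "\<And>n. cmod (c n) \<le> B"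
begin

lemma pser_norm_summable:
  assumes "cmod w < 1"
  shows "summable (\<lambda>n. norm (c n * w ^ n))"
proof (rule summable_comparison_test')
  show "summable (\<lambda>n. B * cmod w ^ n)" using assms by (intro summable_mult summable_geometric) simp
  show "norm (norm (c n * w ^ n)) \<le> B * cmod w ^ n" for n
    using B[of n] by (simp add: norm_mult norm_power mult_right_mono)
qed

lemma pser_sums:
  assumes "cmod w < 1"
  shows "(\<lambda>n. c n * w ^ n) sums pser c w"
  unfolding pser_def by (rule summable_sums[OF summable_norm_cancel[OF pser_norm_summable[OF assms]]])

lemma pser_has_sum:
  assumes "cmod w < 1"
  shows "((\<lambda>n. c n * w ^ n) has_sum pser c w) UNIV"
  by (rule norm_summable_imp_has_sum[OF pser_norm_summable pser_sums]) (use assms in auto)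

lemma pser_Suc_has_sum:
  assumes "cmod w < 1"
  shows "((\<lambda>n. c n * w ^ Suc n) has_sum (w * pser c w)) UNIV"
  using has_sum_cmult_right[OF pser_has_sum[OF assms], of w] by (simp add: mult_ac)

lemma pser_holomorphic: "pser c holomorphic_on ball 0 1"
  by (rule power_series_holomorphic[of _ _ c]) (use pser_sums in auto)

text \<open>The shape of the hypothesis comes from principal parts, which equal
  \<open>w * pser c w\<close> at \<open>w = r / (\<zeta> - c)\<close>; this argument never takes the
  value 0. Zeros of a nonzero power series are isolated.\<close>

lemma pser_eq_0:
  assumes z: "\<And>w. w \<noteq> 0 \<Longrightarrow> cmod w < 1 \<Longrightarrow> w * pser c w = 0"
  shows "c n = 0"
proof (rule ccontr)
  assume cn: "c n \<noteq> 0"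
  \<comment> \<open>The coefficients of \<open>w * pser c w\<close>.\<close>
  define b where "b k = (case k of 0 \<Rightarrow> 0 | Suc k \<Rightarrow> c k)" for k
  have "(\<lambda>k. b k * (w - 0) ^ k) sums (w * pser c w)" if "cmod (w - 0) < 1" for w
  proof -
    have "(\<lambda>n. b (Suc n) * w ^ Suc n) sums (w * pser c w)"
      using sums_mult[OF pser_sums, of w w] that by (simp add: b_def mult_ac)
    then show ?thesis by (subst (asm) sums_Suc_iff) (simp add: b_def)
  qed
  then obtain s where s: "0 < s" "\<And>w. w \<in> cball 0 s - {0} \<Longrightarrow> w * pser c w \<noteq> 0"
    using powser_0_nonzero[of 1 0 b "\<lambda>w. w * pser c w" "Suc n"] cn by (auto simp: b_def)
  define w where "w = complex_of_real (min s (1/2))"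
  have "w \<noteq> 0" "cmod w < 1" "cmod w \<le> s" using s(1) by (auto simp: w_def)
  then show False using s(2)[of w] z[of w] by simp
qed

end

text \<open>Glue \<open>f\<close> outside the disc with \<open>- g\<close> inside and apply Liouville's theorem.\<close>

lemma laurent_principal_part_eq_0:
  fixes f g :: "complex \<Rightarrow> complex"
  assumes f: "f holomorphic_on {\<zeta>. cmod (\<zeta> - c) > \<rho>}" and g: "g holomorphic_on ball c R"
    and "\<rho> < R" and fg: "\<And>\<zeta>. \<rho> < cmod (\<zeta> - c) \<Longrightarrow> cmod (\<zeta> - c) < R \<Longrightarrow> f \<zeta> + g \<zeta> = 0"
    and inf: "(f \<longlongrightarrow> 0) at_infinity" and "\<rho> < cmod (\<zeta> - c)"
  shows "f \<zeta> = 0"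
proof -
  define U where "U = {\<zeta>. cmod (\<zeta> - c) > \<rho>}"
  define h where "h = (\<lambda>\<zeta>. if \<zeta> \<in> U then f \<zeta> else - g \<zeta>)"
  have "open U" unfolding U_def by (intro open_Collect_less continuous_intros)
  have eq: "f z = - g z" if "z \<in> U" "z \<in> ball c R" for z
    using fg[of z] that by (simp add: U_def dist_norm norm_minus_commute eq_neg_iff_add_eq_0)
  have "h holomorphic_on (U \<union> ball c R)"
    unfolding h_def by (rule holomorphic_on_If_Un)
      (use f g \<open>open U\<close> eq in \<open>auto simp: U_def[symmetric] intro!: holomorphic_intros\<close>)
  moreover have "U \<union> ball c R = UNIV" using \<open>\<rho> < R\<close> by (auto simp: U_def dist_norm norm_minus_commute)
  ultimately have "h holomorphic_on UNIV" by simp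
  moreover have "(h \<longlongrightarrow> 0) at_infinity"
  proof (rule Lim_transform_eventually[OF inf])
    have "f z = h z" if "cmod z \<ge> \<bar>\<rho>\<bar> + 1 + cmod c" for z
      using that norm_triangle_ineq2[of z c] by (auto simp: h_def U_def)
    then show "\<forall>\<^sub>F z in at_infinity. f z = h z"
      unfolding eventually_at_infinity by blast
  qed
  ultimately have "h \<zeta> = 0" by (rule Liouville_weak_0)
  then show ?thesis using assms(6) by (simp add: h_def U_def)
qed

lemma tendsto_inverse_at_infinity: "((\<lambda>\<zeta>. of_real r / (\<zeta> - c) :: complex) \<longlongrightarrow> 0) at_infinity"
proof (rule tendstoI)
  fix e :: real assume "e > 0"
  have "dist (of_real r / (z - c)) 0 < e" if "cmod z \<ge> cmod c + (\<bar>r\<bar> + 1) / e" for z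
  proof -
    have "cmod (z - c) \<ge> (\<bar>r\<bar> + 1) / e" using that norm_triangle_ineq2[of z c] by linarith
    then have "\<bar>r\<bar> + 1 \<le> cmod (z - c) * e" using \<open>e > 0\<close> by (simp only: pos_divide_le_eq)
    moreover have "cmod (z - c) > 0"
    proof -
      have "0 < (\<bar>r\<bar> + 1) / e" using \<open>e > 0\<close> by (simp add: add_nonneg_pos)
      also have "\<dots> \<le> cmod (z - c)" by fact
      finally show ?thesis .
    qed
    ultimately have "\<bar>r\<bar> / cmod (z - c) < e" by (subst pos_divide_less_eq) (auto simp: mult.commute)
    then show ?thesis by (simp add: norm_divide)
  qed
  then show "\<forall>\<^sub>F z in at_infinity. dist (of_real r / (z - c)) 0 < e"
    unfolding eventually_at_infinity by blast
qed

context pair_of_pants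
begin

definition I :: "complex set" where
  "I = interior (pants a r1 r2)"

lemma I_eq: "I = {\<zeta>. cmod \<zeta> < 1 \<and> cmod \<zeta> > r1 \<and> cmod (\<zeta> - of_real a) > r2}"
proof -
  have "pants a r1 r2 = cball 0 1 \<inter> (- ball 0 r1) \<inter> (- ball (of_real a) r2)"
    by (auto simp: pants_def dist_norm norm_minus_commute not_less)
  then have I: "I = ball 0 1 \<inter> (- cball 0 r1) \<inter> (- cball (of_real a) r2)"
    using r1_pos r2_pos by (simp add: I_def interior_complement)
  have "dist (of_real a) \<zeta> = cmod (\<zeta> - of_real a)" for \<zeta> :: complex
    by (metis dist_commute dist_norm)
  then show ?thesis unfolding I by (simp only: set_eq_iff Int_iff Compl_iff mem_ball mem_cball
      dist_0_norm not_le mem_Collect_eq conj_assoc simp_thms)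
qed

lemma open_I: "open I"
  by (simp add: I_def)

lemma I_ne: "I \<noteq> {}"
proof -
  \<comment> \<open>The midpoint of the gap between the two holes on the real axis.\<close>
  define t where "t = (r1 + (a - r2)) / 2"
  have t: "r1 < t" "t < a - r2" using disjoint by (auto simp: t_def)
  have "cmod (complex_of_real t - of_real a) = a - t"
    using t r2_pos by (simp only: of_real_diff[symmetric] norm_of_real)
  then have "complex_of_real t \<in> I"
    using t r1_pos r2_pos a_less by (simp add: I_eq)
  then show ?thesis by blast
qed

abbreviation basis :: "pants_idx \<Rightarrow> complex \<Rightarrow> complex" where
  "basis \<equiv> pants_basis a r1 r2"

text \<open>Negative powers become positive powers of the reciprocal, so that all three branches are
  ordinary power series.\<close>

lemma basis_simps:
  "basis (idxE n) \<zeta> = \<zeta> ^ n"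
  "basis (idxF n) \<zeta> = (of_real r1 / \<zeta>) ^ Suc n"
  "basis (idxG n) \<zeta> = (of_real r2 / (\<zeta> - of_real a)) ^ Suc n"
proof -
  have *: "x powi (- (int n + 1)) = (inverse x) ^ Suc n" for x :: complex
    by (metis add.commute of_nat_Suc power_int_minus power_int_of_nat power_inverse)
  show "basis (idxF n) \<zeta> = (of_real r1 / \<zeta>) ^ Suc n"
    "basis (idxG n) \<zeta> = (of_real r2 / (\<zeta> - of_real a)) ^ Suc n"
    by (simp_all only: pants_basis.simps * inverse_divide)
qed simp

lemma I_small:
  assumes "\<zeta> \<in> I"
  shows "cmod \<zeta> < 1" "cmod (of_real r1 / \<zeta>) < 1" "cmod (of_real r2 / (\<zeta> - of_real a)) < 1" "\<zeta> \<noteq> 0" "\<zeta> \<noteq> of_real a"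
  using assms r1_pos r2_pos by (auto simp: I_eq norm_divide divide_less_eq)

lemma basis_square_summable:
  assumes "\<zeta> \<in> I"
  shows "(\<lambda>i. (cmod (basis i \<zeta>))\<^sup>2) summable_on UNIV"
proof -
  have geo: "(\<lambda>n. (cmod (w ^ n))\<^sup>2) summable_on UNIV" if "cmod w < 1" for w
  proof -
    have "(\<lambda>n. ((cmod w)\<^sup>2) ^ n) summable_on UNIV"
      using that by (subst summable_on_UNIV_nonneg_real_iff) (auto intro!: summable_geometric simp: power_less_one_iff)
    then show ?thesis by (simp add: norm_power power_mult[symmetric] mult.commute)
  qed
  have geo': "(\<lambda>n. (cmod (w ^ Suc n))\<^sup>2) summable_on UNIV" if "cmod w < 1" for w
    using square_summable_cmult[OF geo[OF that], of w] by simp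
  show ?thesis
    using has_sum_pants_idx[of "\<lambda>i. (cmod (basis i \<zeta>))\<^sup>2", unfolded basis_simps,
        OF has_sum_infsum[OF geo] has_sum_infsum[OF geo'] has_sum_infsum[OF geo']] I_small[OF assms]
    unfolding summable_on_def by blast
qed

text \<open>The reproducing kernel at \<open>\<zeta>\<close>. It is an eigenvector of the adjoint, so multiplication by \<open>\<zeta>\<close> is
  identified without rearranging series.\<close>

definition kern :: "complex \<Rightarrow> hvec" where
  "kern \<zeta> = Ell2 (\<lambda>i. cnj (basis i \<zeta>))"

lemma coord_kern: "\<zeta> \<in> I \<Longrightarrow> coord (kern \<zeta>) i = cnj (basis i \<zeta>)"
  by (simp add: kern_def Ell2_inverse basis_square_summable)

text \<open>Pairing with the kernel is evaluation at the point; the value outside \<open>I\<close>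
  follows the convention of \<open>pants_H\<close>.\<close>

definition expand :: "hvec \<Rightarrow> complex \<Rightarrow> complex" where
  "expand x \<zeta> = (if \<zeta> \<in> I then cip x (kern \<zeta>) else 0)"

lemma expand_has_sum:
  assumes "\<zeta> \<in> I"
  shows "((\<lambda>i. coord x i * basis i \<zeta>) has_sum expand x \<zeta>) UNIV"
proof -
  have "((\<lambda>i. coord x i * cnj (coord (kern \<zeta>) i)) has_sum cip x (kern \<zeta>)) UNIV"
    unfolding cip_def by (rule has_sum_infsum) (rule cip_summable)
  then show ?thesis using assms by (simp add: coord_kern expand_def)
qed

lemma cip_add_left: "cip (x + y) z = cip x z + cip y z"
  by (simp add: cip_eq_inner inner_add_left complex_eq_iff)

lemma expand_add: "expand (x + y) = (\<lambda>\<zeta>. expand x \<zeta> + expand y \<zeta>)"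
  by (auto simp: expand_def cip_add_left fun_eq_iff)

lemma expand_scaleC: "expand (scaleC k x) = (\<lambda>\<zeta>. k * expand x \<zeta>)"
  by (auto simp: expand_def cip_scaleC_left fun_eq_iff)

lemma expand_diff: "expand (x - y) = (\<lambda>\<zeta>. expand x \<zeta> - expand y \<zeta>)"
  using expand_add[of "x - y" y] by (auto simp: fun_eq_iff)

lemma expand_Z: "expand (Z x) = (\<lambda>\<zeta>. \<zeta> * expand x \<zeta>)"
proof (rule ext)
  fix \<zeta>
  have "adj Z (kern \<zeta>) = scaleC (cnj \<zeta>) (kern \<zeta>)" if \<zeta>: "\<zeta> \<in> I"
  proof (rule ell2_eqI)
    have F: "cnj \<zeta> * cnj (of_real r1 / \<zeta>) = of_real r1"
      using I_small[OF \<zeta>] by (simp flip: complex_cnj_mult)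
    have G: "cnj \<zeta> * cnj (of_real r2 / (\<zeta> - of_real a)) = of_real r2 + of_real a * cnj (of_real r2 / (\<zeta> - of_real a))"
    proof -
      \<comment> \<open>Writing \<open>\<zeta>\<close> as \<open>(\<zeta> - a) + a\<close> yields
        the weighted shift and the diagonal term of the third branch.\<close>
      have "\<zeta> * (of_real r2 / (\<zeta> - of_real a)) = of_real r2 + of_real a * (of_real r2 / (\<zeta> - of_real a))"
        using I_small[OF \<zeta>] by (simp add: field_simps)
      then have "cnj (\<zeta> * (of_real r2 / (\<zeta> - of_real a))) = cnj (of_real r2 + of_real a * (of_real r2 / (\<zeta> - of_real a)))"
        by (rule arg_cong)
      then show ?thesis by (simp only: complex_cnj_mult complex_cnj_add complex_cnj_complex_of_real)
    qed
    fix i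
    show "coord (adj Z (kern \<zeta>)) i = coord (scaleC (cnj \<zeta>) (kern \<zeta>)) i"
    proof (cases i)
      case (idxE n)
      then show ?thesis using \<zeta> by (simp add: coord_adj_Z coord_kern)
    next
      case (idxF n)
      define q where "q = cnj (of_real r1 / \<zeta>)"
      have k: "coord (kern \<zeta>) (idxF n) = q ^ Suc n" "coord (kern \<zeta>) (idxE 0) = 1" for n
        unfolding coord_kern[OF \<zeta>] basis_simps q_def by (simp_all only: complex_cnj_power power_0 complex_cnj_one)
      have F: "cnj \<zeta> * q = of_real r1" unfolding q_def by (rule F)
      have F': "cnj \<zeta> * (q * y) = of_real r1 * y" for y using F by (simp add: mult.assoc[symmetric])
      show ?thesis using F F' unfolding idxF by (cases n) (simp_all add: coord_adj_Z k)
    next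
      case (idxG n)
      define q where "q = cnj (of_real r2 / (\<zeta> - of_real a))"
      have k: "coord (kern \<zeta>) (idxG n) = q ^ Suc n" "coord (kern \<zeta>) (idxE 0) = 1" for n
        unfolding coord_kern[OF \<zeta>] basis_simps q_def by (simp_all only: complex_cnj_power power_0 complex_cnj_one)
      have G: "cnj \<zeta> * q = of_real r2 + of_real a * q" unfolding q_def by (rule G)
      have G': "cnj \<zeta> * (q * y) = of_real r2 * y + of_real a * (q * y)" for y
        using arg_cong[OF G, of "\<lambda>t. t * y"] by (simp add: algebra_simps)
      show ?thesis using G G' unfolding idxG by (cases n) (simp_all add: coord_adj_Z k)
    qed
  qed
  then show "expand (Z x) \<zeta> = \<zeta> * expand x \<zeta>"
    by (simp add: expand_def cip_adj[OF clin_Z] cip_scaleC_right)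
qed

section \<open>Laurent parts and uniqueness of the expansion\<close>

definition partE :: "hvec \<Rightarrow> complex \<Rightarrow> complex" where
  "partE x \<zeta> = pser (\<lambda>n. coord x (idxE n)) \<zeta>"

text \<open>The \<open>\<zeta> - 0\<close> gives both principal parts the common shape that the
  lemmas below treat for an arbitrary centre.\<close>

definition partF :: "hvec \<Rightarrow> complex \<Rightarrow> complex" where
  "partF x \<zeta> = of_real r1 / (\<zeta> - 0) * pser (\<lambda>n. coord x (idxF n)) (of_real r1 / (\<zeta> - 0))"

definition partG :: "hvec \<Rightarrow> complex \<Rightarrow> complex" where
  "partG x \<zeta> = of_real r2 / (\<zeta> - of_real a) * pser (\<lambda>n. coord x (idxG n)) (of_real r2 / (\<zeta> - of_real a))"

lemma expand_eq_parts:
  assumes "\<zeta> \<in> I"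
  shows "expand x \<zeta> = partE x \<zeta> + partF x \<zeta> + partG x \<zeta>"
proof (rule has_sum_unique[OF expand_has_sum[OF assms]], rule has_sum_pants_idx)
  show "((\<lambda>n. coord x (idxE n) * basis (idxE n) \<zeta>) has_sum partE x \<zeta>) UNIV"
    unfolding basis_simps partE_def by (rule pser_has_sum[OF coord_le_norm]) (use I_small[OF assms] in auto)
  show "((\<lambda>n. coord x (idxF n) * basis (idxF n) \<zeta>) has_sum partF x \<zeta>) UNIV"
    unfolding basis_simps partF_def diff_0_right
    by (rule pser_Suc_has_sum[OF coord_le_norm]) (use I_small[OF assms] in auto)
  show "((\<lambda>n. coord x (idxG n) * basis (idxG n) \<zeta>) has_sum partG x \<zeta>) UNIV"
    unfolding basis_simps partG_def
    by (rule pser_Suc_has_sum[OF coord_le_norm]) (use I_small[OF assms] in auto)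
qed

lemma principal_part_holomorphic:
  fixes c :: complex and r :: real
  assumes "\<And>n. cmod (d n) \<le> B" "r > 0"
  shows "(\<lambda>\<zeta>. of_real r / (\<zeta> - c) * pser d (of_real r / (\<zeta> - c))) holomorphic_on {\<zeta>. cmod (\<zeta> - c) > r}"
proof -
  have h: "(\<lambda>\<zeta>. of_real r / (\<zeta> - c)) holomorphic_on {\<zeta>. cmod (\<zeta> - c) > r}"
    using \<open>r > 0\<close> by (intro holomorphic_intros) auto
  have "(pser d \<circ> (\<lambda>\<zeta>. of_real r / (\<zeta> - c))) holomorphic_on {\<zeta>. cmod (\<zeta> - c) > r}"
    by (rule holomorphic_on_compose_gen[OF h pser_holomorphic[OF assms(1)]])
      (use \<open>r > 0\<close> in \<open>auto simp: norm_divide divide_less_eq\<close>)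
  then show ?thesis by (intro holomorphic_on_mult h) (simp add: o_def)
qed

lemma principal_part_tendsto:
  fixes c :: complex and r :: real
  assumes "\<And>n. cmod (d n) \<le> B"
  shows "((\<lambda>\<zeta>. of_real r / (\<zeta> - c) * pser d (of_real r / (\<zeta> - c))) \<longlongrightarrow> 0) at_infinity"
proof -
  have "isCont (pser d) 0"
    using holomorphic_on_imp_continuous_on[OF pser_holomorphic[OF assms]]
    by (rule continuous_on_interior) auto
  then have "((\<lambda>\<zeta>. pser d (of_real r / (\<zeta> - c))) \<longlongrightarrow> pser d 0) at_infinity"
    by (rule isCont_tendsto_compose[OF _ tendsto_inverse_at_infinity])
  from tendsto_mult[OF tendsto_inverse_at_infinity[of r c] this] show ?thesis by simp
qed

lemma partE_holomorphic: "partE x holomorphic_on ball 0 1"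
  unfolding partE_def[abs_def] by (rule pser_holomorphic[OF coord_le_norm])

lemma partF_holomorphic: "partF x holomorphic_on {\<zeta>. cmod (\<zeta> - 0) > r1}"
  unfolding partF_def[abs_def] by (rule principal_part_holomorphic[OF coord_le_norm r1_pos])

lemma partG_holomorphic: "partG x holomorphic_on {\<zeta>. cmod (\<zeta> - of_real a) > r2}"
  unfolding partG_def[abs_def] by (rule principal_part_holomorphic[OF coord_le_norm r2_pos])

lemma expand_holomorphic: "expand x holomorphic_on I"
proof -
  have "(\<lambda>\<zeta>. partE x \<zeta> + partF x \<zeta> + partG x \<zeta>) holomorphic_on I"
    by (intro holomorphic_on_add holomorphic_on_subset[OF partE_holomorphic]
        holomorphic_on_subset[OF partF_holomorphic] holomorphic_on_subset[OF partG_holomorphic])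
      (auto simp: I_eq)
  then show ?thesis by (rule holomorphic_transform) (simp add: expand_eq_parts)
qed

text \<open>The substitution \<open>w = r / (\<zeta> - c)\<close> maps the exterior of the disc onto
  the punctured unit disc.\<close>

lemma principal_part_coeff_0:
  assumes "\<And>n. cmod (d n) \<le> B" "r > 0"
    and z: "\<And>\<zeta>. r < cmod (\<zeta> - c) \<Longrightarrow> of_real r / (\<zeta> - c) * pser d (of_real r / (\<zeta> - c)) = 0"
  shows "d n = 0"
proof (rule pser_eq_0[OF assms(1)])
  fix w :: complex assume w: "w \<noteq> 0" "cmod w < 1"
  have "r < cmod (of_real r / w)" using w \<open>r > 0\<close> by (simp add: norm_divide field_simps)
  then show "w * pser d w = 0" using z[of "of_real r / w + c"] w \<open>r > 0\<close> by simp
qed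

text \<open>Around each hole an annulus fits into \<open>I\<close>, with outer radius
  \<open>a - r2\<close> at 0 and \<open>min (a - r1) (1 - a)\<close> at \<open>a\<close>. In the
  full disc of that radius the other two parts are holomorphic, so the principal part
  vanishes.\<close>

lemma expand_eq_0:
  assumes x: "\<And>\<zeta>. \<zeta> \<in> I \<Longrightarrow> expand x \<zeta> = 0"
  shows "x = 0"
proof -
  have sum0: "partE x \<zeta> + partF x \<zeta> + partG x \<zeta> = 0" if "\<zeta> \<in> I" for \<zeta>
    using x[OF that] expand_eq_parts[OF that, of x] by simp
  have tri: "a \<le> cmod (\<zeta> - of_real a) + cmod \<zeta>" for \<zeta>
    using norm_triangle_ineq4[of \<zeta> "\<zeta> - of_real a"] a_pos by (simp add: add.commute)
  have tri': "cmod \<zeta> \<le> cmod (\<zeta> - of_real a) + a" for \<zeta>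
    using norm_triangle_ineq[of "\<zeta> - of_real a" "of_real a"] a_pos by simp
  have F: "partF x \<zeta> = 0" if "r1 < cmod (\<zeta> - 0)" for \<zeta>
  proof (rule laurent_principal_part_eq_0[where f = "partF x" and c = 0 and \<rho> = r1 and g = "\<lambda>\<zeta>. partE x \<zeta> + partG x \<zeta>" and R = "a - r2"])
    show "partF x holomorphic_on {\<zeta>. r1 < cmod (\<zeta> - 0)}" by (rule partF_holomorphic)
    show "(\<lambda>\<zeta>. partE x \<zeta> + partG x \<zeta>) holomorphic_on ball 0 (a - r2)"
    proof (intro holomorphic_on_add holomorphic_on_subset[OF partE_holomorphic] holomorphic_on_subset[OF partG_holomorphic])
      show "ball 0 (a - r2) \<subseteq> ball (0::complex) 1" using a_less r2_pos by (intro subset_ball) simp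
      show "ball 0 (a - r2) \<subseteq> {\<zeta>. r2 < cmod (\<zeta> - of_real a)}"
      proof
        fix z :: complex assume "z \<in> ball 0 (a - r2)"
        then show "z \<in> {\<zeta>. r2 < cmod (\<zeta> - of_real a)}" using tri[of z] by simp
      qed
    qed
    show "r1 < a - r2" using disjoint by simp
    show "partF x z + (partE x z + partG x z) = 0" if "r1 < cmod (z - 0)" "cmod (z - 0) < a - r2" for z
    proof -
      have "z \<in> I" using that tri[of z] a_less r2_pos by (simp add: I_eq)
      from sum0[OF this] show ?thesis by (simp add: algebra_simps)
    qed
    show "(partF x \<longlongrightarrow> 0) at_infinity"
      unfolding partF_def[abs_def] by (rule principal_part_tendsto[OF coord_le_norm])
  qed (rule that)
  have G: "partG x \<zeta> = 0" if "r2 < cmod (\<zeta> - of_real a)" for \<zeta>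
  proof (rule laurent_principal_part_eq_0[where f = "partG x" and c = "of_real a" and \<rho> = r2 and g = "\<lambda>\<zeta>. partE x \<zeta> + partF x \<zeta>" and R = "min (a - r1) (1 - a)"])
    show "partG x holomorphic_on {\<zeta>. r2 < cmod (\<zeta> - of_real a)}" by (rule partG_holomorphic)
    show "(\<lambda>\<zeta>. partE x \<zeta> + partF x \<zeta>) holomorphic_on ball (of_real a) (min (a - r1) (1 - a))"
    proof (intro holomorphic_on_add holomorphic_on_subset[OF partE_holomorphic] holomorphic_on_subset[OF partF_holomorphic])
      show "ball (complex_of_real a) (min (a - r1) (1 - a)) \<subseteq> ball 0 1"
      proof
        fix z assume "z \<in> ball (complex_of_real a) (min (a - r1) (1 - a))"
        then show "z \<in> ball 0 1" using tri'[of z] by (simp add: dist_norm norm_minus_commute)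
      qed
      show "ball (complex_of_real a) (min (a - r1) (1 - a)) \<subseteq> {\<zeta>. r1 < cmod (\<zeta> - 0)}"
      proof
        fix z assume "z \<in> ball (complex_of_real a) (min (a - r1) (1 - a))"
        then show "z \<in> {\<zeta>. r1 < cmod (\<zeta> - 0)}" using tri[of z] by (simp add: dist_norm norm_minus_commute)
      qed
    qed
    show "r2 < min (a - r1) (1 - a)" using disjoint outer by simp
    show "partG x z + (partE x z + partF x z) = 0"
      if "r2 < cmod (z - of_real a)" "cmod (z - of_real a) < min (a - r1) (1 - a)" for z
    proof -
      have "z \<in> I" using that tri[of z] tri'[of z] by (simp add: I_eq)
      from sum0[OF this] show ?thesis by (simp add: algebra_simps)
    qed
    show "(partG x \<longlongrightarrow> 0) at_infinity"
      unfolding partG_def[abs_def] by (rule principal_part_tendsto[OF coord_le_norm])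
  qed (rule that)
  \<comment> \<open>With both principal parts gone, \<open>partE x\<close> vanishes on the open set
    \<open>I\<close>, and the identity theorem extends this to the disc.\<close>
  have E: "partE x \<zeta> = 0" if "cmod \<zeta> < 1" for \<zeta>
  proof (rule analytic_continuation_open[where f = "partE x" and s = I and s' = "ball 0 1" and g = "\<lambda>_. 0"])
    show "partE x z = 0" if "z \<in> I" for z using sum0[OF that] F[of z] G[of z] that by (simp add: I_eq)
  qed (use that open_I I_ne partE_holomorphic in \<open>auto simp: I_eq\<close>)
  have "coord x i = 0" for i
  proof (cases i)
    case (idxE n)
    have "w * pser (\<lambda>n. coord x (idxE n)) w = 0" if "cmod w < 1" for w
      using E[OF that] by (simp add: partE_def)
    then show ?thesis using pser_eq_0[OF coord_le_norm, of x idxE n] idxE by blast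
  next
    case (idxF n)
    show ?thesis unfolding idxF
      by (rule principal_part_coeff_0[OF coord_le_norm r1_pos F[unfolded partF_def]])
  next
    case (idxG n)
    show ?thesis unfolding idxG
      by (rule principal_part_coeff_0[OF coord_le_norm r2_pos G[unfolded partG_def]])
  qed
  then show ?thesis by (intro ell2_eqI) simp
qed

section \<open>Transport of vectors and operators between coefficients and functions\<close>

abbreviation H :: "(complex \<Rightarrow> complex) set" where "H \<equiv> pants_H a r1 r2"
abbreviation pnorm :: "(complex \<Rightarrow> complex) \<Rightarrow> real" where "pnorm \<equiv> pants_norm a r1 r2"

lemma expand_inject:
  assumes "\<And>\<zeta>. \<zeta> \<in> I \<Longrightarrow> expand x \<zeta> = expand y \<zeta>"
  shows "x = y"
proof -
  have "x - y = 0" by (rule expand_eq_0) (simp add: expand_diff assms)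
  then show ?thesis by simp
qed

lemma pants_expansion_imp_expand:
  assumes "pants_expansion a r1 r2 c \<phi>"
  shows "\<exists>x. c = coord x \<and> (\<forall>\<zeta>\<in>I. \<phi> \<zeta> = expand x \<zeta>)"
proof -
  have "(\<lambda>i. (cmod (c i))\<^sup>2) summable_on UNIV" using assms by (simp add: pants_expansion_def)
  then obtain x where x: "c = coord x" by (metis Ell2_inverse mem_Collect_eq)
  have "\<phi> \<zeta> = expand x \<zeta>" if "\<zeta> \<in> I" for \<zeta>
    using assms that expand_has_sum[OF that, of x] unfolding pants_expansion_def I_def[symmetric] x
    by (blast intro: has_sum_unique)
  with x show ?thesis by blast
qed

lemma pants_expansion_expand: "pants_expansion a r1 r2 (coord x) (expand x)"
  unfolding pants_expansion_def I_def[symmetric] by (auto intro: coord_summable expand_has_sum)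

lemma coeff_expand [simp]: "pants_coeff a r1 r2 (expand x) = coord x"
  unfolding pants_coeff_def
proof (rule the_equality)
  fix c assume "pants_expansion a r1 r2 c (expand x)"
  then show "c = coord x" using pants_expansion_imp_expand expand_inject by metis
qed (rule pants_expansion_expand)

lemma H_eq: "H = range expand"
proof (intro equalityI subsetI)
  fix \<phi> assume "\<phi> \<in> H"
  then obtain c where c: "pants_expansion a r1 r2 c \<phi>" and 0: "\<forall>\<zeta>. \<zeta> \<notin> I \<longrightarrow> \<phi> \<zeta> = 0"
    unfolding pants_H_def I_def by blast
  obtain x where "\<forall>\<zeta>\<in>I. \<phi> \<zeta> = expand x \<zeta>" using pants_expansion_imp_expand[OF c] by blast
  with 0 have "\<phi> = expand x" by (auto simp: expand_def fun_eq_iff)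
  then show "\<phi> \<in> range expand" by simp
next
  fix \<phi> assume "\<phi> \<in> range expand"
  then show "\<phi> \<in> H"
    using pants_expansion_expand expand_holomorphic
    unfolding pants_H_def I_def[symmetric] by (auto simp: expand_def[of _ \<zeta> for \<zeta>])
qed

lemma expand_in_H [simp]: "expand x \<in> H"
  by (simp add: H_eq)

lemma norm_expand [simp]: "pnorm (expand x) = norm x"
  by (simp add: pants_norm_def norm_ell2_sq[symmetric])

lemma inner_expand [simp]: "pants_inner a r1 r2 (expand x) (expand y) = cip x y"
  by (simp add: pants_inner_def cip_def)

lemma expand_eq_iff [simp]: "expand x = expand y \<longleftrightarrow> x = y"
  using expand_inject by metis

lemma expand_0: "expand 0 = (\<lambda>\<zeta>. 0)"
  using expand_scaleC[of 0 0] by (simp add: scaleC_simps)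

text \<open>The zero function outside \<open>H\<close> is the normal form demanded by
  \<open>bounded_ops\<close>; it makes the transport injective and onto the bounded
  operators.\<close>

definition of_L :: "hop \<Rightarrow> operator" where
  "of_L B \<phi> = (if \<phi> \<in> H then expand (B (inv expand \<phi>)) else (\<lambda>\<zeta>. 0))"

lemma of_L_expand [simp]: "of_L B (expand x) = expand (B x)"
proof -
  have "inv expand (expand x) = x" by (rule inv_f_f) (simp add: inj_def)
  then show ?thesis by (simp add: of_L_def)
qed

lemma of_L_outside [simp]: "\<phi> \<notin> H \<Longrightarrow> of_L B \<phi> = (\<lambda>\<zeta>. 0)"
  by (simp add: of_L_def)

lemma of_L_eqI:
  assumes "\<And>x. T (expand x) = expand (blinfun_apply B x)" "\<And>\<phi>. \<phi> \<notin> H \<Longrightarrow> T \<phi> = (\<lambda>\<zeta>. 0)"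
  shows "T = of_L B"
proof
  fix \<phi> show "T \<phi> = of_L B \<phi>"
    by (cases "\<phi> \<in> H") (use assms in \<open>auto simp: H_eq\<close>)
qed

lemma of_L_inject [simp]: "of_L S = of_L T \<longleftrightarrow> S = T"
proof
  assume "of_L S = of_L T"
  then have "expand (S x) = expand (T x)" for x by (metis of_L_expand)
  then show "S = T" by (intro blinfun_eqI) simp
qed simp

lemma of_L_add: "(\<lambda>\<phi> \<zeta>. of_L S \<phi> \<zeta> + of_L T \<phi> \<zeta>) = of_L (S + T)"
  by (rule of_L_eqI) (simp_all add: blinfun.add_left expand_add)

lemma of_L_diff: "(\<lambda>\<phi> \<zeta>. of_L S \<phi> \<zeta> - of_L T \<phi> \<zeta>) = of_L (S - T)"
  by (rule of_L_eqI) (simp_all add: blinfun.diff_left expand_diff)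

lemma of_L_cmul: "(\<lambda>\<phi> \<zeta>. c * of_L T \<phi> \<zeta>) = of_L (cmul c o\<^sub>L T)"
  by (rule of_L_eqI) (simp_all add: expand_scaleC)

lemma of_L_0: "(\<lambda>\<phi> \<zeta>. 0) = of_L 0"
  by (rule of_L_eqI) (simp_all add: expand_0)

lemma of_L_compose: "of_L S \<circ> of_L T = of_L (S o\<^sub>L T)"
proof (rule of_L_eqI)
  have "of_L S (\<lambda>\<zeta>. 0) = (\<lambda>\<zeta>. 0)"
    using of_L_expand[of S 0] by (simp add: expand_0 blinfun.zero_right)
  then show "(of_L S \<circ> of_L T) \<phi> = (\<lambda>\<zeta>. 0)" if "\<phi> \<notin> H" for \<phi> using that by simp
qed simp

lemma bounded_ops_eq: "bounded_ops a r1 r2 = of_L ` {B. clin B}"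
proof (intro equalityI subsetI)
  fix T assume T: "T \<in> bounded_ops a r1 r2"
  define f where "f x = inv expand (T (expand x))" for x
  have ex: "expand (f x) = T (expand x)" for x
  proof -
    have "T (expand x) \<in> range expand" using T unfolding bounded_ops_def H_eq by blast
    then show ?thesis unfolding f_def by (rule f_inv_into_f)
  qed
  have add: "f (x + y) = f x + f y" for x y
  proof -
    have "T (\<lambda>\<zeta>. expand x \<zeta> + expand y \<zeta>) = (\<lambda>\<zeta>. T (expand x) \<zeta> + T (expand y) \<zeta>)"
      using T unfolding bounded_ops_def by simp
    then have "expand (f (x + y)) = expand (f x + f y)" by (simp add: ex expand_add)
    then show ?thesis by simp
  qed
  have scale: "f (scaleC k x) = scaleC k (f x)" for k x
  proof -
    have "T (\<lambda>\<zeta>. k * expand x \<zeta>) = (\<lambda>\<zeta>. k * T (expand x) \<zeta>)"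
      using T unfolding bounded_ops_def by simp
    then have "expand (f (scaleC k x)) = expand (scaleC k (f x))" by (simp add: ex expand_scaleC)
    then show ?thesis by simp
  qed
  obtain C where "\<forall>\<phi>\<in>H. pnorm (T \<phi>) \<le> C * pnorm \<phi>"
    using T unfolding bounded_ops_def by blast
  then have C: "norm (f x) \<le> C * norm x" for x
    using norm_expand[of "f x"] unfolding ex by (metis expand_in_H norm_expand)
  have sR: "r *\<^sub>R x = scaleC (of_real r) x" for r and x :: hvec by (rule ell2_eqI) simp
  have "bounded_linear f"
    by (rule bounded_linear_intro[of _ C]) (use add scale C in \<open>auto simp: sR mult.commute\<close>)
  then have B: "blinfun_apply (Blinfun f) = f" by (rule bounded_linear_Blinfun_apply)
  have "T = of_L (Blinfun f)"
    by (rule of_L_eqI) (use T in \<open>auto simp: B ex bounded_ops_def\<close>)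
  moreover have "clin (Blinfun f)" by (simp add: clin_def B scale)
  ultimately show "T \<in> of_L ` {B. clin B}" by blast
next
  fix T assume "T \<in> of_L ` {B. clin B}"
  then obtain B where B: "T = of_L B" "clin B" by blast
  have "of_L B (\<lambda>\<zeta>. expand x \<zeta> + expand y \<zeta>) = (\<lambda>\<zeta>. of_L B (expand x) \<zeta> + of_L B (expand y) \<zeta>)" for x y
    unfolding expand_add[symmetric] of_L_expand by (simp add: blinfun.add_right)
  moreover have "of_L B (\<lambda>\<zeta>. k * expand x \<zeta>) = (\<lambda>\<zeta>. k * of_L B (expand x) \<zeta>)" for k x
    unfolding expand_scaleC[symmetric] of_L_expand using B(2) by (simp add: clin_def)
  moreover have "\<exists>C. \<forall>x. norm (B x) \<le> C * norm x" using norm_blinfun by blast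
  ultimately show "T \<in> bounded_ops a r1 r2" unfolding B bounded_ops_def by (auto simp: H_eq)
qed

lemma op_norm_of_L: "op_norm a r1 r2 (of_L B) = norm B"
proof -
  have eq: "op_norm a r1 r2 (of_L B) = (SUP x\<in>{x. norm x \<le> 1}. norm (B x))"
  proof -
    have "{\<phi> \<in> H. pnorm \<phi> \<le> 1} = expand ` {x. norm x \<le> 1}" by (auto simp: H_eq)
    then show ?thesis by (simp add: op_norm_def image_image)
  qed
  have ub: "norm (B x) \<le> norm B" if "norm x \<le> 1" for x
    using norm_blinfun[of B x] mult_left_le[OF that, of "norm B"] by simp
  have bdd: "bdd_above ((\<lambda>x. norm (B x)) ` {x. norm x \<le> 1})"
    by (rule bdd_aboveI[of _ "norm B"]) (use ub in auto)
  show ?thesis unfolding eq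
  proof (rule antisym)
    have "0 \<in> {x :: hvec. norm x \<le> 1}" by simp
    then show "(SUP x\<in>{x. norm x \<le> 1}. norm (B x)) \<le> norm B"
      by (intro cSUP_least ub) blast+
    show "norm B \<le> (SUP x\<in>{x. norm x \<le> 1}. norm (B x))"
    proof (rule norm_blinfun_bound_unit)
      show "norm (B x) \<le> (SUP x\<in>{x. norm x \<le> 1}. norm (B x))" if "norm x \<le> 1" for x
        by (rule cSUP_upper[OF _ bdd]) (use that in simp)
      from this[of 0] show "0 \<le> (SUP x\<in>{x. norm x \<le> 1}. norm (B x))"
        by (simp add: blinfun.zero_right)
    qed
  qed
qed

lemma op_adjoint_of_L:
  assumes "clin B"
  shows "op_adjoint a r1 r2 (of_L B) = of_L (adj B)"
  unfolding op_adjoint_def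
proof (rule the_equality)
  show "of_L (adj B) \<in> bounded_ops a r1 r2 \<and> (\<forall>\<phi>\<in>H. \<forall>\<psi>\<in>H.
      pants_inner a r1 r2 (of_L B \<phi>) \<psi> = pants_inner a r1 r2 \<phi> (of_L (adj B) \<psi>))"
    using assms by (auto simp: bounded_ops_eq H_eq cip_adj)
next
  fix S assume S: "S \<in> bounded_ops a r1 r2 \<and> (\<forall>\<phi>\<in>H. \<forall>\<psi>\<in>H.
      pants_inner a r1 r2 (of_L B \<phi>) \<psi> = pants_inner a r1 r2 \<phi> (S \<psi>))"
  then obtain S' where S': "S = of_L S'" unfolding bounded_ops_eq by blast
  have "cip (B x) y = cip x (S' y)" for x y
    using S[THEN conjunct2, rule_format, of "expand x" "expand y"] by (simp add: S')
  then have "inner (B x) y = inner x (S' y)" for x y by (simp add: inner_ell2_def)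
  then have "adj B = S'" by (rule adj_eqI)
  then show "S = of_L (adj B)" by (simp add: S')
qed

lemma compact_ops_eq: "compact_ops a r1 r2 = of_L ` {B. clin B \<and> comp_op B}"
proof -
  \<comment> \<open>Separating hypothesis and conclusion of \<open>compact_ops\<close> allows the
    latter to be rewritten for sequences of the form \<open>expand (x n)\<close>.\<close>
  define P where "P \<phi> \<longleftrightarrow> (\<forall>n::nat. \<phi> n \<in> H \<and> pnorm (\<phi> n) \<le> 1)" for \<phi>
  define Q where "Q T \<phi> \<longleftrightarrow> (\<exists>s. strict_mono (s :: nat \<Rightarrow> nat) \<and>
      (\<exists>\<psi>\<in>H. (\<lambda>n. pnorm (\<lambda>\<zeta>. T (\<phi> (s n)) \<zeta> - \<psi> \<zeta>)) \<longlonglongrightarrow> 0))"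
    for T :: operator and \<phi>
  have Q: "Q (of_L B) (\<lambda>n. expand (x n)) \<longleftrightarrow> (\<exists>s l. strict_mono s \<and> (\<lambda>n. B (x (s n))) \<longlonglongrightarrow> l)" for B x
    by (simp add: Q_def H_eq expand_diff[symmetric] tendsto_norm_zero_iff LIM_zero_iff)
  have "(\<forall>\<phi>. P \<phi> \<longrightarrow> Q (of_L B) \<phi>) = comp_op B" for B
  proof
    assume L: "\<forall>\<phi>. P \<phi> \<longrightarrow> Q (of_L B) \<phi>"
    have "Q (of_L B) (\<lambda>n. expand (x n))" if "\<forall>n. norm (x n) \<le> 1" for x
      by (rule L[THEN spec, THEN mp]) (simp add: P_def that)
    then show "comp_op B" unfolding comp_op_def Q by simp
  next
    assume B: "comp_op B"
    show "\<forall>\<phi>. P \<phi> \<longrightarrow> Q (of_L B) \<phi>"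
    proof (intro allI impI)
      fix \<phi> assume P: "P \<phi>"
      then have "\<forall>n. \<exists>x. \<phi> n = expand x" unfolding P_def H_eq by blast
      then obtain x where "\<And>n. \<phi> n = expand (x n)" by metis
      then have x: "\<phi> = (\<lambda>n. expand (x n))" by auto
      then have "\<forall>n. norm (x n) \<le> 1" using P by (simp add: P_def)
      then show "Q (of_L B) \<phi>" unfolding x Q using B by (simp add: comp_op_def)
    qed
  qed
  moreover have "compact_ops a r1 r2 = {T \<in> bounded_ops a r1 r2. \<forall>\<phi>. P \<phi> \<longrightarrow> Q T \<phi>}"
    unfolding compact_ops_def P_def Q_def ..
  ultimately show ?thesis unfolding bounded_ops_eq by (auto simp only: mem_Collect_eq)
qed

lemma mult_z_eq: "mult_z a r1 r2 = of_L Z"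
  by (rule of_L_eqI) (auto simp: mult_z_def expand_Z)

lemma of_L_in_image [simp]: "of_L B \<in> of_L ` A \<longleftrightarrow> B \<in> A"
  by auto

lemma is_cstar_subalgebra_Alg: "is_cstar_subalgebra a r1 r2 (of_L ` Alg)"
  unfolding is_cstar_subalgebra_def
proof (intro conjI ballI allI impI)
  note c = csub_Alg[unfolded csub_def]
  show "of_L ` Alg \<subseteq> bounded_ops a r1 r2" using c by (auto simp: bounded_ops_eq)
  show "(\<lambda>\<phi> \<zeta>. 0) \<in> of_L ` Alg" using c by (simp add: of_L_0)
  show "(\<lambda>\<phi> \<zeta>. S \<phi> \<zeta> + T \<phi> \<zeta>) \<in> of_L ` Alg" if "S \<in> of_L ` Alg" "T \<in> of_L ` Alg" for S T
    using that c by (auto simp: of_L_add)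
  show "(\<lambda>\<phi> \<zeta>. k * T \<phi> \<zeta>) \<in> of_L ` Alg" if "T \<in> of_L ` Alg" for k T
    using that c by (auto simp: of_L_cmul)
  show "S \<circ> T \<in> of_L ` Alg" if "S \<in> of_L ` Alg" "T \<in> of_L ` Alg" for S T
    using that c by (auto simp: of_L_compose)
  show "op_adjoint a r1 r2 T \<in> of_L ` Alg" if "T \<in> of_L ` Alg" for T
    using that c by (auto simp: op_adjoint_of_L)
  fix f T assume f: "(\<forall>n::nat. f n \<in> of_L ` Alg) \<and> T \<in> bounded_ops a r1 r2 \<and>
        (\<lambda>n. op_norm a r1 r2 (\<lambda>\<phi> \<zeta>. f n \<phi> \<zeta> - T \<phi> \<zeta>)) \<longlonglongrightarrow> 0"
  define g where "g n = inv_into Alg of_L (f n)" for n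
  have g: "f n = of_L (g n)" "g n \<in> Alg" for n
    using f by (simp_all add: g_def f_inv_into_f inv_into_into)
  obtain B where B: "T = of_L B" using f unfolding bounded_ops_eq by blast
  have "(\<lambda>n. norm (g n - B)) \<longlonglongrightarrow> 0" using f by (simp add: g B of_L_diff op_norm_of_L)
  then have "g \<longlonglongrightarrow> B" by (rule LIM_zero_cancel[OF tendsto_norm_zero_cancel])
  then show "T \<in> of_L ` Alg" unfolding B of_L_in_image by (rule csub_closed[OF csub_Alg g(2)])
qed

text \<open>Pulls a competing subalgebra back to coefficients, so that \<open>Alg_least\<close>
  applies to it.\<close>

lemma csub_preimage:
  assumes A: "is_cstar_subalgebra a r1 r2 A"
  shows "csub {B. clin B \<and> of_L B \<in> A}"
  unfolding csub_def
proof (intro conjI ballI allI impI)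
  let ?B = "{B. clin B \<and> of_L B \<in> A}"
  note c = A[unfolded is_cstar_subalgebra_def]
  show "T \<in> ?B \<Longrightarrow> clin T" for T by simp
  show "0 \<in> ?B" using c by (simp add: of_L_0)
  show "S + T \<in> ?B"
    if "S \<in> ?B" "T \<in> ?B" for S T
    using that c by (auto simp: of_L_add[symmetric])
  show "cmul k o\<^sub>L T \<in> ?B" if "T \<in> ?B" for k T
    using that c by (auto simp: of_L_cmul[symmetric])
  show "S o\<^sub>L T \<in> ?B"
    if "S \<in> ?B" "T \<in> ?B" for S T
    using that c by (auto simp: of_L_compose[symmetric])
  show "adj T \<in> ?B" if "T \<in> ?B" for T
    using that c by (auto simp: op_adjoint_of_L[symmetric])
  fix f :: "nat \<Rightarrow> hop" and T assume f: "(\<forall>n. f n \<in> ?B) \<and> f \<longlonglongrightarrow> T"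
  then have T: "clin T" using clin_limit[of f T] by blast
  have "(\<lambda>n. op_norm a r1 r2 (\<lambda>\<phi> \<zeta>. of_L (f n) \<phi> \<zeta> - of_L T \<phi> \<zeta>)) \<longlonglongrightarrow> 0"
    using f by (simp add: of_L_diff op_norm_of_L tendsto_norm_zero_iff LIM_zero_iff)
  moreover have "of_L T \<in> bounded_ops a r1 r2" using T by (simp add: bounded_ops_eq)
  moreover have "\<forall>n. of_L (f n) \<in> A" using f by simp
  ultimately have "of_L T \<in> A"
    using c[THEN conjunct2, THEN conjunct2, THEN conjunct2, THEN conjunct2, THEN conjunct2, THEN conjunct2,
      rule_format, of "\<lambda>n. of_L (f n)" "of_L T"] by blast
  with T show "T \<in> ?B" by simp
qed

lemma cstar_z_carrier: "cs_carrier (cstar_z a r1 r2) = of_L ` Alg"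
proof -
  have "\<Inter>{A. is_cstar_subalgebra a r1 r2 A \<and> mult_z a r1 r2 \<in> A} = of_L ` Alg"
  proof (intro equalityI Inter_lower Inter_greatest)
    show "of_L ` Alg \<in> {A. is_cstar_subalgebra a r1 r2 A \<and> mult_z a r1 r2 \<in> A}"
      by (simp add: is_cstar_subalgebra_Alg mult_z_eq Z_in_Alg)
    fix A assume "A \<in> {A. is_cstar_subalgebra a r1 r2 A \<and> mult_z a r1 r2 \<in> A}"
    then have A: "is_cstar_subalgebra a r1 r2 A" "of_L Z \<in> A" by (auto simp: mult_z_eq)
    have "Alg \<subseteq> {B. clin B \<and> of_L B \<in> A}"
      by (rule Alg_least[OF csub_preimage[OF A(1)]]) (simp add: A(2))
    then show "of_L ` Alg \<subseteq> A" by blast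
  qed
  then show ?thesis by (simp add: cstar_z_def)
qed

end

text \<open>Extension by zero, the representation of functions in \<open>C_circle\<close>.\<close>

definition on_circle :: "(complex \<Rightarrow> complex) \<Rightarrow> complex \<Rightarrow> complex" where
  "on_circle f u = (if cmod u = 1 then f u else 0)"

context pair_of_pants
begin

section \<open>The quotient by the compact operators\<close>

abbreviation A :: "operator cstar" where "A \<equiv> cstar_z a r1 r2"
abbreviation K :: "operator set" where "K \<equiv> compact_ops a r1 r2"

definition coset :: "hop \<Rightarrow> operator set" where
  "coset T = cs_coset A K (of_L T)"

lemma coset_eq: "coset T = of_L ` {S. clin (S - T) \<and> comp_op (S - T)}"
proof -
  have "coset T = (\<lambda>k. of_L (T + k)) ` {k. clin k \<and> comp_op k}"
    by (simp add: coset_def cs_coset_def cstar_z_def compact_ops_eq image_image of_L_add)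
  also have "\<dots> = of_L ` (\<lambda>k. T + k) ` {k. clin k \<and> comp_op k}" by (simp add: image_image)
  also have "(\<lambda>k. T + k) ` {k. clin k \<and> comp_op k} = {S. clin (S - T) \<and> comp_op (S - T)}"
  proof (intro equalityI subsetI)
    fix S assume "S \<in> {S. clin (S - T) \<and> comp_op (S - T)}"
    then show "S \<in> (\<lambda>k. T + k) ` {k. clin k \<and> comp_op k}" by (intro image_eqI[of _ _ "S - T"]) auto
  qed auto
  finally show ?thesis .
qed

lemma of_L_in_coset [simp]: "of_L S \<in> coset T \<longleftrightarrow> clin (S - T) \<and> comp_op (S - T)"
  by (auto simp: coset_eq)

lemma in_cosetE:
  assumes "x \<in> coset T"
  obtains S where "x = of_L S" "clin (S - T)" "comp_op (S - T)"
  using assms by (auto simp: coset_eq)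

lemma coset_self: "of_L T \<in> coset T"
  by simp

lemma coset_ne: "coset T \<noteq> {}"
  using coset_self by blast

lemma coset_cong:
  assumes "clin (S - T)" "comp_op (S - T)"
  shows "coset S = coset T"
proof -
  have "clin (R - S) \<and> comp_op (R - S) \<longleftrightarrow> clin (R - T) \<and> comp_op (R - T)" for R
  proof
    assume "clin (R - S) \<and> comp_op (R - S)"
    moreover have "R - T = (R - S) + (S - T)" by simp
    ultimately show "clin (R - T) \<and> comp_op (R - T)" using assms by (metis clin_add comp_op_add)
  next
    assume "clin (R - T) \<and> comp_op (R - T)"
    moreover have "R - S = (R - T) - (S - T)" by simp
    ultimately show "clin (R - S) \<and> comp_op (R - S)" using assms by (metis clin_diff comp_op_diff)
  qed
  then show ?thesis by (simp add: coset_eq)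
qed

abbreviation Q :: "operator set cstar" where "Q \<equiv> cs_quotient A K"

lemma Q_carrier: "cs_carrier Q = coset ` Alg"
  by (simp add: cs_quotient_def cstar_z_carrier image_image coset_def[abs_def])

text \<open>The ideal property makes all members of the union in \<open>cs_quotient\<close> the same
  coset. The other quotient operations are handled in this way too.\<close>

lemma Q_add:
  "cs_add Q (coset S) (coset T) = coset (S + T)"
proof -
  have "cs_coset A K (cs_add A x y) = coset (S + T)" if xy: "x \<in> coset S" "y \<in> coset T" for x y
  proof -
    obtain S' T' where S': "x = of_L S'" "clin (S' - S)" "comp_op (S' - S)"
      and T': "y = of_L T'" "clin (T' - T)" "comp_op (T' - T)"
      using xy by (auto elim!: in_cosetE)
    have "clin ((S' - S) + (T' - T))" "comp_op ((S' - S) + (T' - T))"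
      using S' T' by (auto intro: comp_op_add)
    then have "coset (S' + T') = coset (S + T)" by (intro coset_cong) (simp_all add: algebra_simps)
    then show ?thesis by (simp add: S' T' coset_def cstar_z_def of_L_add)
  qed
  then show ?thesis using coset_ne[of S] coset_ne[of T] unfolding cs_quotient_def by auto
qed

lemma Q_scale: "cs_scale Q c (coset T) = coset (cmul c o\<^sub>L T)"
proof -
  have "cs_coset A K (cs_scale A c y) = coset (cmul c o\<^sub>L T)" if y: "y \<in> coset T" for y
  proof -
    obtain T' where T': "y = of_L T'" "clin (T' - T)" "comp_op (T' - T)"
      using y by (auto elim!: in_cosetE)
    have "(cmul c o\<^sub>L T') - (cmul c o\<^sub>L T) = cmul c o\<^sub>L (T' - T)"
      by (simp add: bounded_bilinear.diff_right[OF bounded_bilinear_blinfun_compose])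
    then have "coset (cmul c o\<^sub>L T') = coset (cmul c o\<^sub>L T)"
      using T' by (intro coset_cong) (auto intro: comp_op_cmul)
    then show ?thesis by (simp add: T' coset_def cstar_z_def of_L_cmul)
  qed
  then show ?thesis using coset_ne[of T] unfolding cs_quotient_def by auto
qed

lemma Q_mult:
  assumes "clin S" "clin T"
  shows "cs_mult Q (coset S) (coset T) = coset (S o\<^sub>L T)"
proof -
  have "cs_coset A K (cs_mult A x y) = coset (S o\<^sub>L T)" if xy: "x \<in> coset S" "y \<in> coset T" for x y
  proof -
    obtain S' T' where S': "x = of_L S'" "clin (S' - S)" "comp_op (S' - S)"
      and T': "y = of_L T'" "clin (T' - T)" "comp_op (T' - T)"
      using xy by (auto elim!: in_cosetE)
    have "clin ((T' - T) + T)" using T'(2) assms(2) by (rule clin_add)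
    then have lT': "clin T'" by simp
    have eq: "(S' o\<^sub>L T') - (S o\<^sub>L T) = ((S' - S) o\<^sub>L T') + (S o\<^sub>L (T' - T))"
      by (simp add: bounded_bilinear.diff_right[OF bounded_bilinear_blinfun_compose]
          bounded_bilinear.diff_left[OF bounded_bilinear_blinfun_compose])
    have "coset (S' o\<^sub>L T') = coset (S o\<^sub>L T)"
    proof (rule coset_cong)
      show "clin ((S' o\<^sub>L T') - (S o\<^sub>L T))" unfolding eq
        using S' T' lT' assms by (intro clin_add clin_compose)
      show "comp_op ((S' o\<^sub>L T') - (S o\<^sub>L T))" unfolding eq
        by (intro comp_op_add comp_op_compose_right[OF S'(3)] comp_op_compose_left[OF T'(3)])
    qed
    then show ?thesis by (simp add: S' T' coset_def cstar_z_def of_L_compose)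
  qed
  then show ?thesis using coset_ne[of S] coset_ne[of T] unfolding cs_quotient_def by auto
qed

lemma Q_star:
  assumes "clin T"
  shows "cs_star Q (coset T) = coset (adj T)"
proof -
  have "cs_coset A K (cs_star A y) = coset (adj T)" if y: "y \<in> coset T" for y
  proof -
    obtain T' where T': "y = of_L T'" "clin (T' - T)" "comp_op (T' - T)"
      using y by (auto elim!: in_cosetE)
    have "clin ((T' - T) + T)" using T'(2) assms by (rule clin_add)
    then have lT': "clin T'" by simp
    have "coset (adj T') = coset (adj T)"
      using T' clin_adj[OF T'(2)] comp_op_adj[OF T'(3)] by (intro coset_cong) (simp_all add: adj_diff)
    then show ?thesis using lT' by (simp add: T' coset_def cstar_z_def op_adjoint_of_L)
  qed
  then show ?thesis using coset_ne[of T] unfolding cs_quotient_def by auto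
qed

lemma Q_norm: "cs_norm Q (coset T) = (INF k\<in>{k. clin k \<and> comp_op k}. norm (T + k))"
proof -
  have "coset T = (\<lambda>k. of_L (T + k)) ` {k. clin k \<and> comp_op k}"
    by (simp add: coset_def cs_coset_def cstar_z_def compact_ops_eq image_image of_L_add)
  then have "cs_norm Q (coset T) = (INF x\<in>(\<lambda>k. of_L (T + k)) ` {k. clin k \<and> comp_op k}. op_norm a r1 r2 x)"
    by (simp add: cs_quotient_def cstar_z_def)
  then show ?thesis by (simp add: image_image op_norm_of_L)
qed

text \<open>The identification of continuous functions on \<open>X\<close> with triples on the unit
  circle. The circles are parametrized by \<open>u\<close> instead of the \<open>cnj u\<close> of
  \<open>acts3\<close>; either choice runs through the same points.\<close>

definition circles :: "(complex \<Rightarrow> complex) \<Rightarrow>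
    (complex \<Rightarrow> complex) \<times> (complex \<Rightarrow> complex) \<times> (complex \<Rightarrow> complex)" where
  "circles F = (on_circle F, on_circle (\<lambda>u. F (of_real r1 * u)), on_circle (\<lambda>u. F (of_real a + of_real r2 * u)))"

lemma X_cases:
  "w \<in> X \<longleftrightarrow> (\<exists>u. cmod u = 1 \<and> (w = u \<or> w = of_real r1 * u \<or> w = of_real a + of_real r2 * u))"
proof
  assume "w \<in> X"
  then consider "cmod w = 1" | "cmod w = r1" | "cmod (w - of_real a) = r2"
    by (auto simp: X_def dist_norm norm_minus_commute)
  then show "\<exists>u. cmod u = 1 \<and> (w = u \<or> w = of_real r1 * u \<or> w = of_real a + of_real r2 * u)"
  proof cases
    case 2
    then show ?thesis using r1_pos by (intro exI[of _ "w / of_real r1"]) (simp add: norm_divide)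
  next
    case 3
    then show ?thesis using r2_pos by (intro exI[of _ "(w - of_real a) / of_real r2"]) (simp add: norm_divide)
  qed blast
next
  assume "\<exists>u. cmod u = 1 \<and> (w = u \<or> w = of_real r1 * u \<or> w = of_real a + of_real r2 * u)"
  then show "w \<in> X" using r1_pos r2_pos by (auto simp: X_def dist_norm norm_mult)
qed

lemma circles_eq_iff: "circles F = circles G \<longleftrightarrow> (\<forall>w\<in>X. F w = G w)"
proof -
  have "circles F = circles G \<longleftrightarrow> (\<forall>u. cmod u = 1 \<longrightarrow> F u = G u \<and> F (of_real r1 * u) = G (of_real r1 * u) \<and>
      F (of_real a + of_real r2 * u) = G (of_real a + of_real r2 * u))"
    unfolding circles_def on_circle_def[abs_def] fun_eq_iff prod.inject by (meson)
  also have "\<dots> \<longleftrightarrow> (\<forall>w\<in>X. F w = G w)" unfolding Ball_def X_cases by blast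
  finally show ?thesis .
qed

abbreviation C3 :: "((complex \<Rightarrow> complex) \<times> (complex \<Rightarrow> complex) \<times> (complex \<Rightarrow> complex)) cstar" where
  "C3 \<equiv> C_circle \<oplus>\<^sub>C C_circle \<oplus>\<^sub>C C_circle"

lemma circles_carrier:
  assumes "continuous_on X F"
  shows "circles F \<in> cs_carrier C3"
proof -
  have "continuous_on (sphere 0 1) F" "continuous_on (sphere 0 1) (\<lambda>u. F (of_real r1 * u))"
    "continuous_on (sphere 0 1) (\<lambda>u. F (of_real a + of_real r2 * u))"
    by (intro continuous_on_compose2[OF assms] continuous_intros; auto simp: X_cases)+
  then have "continuous_on (sphere 0 1) (on_circle F)" "continuous_on (sphere 0 1) (on_circle (\<lambda>u. F (of_real r1 * u)))"
    "continuous_on (sphere 0 1) (on_circle (\<lambda>u. F (of_real a + of_real r2 * u)))"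
    by (auto intro: continuous_on_eq simp: on_circle_def)
  then show ?thesis by (simp add: cs_dsum_def C_circle_def circles_def on_circle_def)
qed

text \<open>The circle around \<open>a\<close> lies strictly between the two centred at 0. The three
  closed pieces are therefore disjoint, and the function defined by cases is continuous on their
  union.\<close>

lemma circles_surj:
  assumes "t \<in> cs_carrier C3"
  shows "\<exists>F. continuous_on X F \<and> circles F = t"
proof -
  obtain f g h where t: "t = (f, g, h)" by (cases t)
  have f: "continuous_on (sphere 0 1) f" "\<And>u. cmod u \<noteq> 1 \<Longrightarrow> f u = 0"
    and g: "continuous_on (sphere 0 1) g" "\<And>u. cmod u \<noteq> 1 \<Longrightarrow> g u = 0"
    and h: "continuous_on (sphere 0 1) h" "\<And>u. cmod u \<noteq> 1 \<Longrightarrow> h u = 0"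
    using assms by (auto simp: t cs_dsum_def C_circle_def)
  have d1: "cmod (of_real a + of_real r2 * u) < 1" "cmod (of_real a + of_real r2 * u) > r1" if "cmod u = 1" for u
    using norm_triangle_ineq[of "of_real a" "of_real r2 * u"] norm_triangle_ineq2[of "of_real a" "- (of_real r2 * u)"]
      that a_pos r2_pos outer disjoint by (simp_all add: norm_mult)
  have r1_less: "r1 < 1" using disjoint r2_pos a_less by simp
  have sph: "w \<in> sphere (of_real a) r2 \<longleftrightarrow> cmod (w - of_real a) = r2" for w :: complex
    by (metis dist_commute dist_norm mem_sphere)
  define F where "F w = (if cmod w = 1 then f w else if cmod w = r1 then g (w / of_real r1)
      else h ((w - of_real a) / of_real r2))" for w
  have F1: "F u = f u" "F (of_real r1 * u) = g u" "F (of_real a + of_real r2 * u) = h u" if "cmod u = 1" for u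
    using that d1[OF that] r1_pos r2_pos r1_less by (auto simp: F_def norm_mult)
  have "continuous_on (sphere 0 1) F"
    by (rule continuous_on_eq[OF f(1)]) (simp add: F1)
  moreover have "continuous_on (sphere 0 r1) F"
  proof (rule continuous_on_eq)
    show "continuous_on (sphere 0 r1) (\<lambda>w. g (w / of_real r1))"
      by (intro continuous_on_compose2[OF g(1)] continuous_intros) (use r1_pos in \<open>auto simp: norm_divide\<close>)
    show "g (w / of_real r1) = F w" if "w \<in> sphere 0 r1" for w
      using that r1_less by (simp add: F_def)
  qed
  moreover have "continuous_on (sphere (of_real a) r2) F"
  proof (rule continuous_on_eq)
    show "continuous_on (sphere (of_real a) r2) (\<lambda>w. h ((w - of_real a) / of_real r2))"
      by (intro continuous_on_compose2[OF h(1)] continuous_intros)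
        (use r2_pos in \<open>auto simp: norm_divide sph simp del: mem_sphere\<close>)
    show "h ((w - of_real a) / of_real r2) = F w" if "w \<in> sphere (of_real a) r2" for w
    proof -
      define u where "u = (w - of_real a) / of_real r2"
      have u: "cmod u = 1" "of_real a + of_real r2 * u = w"
        using that[unfolded sph] r2_pos by (auto simp: u_def norm_divide)
      show ?thesis using F1(3)[OF u(1)] unfolding u(2) by (simp only: u_def)
    qed
  qed
  ultimately have "continuous_on X F"
    unfolding X_def by (intro continuous_on_closed_Un) auto
  moreover have "circles F = t"
    using F1 f(2) g(2) h(2) by (auto simp: t circles_def on_circle_def fun_eq_iff)
  ultimately show ?thesis by blast
qed

lemma circles_ops:
  "circles (\<lambda>w. F w + G w) = cs_add C3 (circles F) (circles G)"
  "circles (\<lambda>w. c * F w) = cs_scale C3 c (circles F)"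
  "circles (\<lambda>w. F w * G w) = cs_mult C3 (circles F) (circles G)"
  "circles (\<lambda>w. cnj (F w)) = cs_star C3 (circles F)"
  by (auto simp: circles_def cs_dsum_def C_circle_def on_circle_def fun_eq_iff)

lemma circles_norm_bounds:
  assumes F: "continuous_on X F"
  shows "w \<in> X \<Longrightarrow> cmod (F w) \<le> cs_norm C3 (circles F)"
    and "(\<And>w. w \<in> X \<Longrightarrow> cmod (F w) \<le> M) \<Longrightarrow> cs_norm C3 (circles F) \<le> M"
proof -
  define s where "s f = (SUP u\<in>sphere 0 1. cmod (f u))" for f :: "complex \<Rightarrow> complex"
  have norm: "cs_norm C3 (circles F) = max (s (on_circle F)) (max (s (on_circle (\<lambda>u. F (of_real r1 * u))))
      (s (on_circle (\<lambda>u. F (of_real a + of_real r2 * u)))))"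
    by (simp add: cs_dsum_def C_circle_def circles_def s_def)
  have "bounded (F ` X)" using F compact_X by (intro compact_imp_bounded compact_continuous_image)
  then obtain B where B: "\<And>w. w \<in> X \<Longrightarrow> cmod (F w) \<le> B" unfolding bounded_iff by blast
  have up: "cmod (f u) \<le> s (on_circle f)" if "cmod u = 1" "\<And>u. cmod u = 1 \<Longrightarrow> cmod (f u) \<le> B" for f u
  proof -
    have "cmod (on_circle f u) \<le> s (on_circle f)"
      unfolding s_def by (rule cSUP_upper) (use that in \<open>auto simp: on_circle_def intro!: bdd_aboveI[of _ B]\<close>)
    then show ?thesis using that(1) by (simp add: on_circle_def)
  qed
  show "cmod (F w) \<le> cs_norm C3 (circles F)" if "w \<in> X"
  proof -
    obtain u where u: "cmod u = 1" and w: "w = u \<or> w = of_real r1 * u \<or> w = of_real a + of_real r2 * u"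
      using \<open>w \<in> X\<close> unfolding X_cases by blast
    have "cmod (F u) \<le> s (on_circle F)"
      "cmod (F (of_real r1 * u)) \<le> s (on_circle (\<lambda>u. F (of_real r1 * u)))"
      "cmod (F (of_real a + of_real r2 * u)) \<le> s (on_circle (\<lambda>u. F (of_real a + of_real r2 * u)))"
      by (rule up[OF u], rule B, force simp: X_cases)+
    then show ?thesis using w unfolding norm by (auto simp: le_max_iff_disj)
  qed
  show "cs_norm C3 (circles F) \<le> M" if M: "\<And>w. w \<in> X \<Longrightarrow> cmod (F w) \<le> M"
  proof -
    have le: "s (on_circle f) \<le> M" if "\<And>u. cmod u = 1 \<Longrightarrow> cmod (f u) \<le> M" for f
    proof -
      have "sphere (0::complex) 1 \<noteq> {}" by simp
      then show ?thesis unfolding s_def by (rule cSUP_least) (use that in \<open>auto simp: on_circle_def\<close>)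
    qed
    show ?thesis unfolding norm
      by (intro max.boundedI le M) (auto simp: X_cases)
  qed
qed

text \<open>The quotient norm is the distance to the compact operators, bounded from below by
  \<open>symb_lower\<close> and from above, up to any \<open>e\<close>, by
  \<open>symb_upper\<close>.\<close>

lemma Q_norm_symb:
  assumes "symb T F"
  shows "cs_norm Q (coset T) = cs_norm C3 (circles F)"
proof -
  note F = symb_continuous[OF assms]
  let ?N = "cs_norm C3 (circles F)" and ?C = "{k. clin k \<and> comp_op k}"
  have "(0 :: hop) \<in> ?C" by simp
  then have ne: "?C \<noteq> {}" by blast
  have "?N \<le> (INF k\<in>?C. norm (T + k))"
    by (rule cINF_greatest[OF ne], rule circles_norm_bounds(2)[OF F]) (use symb_lower[OF assms] in blast)
  moreover have "(INF k\<in>?C. norm (T + k)) \<le> ?N"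
  proof (rule field_le_epsilon)
    fix e :: real assume "e > 0"
    then obtain k where "comp_op k" "clin k" "norm (T + k) \<le> ?N + e"
      using symb_upper[OF assms circles_norm_bounds(1)[OF F]] by blast
    moreover from this have "(INF k\<in>?C. norm (T + k)) \<le> norm (T + k)"
      by (intro cINF_lower) (auto intro: bdd_belowI[of _ 0])
    ultimately show "(INF k\<in>?C. norm (T + k)) \<le> ?N + e" by linarith
  qed
  ultimately show ?thesis unfolding Q_norm by (rule antisym[rotated])
qed

lemma coset_eq_iff_symb:
  assumes "symb S F" "symb T G"
  shows "coset S = coset T \<longleftrightarrow> circles F = circles G"
proof
  assume "coset S = coset T"
  then have "comp_op (S - T)" "clin (S - T)" using coset_self[of S] by simp_all
  from symb_unique[OF symb_diff[OF assms] symb_comp[OF this]]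
  show "circles F = circles G" unfolding circles_eq_iff by (metis eq_iff_diff_eq_0)
next
  assume "circles F = circles G"
  then have "comp_op (S - T)"
    by (intro symb_zero_imp_comp[OF symb_diff[OF assms]]) (simp add: circles_eq_iff)
  moreover have "clin (S - T)" using assms by (intro clin_diff symb_clin)
  ultimately show "coset S = coset T" by (intro coset_cong)
qed

theorem quotient_isomorphic: "cstar_isomorphic Q C3"
proof -
  \<comment> \<open>A coset has many representatives, and a symbol is arbitrary off
    \<open>X\<close>. By \<open>coset_eq_iff_symb\<close> the triple is nevertheless unique.\<close>
  define h where "h x = (THE t. \<exists>T F. symb T F \<and> x = coset T \<and> t = circles F)" for x
  have h: "h (coset T) = circles F" if "symb T F" for T F
    unfolding h_def by (rule the_equality) (use that coset_eq_iff_symb in blast)+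
  have car: "\<exists>T F. symb T F \<and> x = coset T" if "x \<in> cs_carrier Q" for x
    using that unfolding Q_carrier Alg_def by blast
  have "bij_betw h (cs_carrier Q) (cs_carrier C3)"
    unfolding bij_betw_def
  proof
    show "inj_on h (cs_carrier Q)"
    proof (rule inj_onI)
      fix x y assume "x \<in> cs_carrier Q" "y \<in> cs_carrier Q" "h x = h y"
      then obtain S F T G where "symb S F" "x = coset S" "symb T G" "y = coset T" using car by metis
      then show "x = y" using \<open>h x = h y\<close> h coset_eq_iff_symb by metis
    qed
    show "h ` cs_carrier Q = cs_carrier C3"
    proof (intro equalityI subsetI)
      fix t assume "t \<in> h ` cs_carrier Q"
      then obtain T F where "symb T F" "t = h (coset T)" using car by blast
      then show "t \<in> cs_carrier C3" using circles_carrier symb_continuous h by metis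
    next
      fix t assume "t \<in> cs_carrier C3"
      then obtain F where F: "continuous_on X F" "circles F = t" using circles_surj by blast
      obtain T where T: "symb T F" using symb_surj[OF F(1)] by blast
      then have "coset T \<in> cs_carrier Q" unfolding Q_carrier Alg_def by blast
      then show "t \<in> h ` cs_carrier Q" using h[OF T] F(2) by (metis imageI)
    qed
  qed
  moreover have "h (cs_add Q x y) = cs_add C3 (h x) (h y)" "h (cs_mult Q x y) = cs_mult C3 (h x) (h y)"
    if xy: "x \<in> cs_carrier Q" "y \<in> cs_carrier Q" for x y
  proof -
    obtain S F T G where S: "symb S F" "x = coset S" and T: "symb T G" "y = coset T"
      using car[OF xy(1)] car[OF xy(2)] by blast
    show "h (cs_add Q x y) = cs_add C3 (h x) (h y)"
      unfolding S(2) T(2) Q_add h[OF S(1)] h[OF T(1)] h[OF symb_add[OF S(1) T(1)]] by (rule circles_ops)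
    show "h (cs_mult Q x y) = cs_mult C3 (h x) (h y)"
      unfolding S(2) T(2) Q_mult[OF symb_clin[OF S(1)] symb_clin[OF T(1)]] h[OF S(1)] h[OF T(1)]
        h[OF symb_mult[OF S(1) T(1)]] by (rule circles_ops)
  qed
  moreover have "h (cs_scale Q c x) = cs_scale C3 c (h x)" "h (cs_star Q x) = cs_star C3 (h x)"
    "cs_norm C3 (h x) = cs_norm Q x" if x: "x \<in> cs_carrier Q" for c x
  proof -
    obtain T F where T: "symb T F" "x = coset T" using car[OF x] by blast
    show "h (cs_scale Q c x) = cs_scale C3 c (h x)"
      unfolding T(2) Q_scale h[OF T(1)] h[OF symb_cmul[OF T(1)]] by (rule circles_ops)
    show "h (cs_star Q x) = cs_star C3 (h x)"
      unfolding T(2) Q_star[OF symb_clin[OF T(1)]] h[OF T(1)] h[OF symb_adj[OF T(1)]] by (rule circles_ops)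
    show "cs_norm C3 (h x) = cs_norm Q x"
      unfolding T(2) h[OF T(1)] Q_norm_symb[OF T(1)] ..
  qed
  ultimately show ?thesis unfolding cstar_isomorphic_def by (intro exI[of _ h]) simp
qed

end

theorem theorem3p15:
  fixes a r1 r2 :: real
  assumes "r1 > 0" and "r2 > 0" and "0 < a" and "a < 1"
    and "a + r2 < 1" and "r1 + r2 < a"
  shows "cstar_isomorphic (cs_quotient (cstar_z a r1 r2) (compact_ops a r1 r2))
           (C_circle \<oplus>\<^sub>C C_circle \<oplus>\<^sub>C C_circle)"
proof -
  interpret pair_of_pants a r1 r2 by standard (use assms in auto)
  show ?thesis by (rule quotient_isomorphic)
qed

end
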